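(* Let $\mathcal A=(d_0,\dots,d_k,\psi)$ be a neural network architecture with SAD activation function $\psi\colon\mathbb R\to\mathbb R$, and let $f\colon\mathbb R^{d_0}\to\mathbb R^{d_k}$ be a polynomial map of degree at least $2$. Then there exist an integer $N\in\mathbb N$ and a conull dense open subset $\mathcal D_N\subseteq(\mathbb R^{d_0})^N$ such that the following holds. For any measurable loss function $\ell\colon\mathbb R^{d_k}\times\mathbb R^{d_k}\to[0,\infty)$ and any probability measure $\mu$ on $\mathbb R^{d_0}$ such that either (i) $\mu=\frac1n\sum_{i=1}^n\delta_{x_i}$ for some $n\ge N$ and $x_1,\dots,x_n\in\mathbb R^{d_0}$ with $(x_1,\dots,x_N)\in\mathcal D_N$, or (ii) $d\mu(x)=p(x)\,dx$ for a measurable function $p\colon\mathbb R^{d_0}\to[0,\infty)$, or such that $\mu$ is a convex combination of a measure as in (i) and a measure as in (ii), the expected loss $\mathcal L(\theta)=\mathbb E_{x\sim\mu}[\ell(\mathcal N^{\mathcal A}_\theta(x),f(x))]$ satisfies $\mathcal L(\theta)>0$ for all $\theta\in\mathbb R^{d(\mathcal A)}$. Moreover, if $d_0=1$, then $\mathcal D_N$ can be chosen to be the set of all tuples $(x_1,\dots,x_N)$ with $x_1,\dots,x_N$ pairwise distinct.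
   Context: A function $g\colon\mathbb R^n\to\mathbb R^m$ is SAD (sublinear analytic definable) if (S) $\limsup_{t\to\infty}\|g(tx)\|/t<\infty$ for every $x\in\mathbb R^n$; (A) $g$ is real analytic; (D) $g$ is definable in some o-minimal structure. Here an o-minimal structure is a collection $\mathcal S_n\subseteq\mathcal P(\mathbb R^n)$, $n\in\mathbb N$, closed under finite Boolean operations, Cartesian products and coordinate projections, containing $\{p>0\}$ and $\{p=0\}$ for all real polynomials $p$, and such that every set in $\mathcal S_1$ is a finite union of points and intervals; a function is definable if its graph lies in some $\mathcal S_n$. A loss function is a function $\ell\colon\mathbb R^n\times\mathbb R^n\to[0,\infty)$ with $\ell(x,y)=0\iff x=y$. A neural network architecture is $\mathcal A=(d_0,\dots,d_k,\psi)$ with positive integers $d_i$ and $\psi\colon\mathbb R\to\mathbb R$; $d(\mathcal A)=\sum_{i=1}^kd_i(d_{i-1}+1)$; $\theta\in\mathbb R^{d(\mathcal A)}$ is identified with $(W_1,b_1,\dots,W_k,b_k)$, $W_i\in\mathbb R^{d_i\times d_{i-1}},b_i\in\mathbb R^{d_i}$; the response is $\mathcal N^{\mathcal A}_\theta=f_k\circ\dots\circ f_1$ with $f_i(x)=\psi^{(d_i)}(W_ix+b_i)$ ($i<k$, $\psi$ applied componentwise) and $f_k(x)=W_kx+b_k$. $\delta_x$ denotes the Dirac measure at $x$. *)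

theory Defs
  imports "HOL-Probability.Probability"
begin

text \<open>Vectors of R^n are represented as extensional functions nat => real on {..<n}.
  A multi-index is a function alpha :: nat => nat; c is a finitely supported
  coefficient function.\<close>

definition mpoly_eval :: "nat \<Rightarrow> ((nat \<Rightarrow> nat) \<Rightarrow> real) \<Rightarrow> (nat \<Rightarrow> real) \<Rightarrow> real" where
  "mpoly_eval n c x = (\<Sum>\<alpha> | c \<alpha> \<noteq> 0. c \<alpha> * (\<Prod>i<n. x i ^ \<alpha> i))"

definition mpoly_coeffs :: "nat \<Rightarrow> ((nat \<Rightarrow> nat) \<Rightarrow> real) \<Rightarrow> bool" where
  "mpoly_coeffs n c \<longleftrightarrow> finite {\<alpha>. c \<alpha> \<noteq> 0} \<and> (\<forall>\<alpha>. c \<alpha> \<noteq> 0 \<longrightarrow> (\<forall>i\<ge>n. \<alpha> i = 0))"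

abbreviation Rn :: "nat \<Rightarrow> (nat \<Rightarrow> real) set" where
  "Rn n \<equiv> PiE {..<n} (\<lambda>_. UNIV)"

abbreviation lborel_n :: "nat \<Rightarrow> (nat \<Rightarrow> real) measure" where
  "lborel_n n \<equiv> PiM {..<n} (\<lambda>_. lborel)"

abbreviation top_n :: "nat \<Rightarrow> (nat \<Rightarrow> real) topology" where
  "top_n n \<equiv> product_topology (\<lambda>_. euclideanreal) {..<n}"

definition poly_map_coeffs ::
  "nat \<Rightarrow> nat \<Rightarrow> (nat \<Rightarrow> (nat \<Rightarrow> nat) \<Rightarrow> real) \<Rightarrow> ((nat \<Rightarrow> real) \<Rightarrow> (nat \<Rightarrow> real)) \<Rightarrow> bool" where
  "poly_map_coeffs n m c f \<longleftrightarrow>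
     (\<forall>j<m. mpoly_coeffs n (c j)) \<and>
     (\<forall>x\<in>Rn n. f x \<in> Rn m \<and> (\<forall>j<m. f x j = mpoly_eval n (c j) x))"

definition poly_map_deg_ge2 :: "nat \<Rightarrow> nat \<Rightarrow> (nat \<Rightarrow> (nat \<Rightarrow> nat) \<Rightarrow> real) \<Rightarrow> bool" where
  "poly_map_deg_ge2 n m c \<longleftrightarrow> (\<exists>j<m. \<exists>\<alpha>. c j \<alpha> \<noteq> 0 \<and> (\<Sum>i<n. \<alpha> i) \<ge> 2)"

definition o_minimal :: "(nat \<Rightarrow> real list set set) \<Rightarrow> bool" where
  "o_minimal S \<longleftrightarrow>
     (\<forall>n. \<forall>A\<in>S n. A \<subseteq> {xs. length xs = n}) \<and>
     (\<forall>n. \<forall>A\<in>S n. \<forall>B\<in>S n. A \<union> B \<in> S n) \<and>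
     (\<forall>n. \<forall>A\<in>S n. {xs. length xs = n} - A \<in> S n) \<and>
     (\<forall>n m. \<forall>A\<in>S n. \<forall>B\<in>S m. {xs @ ys |xs ys. xs \<in> A \<and> ys \<in> B} \<in> S (n + m)) \<and>
     (\<forall>n i. i \<le> n \<longrightarrow> (\<forall>A\<in>S (Suc n). {take i xs @ drop (Suc i) xs |xs. xs \<in> A} \<in> S n)) \<and>
     (\<forall>n c. finite {\<alpha>. c \<alpha> \<noteq> 0} \<longrightarrow>
        {xs. length xs = n \<and> mpoly_eval n c (\<lambda>i. xs ! i) > 0} \<in> S n \<and>
        {xs. length xs = n \<and> mpoly_eval n c (\<lambda>i. xs ! i) = 0} \<in> S n) \<and>
     (\<forall>A\<in>S 1. \<exists>F. finite F \<and> (\<forall>I\<in>F. is_interval (I :: real set)) \<and> A = {[x] |x. x \<in> \<Union>F})"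

definition definable_fun :: "(real \<Rightarrow> real) \<Rightarrow> bool" where
  "definable_fun g \<longleftrightarrow> (\<exists>S. o_minimal S \<and> {[x, g x] |x. True} \<in> S 2)"

definition real_analytic :: "(real \<Rightarrow> real) \<Rightarrow> bool" where
  "real_analytic g \<longleftrightarrow> (\<forall>x. \<exists>r>0. \<exists>a :: nat \<Rightarrow> real.
      \<forall>y. \<bar>y - x\<bar> < r \<longrightarrow> (\<lambda>k. a k * (y - x) ^ k) sums g y)"

definition sublinear :: "(real \<Rightarrow> real) \<Rightarrow> bool" where
  "sublinear g \<longleftrightarrow> (\<forall>x. Limsup at_top (\<lambda>t. ereal (\<bar>g (t * x)\<bar> / t)) < \<infinity>)"

definition SAD :: "(real \<Rightarrow> real) \<Rightarrow> bool" where
  "SAD g \<longleftrightarrow> sublinear g \<and> real_analytic g \<and> definable_fun g"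

definition affine_layer ::
  "nat \<Rightarrow> nat \<Rightarrow> (nat \<Rightarrow> nat \<Rightarrow> real) \<Rightarrow> (nat \<Rightarrow> real) \<Rightarrow> (nat \<Rightarrow> real) \<Rightarrow> (nat \<Rightarrow> real)" where
  "affine_layer din dout W b x = (\<lambda>j\<in>{..<dout}. (\<Sum>l<din. W j l * x l) + b j)"

text \<open>Response of the network with architecture (d_0,...,d_k, psi) = (ds, psi) and
  parameters theta = [(W_1,b_1),...,(W_k,b_k)].\<close>
fun nn_response ::
  "(real \<Rightarrow> real) \<Rightarrow> nat list \<Rightarrow> ((nat \<Rightarrow> nat \<Rightarrow> real) \<times> (nat \<Rightarrow> real)) list \<Rightarrow> (nat \<Rightarrow> real) \<Rightarrow> (nat \<Rightarrow> real)" where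
  "nn_response \<psi> [d0, d1] [(W, b)] x = affine_layer d0 d1 W b x"
| "nn_response \<psi> (d0 # d1 # d2 # ds) ((W, b) # \<theta>) x =
     nn_response \<psi> (d1 # d2 # ds) \<theta> (\<lambda>j\<in>{..<d1}. \<psi> (affine_layer d0 d1 W b x j))"
| "nn_response \<psi> _ _ x = x"

definition loss_fun :: "nat \<Rightarrow> ((nat \<Rightarrow> real) \<Rightarrow> (nat \<Rightarrow> real) \<Rightarrow> real) \<Rightarrow> bool" where
  "loss_fun m L \<longleftrightarrow> (\<forall>u\<in>Rn m. \<forall>v\<in>Rn m. L u v \<ge> 0 \<and> (L u v = 0 \<longleftrightarrow> u = v))"

definition measurable_loss :: "nat \<Rightarrow> ((nat \<Rightarrow> real) \<Rightarrow> (nat \<Rightarrow> real) \<Rightarrow> real) \<Rightarrow> bool" where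
  "measurable_loss m L \<longleftrightarrow> loss_fun m L \<and>
     (\<lambda>(u, v). L u v) \<in> borel_measurable (lborel_n m \<Otimes>\<^sub>M lborel_n m)"

text \<open>mu = lam * (1/n) sum_{i<n} delta_{x i} + (1 - lam) * p dx, a probability measure,
  with n >= N and (x_0,...,x_{N-1}) in D.  lam = 1 gives case (i), lam = 0 case (ii).\<close>
definition admissible_measure ::
  "nat \<Rightarrow> nat \<Rightarrow> (nat \<Rightarrow> nat \<Rightarrow> real) set \<Rightarrow> (nat \<Rightarrow> real) measure \<Rightarrow> bool" where
  "admissible_measure d0 N D \<mu> \<longleftrightarrow> prob_space \<mu> \<and> sets \<mu> = sets (lborel_n d0) \<and>
     (\<exists>(lam::real) (n::nat) (x :: nat \<Rightarrow> nat \<Rightarrow> real) (p :: (nat \<Rightarrow> real) \<Rightarrow> real).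
        0 \<le> lam \<and> lam \<le> 1 \<and> n \<ge> N \<and> n > 0 \<and>
        (\<forall>i<n. x i \<in> Rn d0) \<and> restrict x {..<N} \<in> D \<and>
        p \<in> borel_measurable (lborel_n d0) \<and> (\<forall>y\<in>Rn d0. p y \<ge> 0) \<and>
        (\<forall>A\<in>sets (lborel_n d0).
           emeasure \<mu> A = ennreal lam * ennreal (real (card {i. i < n \<and> x i \<in> A}) / real n)
             + ennreal (1 - lam) * (\<integral>\<^sup>+ y\<in>A. ennreal (p y) \<partial>lborel_n d0)))"

end

theory Submission
  imports Defs "HOL-Complex_Analysis.Complex_Analysis"
    "HOL-Computational_Algebra.Fundamental_Theorem_Algebra"
begin

text \<open>For fixed parameters the response minus the target is analytic and nonzero: along a suitable ray
  the polynomial grows faster than linearly, the network at most linearly. Hence its zero set is thin,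
  and the question is how many points defeat all parameters at once.

  In dimension one this is uniform finiteness in o-minimal structures. Over the reals it has a short
  proof, since a definable subset of the line that is countable is finite, and all exceptional sets that
  occur are countable unions of finite sets indexed by rational intervals.

  In general, generic means: for all but countably many values of each coordinate in turn. A one-parameter
  family of thin sets is defeated by two generic tuples, so n parameters are defeated by 2^n generic
  points. Finally, the boundary of a definable set is again thin, which makes the good set of tuples
  contain an open conull dense set.\<close>

section \<open>Definable predicates\<close>

text \<open>The loss matters only through its zero set: the expected loss is positive as soon as
  \<open>\<mu>\<close> charges the set where response and target differ. For a fixed parameter the
  complement of that set is Lebesgue null, so a density always charges it; only the atoms call for a
  choice that works for all parameters at once. The obstacle is that the bad tuples form a union
  over uncountably many parameters, that is, a projection, which is neither visibly null nor visibly
  measurable. The quantifier "for all but countably many" avoids integrating over that set: it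
  passes through countable conjunctions, gives conullity by Tonelli, and gives density because every
  nonempty open box contains generic tuples. Measurability is needed only at the end, where the bad
  set is replaced by its exterior, a countable union of open cubes. The exponent n is a bound on the
  environment entries that the fit relation depends on; definability provides it without any count
  of the weights.\<close>

lemma mpoly_eval_three:
  fixes p q r :: real
  assumes "\<alpha> \<noteq> \<beta>" "\<alpha> \<noteq> \<gamma>" "\<beta> \<noteq> \<gamma>"
  defines "c \<equiv> (\<lambda>_. 0)(\<alpha> := p, \<beta> := q, \<gamma> := r)"
  shows "finite {\<delta>. c \<delta> \<noteq> (0::real)}"
    and "mpoly_eval n c x = p * (\<Prod>i<n. x i ^ \<alpha> i) + q * (\<Prod>i<n. x i ^ \<beta> i) + r * (\<Prod>i<n. x i ^ \<gamma> i)"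
proof -
  have sub: "{\<delta>. c \<delta> \<noteq> 0} \<subseteq> {\<alpha>, \<beta>, \<gamma>}"
    by (auto simp: c_def split: if_splits)
  then show "finite {\<delta>. c \<delta> \<noteq> 0}"
    by (rule finite_subset) simp
  have "mpoly_eval n c x = (\<Sum>\<delta>\<in>{\<alpha>, \<beta>, \<gamma>}. c \<delta> * (\<Prod>i<n. x i ^ \<delta> i))"
    unfolding mpoly_eval_def by (rule sum.mono_neutral_left) (use sub in auto)
  then show "mpoly_eval n c x = p * (\<Prod>i<n. x i ^ \<alpha> i) + q * (\<Prod>i<n. x i ^ \<beta> i) + r * (\<Prod>i<n. x i ^ \<gamma> i)"
    using assms(1-3) by (simp add: c_def)
qed

lemma prod_power_single:
  fixes x :: "nat \<Rightarrow> real"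
  assumes "i < n"
  shows "(\<Prod>k<n. x k ^ (if k = i then m else 0)) = x i ^ m"
proof -
  have "(\<Prod>k<n. x k ^ (if k = i then m else 0)) = (\<Prod>k<n. if k = i then x i ^ m else 1)"
    by (rule prod.cong) auto
  also have "\<dots> = x i ^ m"
    using assms by (simp add: prod.delta)
  finally show ?thesis .
qed

lemma prod_power_pair:
  fixes x :: "nat \<Rightarrow> real"
  assumes "i < n" "j < n" "i \<noteq> j"
  shows "(\<Prod>k<n. x k ^ (if k = i \<or> k = j then 1 else 0)) = x i * x j"
proof -
  have "(\<Prod>k<n. x k ^ (if k = i \<or> k = j then 1 else 0))
      = (\<Prod>k<n. x k ^ (if k = i then 1 else 0) * x k ^ (if k = j then 1 else 0))"
    by (rule prod.cong) (use assms in auto)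
  also have "\<dots> = x i * x j"
    using assms by (simp only: prod.distrib prod_power_single power_one_right)
  finally show ?thesis .
qed

locale ominimal_structure =
  fixes S :: "nat \<Rightarrow> real list set set"
  assumes o_minimal: "o_minimal S"
begin

lemmas S_axioms = o_minimal[unfolded o_minimal_def]

lemma S_length: "A \<in> S n \<Longrightarrow> xs \<in> A \<Longrightarrow> length xs = n"
  using S_axioms[THEN conjunct1] by blast

lemma S_Un: "A \<in> S n \<Longrightarrow> B \<in> S n \<Longrightarrow> A \<union> B \<in> S n"
  using S_axioms[THEN conjunct2, THEN conjunct1] by blast

lemma S_compl: "A \<in> S n \<Longrightarrow> {xs. length xs = n} - A \<in> S n"
  using S_axioms[THEN conjunct2, THEN conjunct2, THEN conjunct1] by blast

lemma S_prod: "A \<in> S n \<Longrightarrow> B \<in> S m \<Longrightarrow> {xs @ ys |xs ys. xs \<in> A \<and> ys \<in> B} \<in> S (n + m)"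
  using S_axioms[THEN conjunct2, THEN conjunct2, THEN conjunct2, THEN conjunct1] by simp

lemma S_proj: "i \<le> n \<Longrightarrow> A \<in> S (Suc n) \<Longrightarrow> {take i xs @ drop (Suc i) xs |xs. xs \<in> A} \<in> S n"
  using S_axioms[THEN conjunct2, THEN conjunct2, THEN conjunct2, THEN conjunct2, THEN conjunct1] by simp

lemma S_pos: "finite {\<alpha>. c \<alpha> \<noteq> 0} \<Longrightarrow> {xs. length xs = n \<and> mpoly_eval n c (\<lambda>i. xs ! i) > 0} \<in> S n"
  and S_zero: "finite {\<alpha>. c \<alpha> \<noteq> 0} \<Longrightarrow> {xs. length xs = n \<and> mpoly_eval n c (\<lambda>i. xs ! i) = 0} \<in> S n"
  using S_axioms[THEN conjunct2, THEN conjunct2, THEN conjunct2, THEN conjunct2, THEN conjunct2, THEN conjunct1]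
  by simp_all

lemma S_intervals:
  assumes "A \<in> S 1"
  shows "\<exists>F. finite F \<and> (\<forall>I\<in>F. is_interval (I :: real set)) \<and> A = {[x] |x. x \<in> \<Union>F}"
  using S_axioms[THEN conjunct2, THEN conjunct2, THEN conjunct2, THEN conjunct2, THEN conjunct2, THEN conjunct2] assms
  by (rule bspec)

lemma S_UNIV: "{xs. length xs = n} \<in> S n"
  using S_zero[of "\<lambda>_. 0" n] by (simp add: mpoly_eval_def)

text \<open>Predicates on infinite environments, depending on finitely many coordinates only; a quantifier
  binds coordinate 0 and shifts the others, as with de Bruijn indices.\<close>
definition definable :: "((nat \<Rightarrow> real) \<Rightarrow> bool) \<Rightarrow> bool" where
  "definable P \<longleftrightarrow> (\<exists>n. \<exists>A\<in>S n. \<forall>e. P e \<longleftrightarrow> map e [0..<n] \<in> A)"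

definition definable_term :: "((nat \<Rightarrow> real) \<Rightarrow> real) \<Rightarrow> bool" where
  "definable_term t \<longleftrightarrow> definable (\<lambda>e. e 0 = t (\<lambda>i. e (Suc i)))"

lemma definableI: "A \<in> S n \<Longrightarrow> (\<And>e. P e \<longleftrightarrow> map e [0..<n] \<in> A) \<Longrightarrow> definable P"
  unfolding definable_def by blast

text \<open>Padding is a product with a full space; it brings predicates with different numbers of
  relevant coordinates to a common arity.\<close>

lemma S_pad:
  assumes "A \<in> S n"
  shows "\<exists>B\<in>S (n + m). \<forall>e. map e [0..<n] \<in> A \<longleftrightarrow> map e [0..<n + m] \<in> B"
proof -
  let ?B = "{xs @ ys |xs ys. xs \<in> A \<and> ys \<in> {ys. length ys = m}}"
  have B: "?B \<in> S (n + m)"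
    using assms S_UNIV by (rule S_prod)
  have "zs \<in> ?B \<longleftrightarrow> take n zs \<in> A" if "length zs = n + m" for zs
  proof
    assume "zs \<in> ?B"
    then show "take n zs \<in> A"
      using S_length[OF assms] by auto
  next
    assume "take n zs \<in> A"
    moreover have "zs = take n zs @ drop n zs" "length (drop n zs) = m"
      using that by simp_all
    ultimately show "zs \<in> ?B" by blast
  qed
  from this[of "map e [0..<n + m]" for e] have "\<forall>e. map e [0..<n] \<in> A \<longleftrightarrow> map e [0..<n + m] \<in> ?B"
    by (simp add: take_map del: mem_Collect_eq)
  then show ?thesis
    by (rule bexI[OF _ B])
qed

text \<open>All large arities are offered, so that two predicates can share one, and a predicate
  under a quantifier can be given one with a coordinate left to project away.\<close>

lemma definable_eventually:
  assumes "definable P"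
  obtains n where "\<And>k. n \<le> k \<Longrightarrow> \<exists>A\<in>S k. \<forall>e. P e \<longleftrightarrow> map e [0..<k] \<in> A"
proof -
  obtain n A where A: "A \<in> S n" "\<And>e. P e \<longleftrightarrow> map e [0..<n] \<in> A"
    using assms unfolding definable_def by blast
  show thesis
  proof
    fix k assume "n \<le> k"
    then show "\<exists>A\<in>S k. \<forall>e. P e \<longleftrightarrow> map e [0..<k] \<in> A"
      using S_pad[OF A(1), of "k - n"] A(2) by simp
  qed
qed

lemma definable_not: "definable P \<Longrightarrow> definable (\<lambda>e. \<not> P e)"
proof -
  assume "definable P"
  then obtain n A where A: "A \<in> S n" "\<And>e. P e \<longleftrightarrow> map e [0..<n] \<in> A"
    unfolding definable_def by blast
  show ?thesis
    by (rule definableI[OF S_compl[OF A(1)]]) (simp add: A(2))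
qed

lemma definable_disj:
  assumes "definable P" "definable Q"
  shows "definable (\<lambda>e. P e \<or> Q e)"
proof -
  obtain n where n: "\<And>k. n \<le> k \<Longrightarrow> \<exists>A\<in>S k. \<forall>e. P e \<longleftrightarrow> map e [0..<k] \<in> A"
    using definable_eventually[OF assms(1)] by blast
  obtain m where m: "\<And>k. m \<le> k \<Longrightarrow> \<exists>A\<in>S k. \<forall>e. Q e \<longleftrightarrow> map e [0..<k] \<in> A"
    using definable_eventually[OF assms(2)] by blast
  obtain A where A: "A \<in> S (max n m)" "\<And>e. P e \<longleftrightarrow> map e [0..<max n m] \<in> A"
    using n[of "max n m"] by auto
  obtain B where B: "B \<in> S (max n m)" "\<And>e. Q e \<longleftrightarrow> map e [0..<max n m] \<in> B"
    using m[of "max n m"] by auto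
  show ?thesis
    by (rule definableI[OF S_Un[OF A(1) B(1)]]) (simp add: A(2) B(2))
qed

lemma definable_conj: "definable P \<Longrightarrow> definable Q \<Longrightarrow> definable (\<lambda>e. P e \<and> Q e)"
  using definable_not[OF definable_disj[OF definable_not definable_not, of P Q]] by simp

lemma definable_imp: "definable P \<Longrightarrow> definable Q \<Longrightarrow> definable (\<lambda>e. P e \<longrightarrow> Q e)"
  using definable_disj[OF definable_not, of P Q] by simp

lemma definable_const: "definable (\<lambda>_. b)"
proof -
  have "definable (\<lambda>_. True)"
    by (rule definableI[OF S_UNIV[of 0]]) simp
  then show ?thesis
    using definable_not[of "\<lambda>_. True"] by (cases b) auto
qed

lemma definable_Ball:
  assumes "finite I" "\<And>i. i \<in> I \<Longrightarrow> definable (P i)"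
  shows "definable (\<lambda>e. \<forall>i\<in>I. P i e)"
  using assms by (induction I) (auto intro!: definable_conj definable_const)

lemma definable_less_forall:
  fixes n :: nat
  assumes "\<And>i. i < n \<Longrightarrow> definable (P i)"
  shows "definable (\<lambda>e. \<forall>i<n. P i e)"
proof -
  have "definable (\<lambda>e. \<forall>i\<in>{..<n}. P i e)"
    by (rule definable_Ball) (use assms in auto)
  then show ?thesis by (simp add: Ball_def)
qed

lemma definable_ex:
  assumes "definable (\<lambda>e. Q (e 0) (\<lambda>i. e (Suc i)))"
  shows "definable (\<lambda>e. \<exists>y. Q y e)"
proof -
  obtain n where "\<And>k. n \<le> k \<Longrightarrow> \<exists>A\<in>S k. \<forall>e. Q (e 0) (\<lambda>i. e (Suc i)) \<longleftrightarrow> map e [0..<k] \<in> A"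
    using definable_eventually[OF assms] by blast
  then obtain A where A: "A \<in> S (Suc n)"
    "\<And>e. Q (e 0) (\<lambda>i. e (Suc i)) \<longleftrightarrow> map e [0..<Suc n] \<in> A"
    by (meson le_SucI order_refl)
  have Q: "Q y e \<longleftrightarrow> y # map e [0..<n] \<in> A" for y e
  proof -
    have "map (case_nat y e) [0..<Suc n] = y # map e [0..<n]"
      by (simp add: upt_conv_Cons map_Suc_upt[symmetric] del: upt_Suc)
    then show ?thesis
      using A(2)[of "case_nat y e"] by simp
  qed
  show ?thesis
  proof (rule definableI[OF S_proj[OF _ A(1), of 0]])
    fix e
    show "(\<exists>y. Q y e) \<longleftrightarrow> map e [0..<n] \<in> {take 0 xs @ drop (Suc 0) xs |xs. xs \<in> A}"
    proof
      assume "map e [0..<n] \<in> {take 0 xs @ drop (Suc 0) xs |xs. xs \<in> A}"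
      then obtain xs where xs: "map e [0..<n] = drop (Suc 0) xs" "xs \<in> A"
        by auto
      \<comment> \<open>The members of \<open>A\<close> are nonempty lists, so the deleted entry is
        recovered as a head and serves as the witness.\<close>
      with S_length[OF A(1) xs(2)] have "xs = hd xs # map e [0..<n]"
        by (cases xs) auto
      then show "\<exists>y. Q y e"
        using xs(2) Q by metis
    qed (use Q in force)
  qed simp
qed

lemma definable_all:
  assumes "definable (\<lambda>e. Q (e 0) (\<lambda>i. e (Suc i)))"
  shows "definable (\<lambda>e. \<forall>y. Q y e)"
  using definable_not[OF definable_ex[OF definable_not[OF assms]]] by simp

lemma case_nat_Suc_id: "case_nat (e 0) (\<lambda>i. e (Suc i)) = e"
  by (auto simp: fun_eq_iff split: nat.split)

text \<open>A block of n quantifiers at once: the fresh values occupy the coordinates below n and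
  the old environment is shifted by n. Renaming and substitution both reduce to this.\<close>

lemma definable_ex_list:
  assumes "definable Q"
  shows "definable (\<lambda>e. \<exists>ys. length ys = n \<and> Q (\<lambda>i. if i < n then ys ! i else e (i - n)))"
  using assms
proof (induction n arbitrary: Q)
  case 0
  then show ?case by simp
next
  case (Suc n)
  have "definable (\<lambda>e. \<exists>y. Q (case_nat y e))"
    by (rule definable_ex) (use Suc.prems in \<open>simp add: case_nat_Suc_id\<close>)
  from Suc.IH[OF this]
  have "definable (\<lambda>e. \<exists>ys. length ys = n \<and>
      (\<exists>y. Q (case_nat y (\<lambda>i. if i < n then ys ! i else e (i - n)))))" .
  moreover have "(\<lambda>i. if i < Suc n then (y # ys) ! i else e (i - Suc n))
      = case_nat y (\<lambda>i. if i < n then ys ! i else e (i - n))" for y ys and e :: "nat \<Rightarrow> real"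
    by (auto simp: fun_eq_iff split: nat.split)
  moreover have "(\<exists>ys. length ys = Suc n \<and> R ys) \<longleftrightarrow> (\<exists>ys. length ys = n \<and> (\<exists>y. R (y # ys)))" for R :: "real list \<Rightarrow> bool"
    by (auto simp: length_Suc_conv)
  ultimately show ?case by simp
qed

text \<open>Order, equality, constants, sums and products are sign conditions on at most three
  monomials; zero coefficients cover the shorter ones, while the exponent vectors must still be
  distinct.\<close>

lemma definable_three_terms:
  fixes p q r :: real
  assumes "\<alpha> \<noteq> \<beta>" "\<alpha> \<noteq> \<gamma>" "\<beta> \<noteq> \<gamma>"
  shows "definable (\<lambda>e. p * (\<Prod>i<n. e i ^ \<alpha> i) + q * (\<Prod>i<n. e i ^ \<beta> i) + r * (\<Prod>i<n. e i ^ \<gamma> i) = 0)"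
    and "definable (\<lambda>e. 0 < p * (\<Prod>i<n. e i ^ \<alpha> i) + q * (\<Prod>i<n. e i ^ \<beta> i) + r * (\<Prod>i<n. e i ^ \<gamma> i))"
proof -
  have eq: "(\<Prod>i<n. map e [0..<n] ! i ^ \<delta> i) = (\<Prod>i<n. e i ^ \<delta> i)" for e :: "nat \<Rightarrow> real" and \<delta>
    by (rule prod.cong) auto
  note three = mpoly_eval_three[OF assms, where p = p and q = q and r = r]
  show "definable (\<lambda>e. p * (\<Prod>i<n. e i ^ \<alpha> i) + q * (\<Prod>i<n. e i ^ \<beta> i) + r * (\<Prod>i<n. e i ^ \<gamma> i) = 0)"
    by (rule definableI[OF S_zero[OF three(1), of n]]) (simp add: three(2) eq del: fun_upd_apply)
  show "definable (\<lambda>e. 0 < p * (\<Prod>i<n. e i ^ \<alpha> i) + q * (\<Prod>i<n. e i ^ \<beta> i) + r * (\<Prod>i<n. e i ^ \<gamma> i))"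
    by (rule definableI[OF S_pos[OF three(1), of n]]) (simp add: three(2) eq del: fun_upd_apply)
qed

lemma definable_eq_var: "definable (\<lambda>e. e i = e j)"
proof (cases "i = j")
  case False
  obtain n where "i < n" "j < n"
    using less_Suc_eq_le max.cobounded1 max.cobounded2 by metis
  let ?u = "\<lambda>i k :: nat. if k = i then (1::nat) else 0"
  have "?u i \<noteq> ?u j" "?u i \<noteq> (\<lambda>_. 0)" "?u j \<noteq> (\<lambda>_. 0)"
    using False by (metis zero_neq_one)+
  from definable_three_terms(1)[OF this, where p = 1 and q = "-1" and r = 0 and n = n]
  show ?thesis
    using \<open>i < n\<close> \<open>j < n\<close> by (simp add: prod_power_single)
qed (simp add: definable_const)

lemma definable_basic:
  "definable (\<lambda>e. e 0 < e 1)" "definable (\<lambda>e. e 0 = r)"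
  "definable (\<lambda>e. e 0 = e 1 + e 2)" "definable (\<lambda>e. e 0 = e 1 * e 2)"
proof -
  \<comment> \<open>\<open>?u i\<close> is the exponent vector of the variable with index i, and
    \<open>?v\<close> that of the product of the variables 1 and 2.\<close>
  let ?u = "\<lambda>i k :: nat. if k = i then (1::nat) else 0" and ?v = "\<lambda>k :: nat. if k = 1 \<or> k = 2 then (1::nat) else 0"
  have ne: "?u 0 \<noteq> ?u 1" "?u 0 \<noteq> ?u 2" "?u 1 \<noteq> ?u 2" "?u 0 \<noteq> (\<lambda>_. 0)" "?u 1 \<noteq> (\<lambda>_. 0)"
    "(\<lambda>_. 0) \<noteq> ?u 1" "?u 0 \<noteq> ?v" "?u 1 \<noteq> ?v"
    by (rule notI, drule fun_cong[of _ _ 0], simp; fail | rule notI, drule fun_cong[of _ _ 1], simp; fail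
        | rule notI, drule fun_cong[of _ _ 2], simp; fail)+
  show "definable (\<lambda>e. e 0 < e 1)"
    using definable_three_terms(2)[OF ne(1) ne(4,5), where p = "-1" and q = 1 and r = 0 and n = 3]
    by (simp add: prod_power_single[where m = 1, simplified])
  show "definable (\<lambda>e. e 0 = r)"
    using definable_three_terms(1)[OF ne(4) ne(1,6), where p = 1 and q = "-r" and r = 0 and n = 3]
    by (simp add: prod_power_single[where m = 1, simplified])
  show "definable (\<lambda>e. e 0 = e 1 + e 2)"
    using definable_three_terms(1)[OF ne(1,2,3), where p = 1 and q = "-1" and r = "-1" and n = 3]
    by (simp add: prod_power_single[where m = 1, simplified] algebra_simps)
  show "definable (\<lambda>e. e 0 = e 1 * e 2)"
    using definable_three_terms(1)[OF ne(1,7,8), where p = 1 and q = 0 and r = "-1" and n = 3]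
    by (simp only: prod_power_single prod_power_pair, simp add: prod_power_single[where m = 1, simplified])
qed

text \<open>The values at the renamed positions are quantified as a fresh initial segment of the
  environment and then compared with the old ones.\<close>
lemma definable_rename:
  assumes "definable P"
  shows "definable (\<lambda>e. P (\<lambda>i. e (\<sigma> i)))"
proof -
  obtain n A where A: "A \<in> S n" "\<And>e. P e \<longleftrightarrow> map e [0..<n] \<in> A"
    using assms unfolding definable_def by blast
  \<comment> \<open>Entry i of the fresh block must equal the old entry \<open>\<sigma> i\<close>,
    which the block has pushed to position \<open>n + \<sigma> i\<close>.\<close>
  have "definable (\<lambda>e. P e \<and> (\<forall>i<n. e i = e (n + \<sigma> i)))"
    by (intro definable_conj assms definable_less_forall definable_eq_var)
  from definable_ex_list[OF this, of n] show ?thesis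
  proof (rule back_subst[where P = definable], intro ext iffI)
    fix e :: "nat \<Rightarrow> real"
    let ?e = "\<lambda>ys i. if i < n then ys ! i else e (i - n)"
    assume "\<exists>ys. length ys = n \<and> P (?e ys) \<and> (\<forall>i<n. ?e ys i = ?e ys (n + \<sigma> i))"
    then obtain ys where ys: "P (?e ys)" "\<And>i. i < n \<Longrightarrow> ?e ys i = e (\<sigma> i)"
      by auto
    have "map (?e ys) [0..<n] = map (\<lambda>i. e (\<sigma> i)) [0..<n]"
      by (rule map_cong) (use ys(2) in auto)
    then show "P (\<lambda>i. e (\<sigma> i))"
      using ys(1) A(2) by metis
  next
    fix e :: "nat \<Rightarrow> real"
    let ?e = "\<lambda>ys i. if i < n then ys ! i else e (i - n)"
    let ?ys = "map (\<lambda>i. e (\<sigma> i)) [0..<n]"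
    assume "P (\<lambda>i. e (\<sigma> i))"
    moreover have "map (?e ?ys) [0..<n] = map (\<lambda>i. e (\<sigma> i)) [0..<n]"
      by (rule map_cong) auto
    ultimately have "P (?e ?ys)"
      using A(2) by metis
    then show "\<exists>ys. length ys = n \<and> P (?e ys) \<and> (\<forall>i<n. ?e ys i = ?e ys (n + \<sigma> i))"
      by (intro exI[of _ ?ys]) auto
  qed
qed

text \<open>The values of the first n terms are quantified as a fresh block and tied to the old
  environment by their graphs. Infinitely many terms may be substituted, since \<open>P\<close>
  reads only n of them.\<close>

lemma definable_subst:
  assumes "definable P" "\<And>i. definable_term (\<lambda>e. s e i)"
  shows "definable (\<lambda>e. P (s e))"
proof -
  obtain n A where A: "A \<in> S n" "\<And>e. P e \<longleftrightarrow> map e [0..<n] \<in> A"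
    using assms unfolding definable_def by blast
  \<comment> \<open>The value slot 0 of the graph is moved to position i of the block, and the
    variables of the term are moved past the block.\<close>
  have "definable (\<lambda>e. e i = s (\<lambda>k. e (n + k)) i)" for i
    using definable_rename[OF assms(2)[of i, unfolded definable_term_def], of "case_nat i (\<lambda>k. n + k)"]
    by simp
  then have "definable (\<lambda>e. P e \<and> (\<forall>i<n. e i = s (\<lambda>k. e (n + k)) i))"
    by (intro definable_conj assms definable_less_forall)
  from definable_ex_list[OF this, of n] show ?thesis
  proof (rule back_subst[where P = definable], intro ext iffI)
    fix e :: "nat \<Rightarrow> real"
    let ?e = "\<lambda>ys i. if i < n then ys ! i else e (i - n)"
    assume "\<exists>ys. length ys = n \<and> P (?e ys) \<and> (\<forall>i<n. ?e ys i = s (\<lambda>k. ?e ys (n + k)) i)"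
    then obtain ys where ys: "P (?e ys)" "\<And>i. i < n \<Longrightarrow> ?e ys i = s e i"
      by auto
    have "map (?e ys) [0..<n] = map (s e) [0..<n]"
      by (rule map_cong) (use ys(2) in auto)
    then show "P (s e)"
      using ys(1) A(2) by metis
  next
    fix e :: "nat \<Rightarrow> real"
    let ?e = "\<lambda>ys i. if i < n then ys ! i else e (i - n)"
    let ?ys = "map (s e) [0..<n]"
    assume "P (s e)"
    moreover have "map (?e ?ys) [0..<n] = map (s e) [0..<n]"
      by (rule map_cong) auto
    ultimately have "P (?e ?ys)"
      using A(2) by metis
    then show "\<exists>ys. length ys = n \<and> P (?e ys) \<and> (\<forall>i<n. ?e ys i = s (\<lambda>k. ?e ys (n + k)) i)"
      by (intro exI[of _ ?ys]) auto
  qed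
qed

section \<open>Definable terms\<close>

lemma definable_term_var: "definable_term (\<lambda>e. e i)"
  unfolding definable_term_def by (rule definable_eq_var)

lemma definable_term_const: "definable_term (\<lambda>_. r)"
  unfolding definable_term_def by (rule definable_basic)

lemma definable_term_case_nat:
  assumes "definable_term t" "\<And>i. definable_term (\<lambda>e. s e i)"
  shows "definable_term (\<lambda>e. case_nat (t e) (s e) i)"
  using assms by (cases i) auto

lemma definable_subst_param:
  assumes "definable (\<lambda>e. P (\<lambda>i. e (Suc i)) (e 0))" "\<And>i. definable_term (\<lambda>e. s e i)" "definable_term t"
  shows "definable (\<lambda>e. P (s e) (t e))"
  using definable_subst[OF assms(1), of "\<lambda>e. case_nat (t e) (s e)"] assms(2,3)
  by (simp add: definable_term_case_nat)

lemma definable_term_rename: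
  assumes "definable_term t"
  shows "definable_term (\<lambda>e. t (\<lambda>i. e (\<sigma> i)))"
  unfolding definable_term_def
  using definable_rename[OF assms[unfolded definable_term_def], of "case_nat 0 (\<lambda>i. Suc (\<sigma> i))"]
  by simp

lemma definable_eq:
  assumes "definable_term t" "definable_term u"
  shows "definable (\<lambda>e. t e = u e)"
  using definable_subst_param[of "\<lambda>e x. x = t e" "\<lambda>e. e" u] assms
  by (simp add: definable_term_def[symmetric] definable_term_var eq_commute)

lemma definable_less:
  assumes "definable_term t" "definable_term u"
  shows "definable (\<lambda>e. t e < u e)"
  using definable_subst_param[of "\<lambda>e x. x < e 0" "\<lambda>e _. u e" t] definable_basic(1) assms by simp

lemma definable_le:
  assumes "definable_term t" "definable_term u"
  shows "definable (\<lambda>e. t e \<le> u e)"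
  using definable_not[OF definable_less[OF assms(2,1)]] by (simp add: not_less)

lemma definable_term_graph:
  assumes "definable (\<lambda>e. R (e 0) (e 1) (e 2))" "\<And>x y z. R x y z \<longleftrightarrow> x = g y z"
    "definable_term t" "definable_term u"
  shows "definable_term (\<lambda>e. g (t e) (u e))"
proof -
  have "definable (\<lambda>e. R (e 0) (t (\<lambda>i. e (Suc i))) (u (\<lambda>i. e (Suc i))))"
    using definable_subst[OF assms(1),
        of "\<lambda>e. case_nat (e 0) (case_nat (t (\<lambda>i. e (Suc i))) (\<lambda>_. u (\<lambda>i. e (Suc i))))"]
      assms(3,4)
    by (simp add: definable_term_case_nat definable_term_var definable_term_rename numeral_2_eq_2)
  then show ?thesis
    by (simp add: definable_term_def assms(2))
qed

lemma definable_term_add: "definable_term t \<Longrightarrow> definable_term u \<Longrightarrow> definable_term (\<lambda>e. t e + u e)"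
  and definable_term_mult: "definable_term t \<Longrightarrow> definable_term u \<Longrightarrow> definable_term (\<lambda>e. t e * u e)"
  by (rule definable_term_graph[OF definable_basic(3)] definable_term_graph[OF definable_basic(4)];
      assumption?; rule refl)+

lemma definable_term_diff: "definable_term t \<Longrightarrow> definable_term u \<Longrightarrow> definable_term (\<lambda>e. t e - u e)"
  using definable_term_add[OF _ definable_term_mult[OF definable_term_const[of "-1"]], of t u] by simp

lemma definable_term_sum:
  "finite I \<Longrightarrow> (\<And>i. i \<in> I \<Longrightarrow> definable_term (t i)) \<Longrightarrow> definable_term (\<lambda>e. \<Sum>i\<in>I. t i e)"
  by (induction I rule: finite_induct) (auto intro: definable_term_add definable_term_const)

lemma definable_term_prod:
  "finite I \<Longrightarrow> (\<And>i. i \<in> I \<Longrightarrow> definable_term (t i)) \<Longrightarrow> definable_term (\<lambda>e. \<Prod>i\<in>I. t i e)"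
  by (induction I rule: finite_induct) (auto intro: definable_term_mult definable_term_const)

lemma definable_term_power: "definable_term t \<Longrightarrow> definable_term (\<lambda>e. t e ^ n)"
  by (induction n) (auto intro: definable_term_mult definable_term_const)

lemma definable_term_fun:
  assumes "{[x, g x] |x. True} \<in> S 2" "definable_term t"
  shows "definable_term (\<lambda>e. g (t e))"
\<comment> \<open>A unary function is treated as a binary one that ignores its second
  argument.\<close>
proof (rule definable_term_graph[where R = "\<lambda>x y _. x = g y" and g = "\<lambda>y _. g y"])
  have "definable (\<lambda>e. e 1 = g (e 0))"
    by (rule definableI[OF assms(1)]) (auto simp: numeral_2_eq_2)
  from definable_rename[OF this, of "case_nat 1 (\<lambda>_. 0)"]
  show "definable (\<lambda>e. e 0 = g (e 1))" by simp
qed (use assms in auto)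

text \<open>Quantifying over infinitely many coordinates is harmless, as only finitely many matter.\<close>
lemma definable_ex_tail:
  assumes "definable P"
  shows "definable (\<lambda>e. \<exists>u. P (\<lambda>i. if i < m then e i else u (i - m)))"
proof -
  obtain n A where A: "A \<in> S n" "\<And>e. P e \<longleftrightarrow> map e [0..<n] \<in> A"
    using assms unfolding definable_def by blast
  \<comment> \<open>Beyond its first n entries \<open>u\<close> is irrelevant and may be taken to be
    0. The n remaining values form the fresh block, so the old entries are read at
    \<open>n + i\<close>.\<close>
  have "definable (\<lambda>e. P (\<lambda>i. if i < m then e (n + i) else if i - m < n then e (i - m) else 0))"
  proof (rule definable_subst[OF assms])
    fix i
    show "definable_term (\<lambda>e. if i < m then e (n + i) else if i - m < n then e (i - m) else 0)"
      by (cases "i < m"; cases "i - m < n") (simp_all add: definable_term_var definable_term_const)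
  qed
  from definable_ex_list[OF this, of n] show ?thesis
  proof (rule back_subst[where P = definable], intro ext iffI)
    fix e :: "nat \<Rightarrow> real"
    let ?e = "\<lambda>ys i. if i < n then ys ! i else e (i - n)"
    let ?Q = "\<lambda>ys. P (\<lambda>i. if i < m then ?e ys (n + i) else if i - m < n then ?e ys (i - m) else 0)"
    show "\<exists>u. P (\<lambda>i. if i < m then e i else u (i - m))" if "\<exists>ys. length ys = n \<and> ?Q ys"
    proof -
      from that obtain ys where "?Q ys" by blast
      then show ?thesis
        by (intro exI[of _ "\<lambda>i. if i < n then ?e ys i else 0"]) (simp cong: if_cong)
    qed
    show "\<exists>ys. length ys = n \<and> ?Q ys" if "\<exists>u. P (\<lambda>i. if i < m then e i else u (i - m))"
    proof -
      from that obtain u where u: "P (\<lambda>i. if i < m then e i else u (i - m))" by blast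
      have "map (\<lambda>i. if i < m then ?e (map u [0..<n]) (n + i) else if i - m < n then ?e (map u [0..<n]) (i - m) else 0) [0..<n]
          = map (\<lambda>i. if i < m then e i else u (i - m)) [0..<n]"
        by (rule map_cong) auto
      then have "?Q (map u [0..<n])"
        using u by (simp only: A(2))
      then show ?thesis
        by (intro exI[of _ "map u [0..<n]"]) simp
    qed
  qed
qed

lemma definable_unary_intervals:
  assumes "definable (\<lambda>e. P (e 0))"
  obtains F where "finite F" "\<And>I. I \<in> F \<Longrightarrow> is_interval (I :: real set)" "{x. P x} = \<Union>F"
proof -
  have proj: "\<exists>B\<in>S 1. \<forall>x. [x] \<in> B \<longleftrightarrow> (\<exists>xs\<in>A. hd xs = x)" if "A \<in> S (Suc n)" for A n
    using that
  proof (induction n arbitrary: A)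
    case 0
    have "xs = [hd xs]" if "xs \<in> A" for xs
      using S_length[OF 0 that] by (cases xs) auto
    then have "\<forall>x. [x] \<in> A \<longleftrightarrow> (\<exists>xs\<in>A. hd xs = x)"
      by (metis list.sel(1))
    with 0 show ?case by auto
  next
    case (Suc n)
    \<comment> \<open>The index \<open>Suc n\<close> is that of the last coordinate, so the head
      survives the projection.\<close>
    let ?A = "{take (Suc n) xs @ drop (Suc (Suc n)) xs |xs. xs \<in> A}"
    have A: "?A \<in> S (Suc n)"
      by (rule S_proj[OF _ Suc.prems]) simp
    have "hd (take (Suc n) xs @ drop (Suc (Suc n)) xs) = hd xs" if "xs \<in> A" for xs
      using S_length[OF Suc.prems that] by (cases xs) auto
    then have "(\<exists>xs\<in>?A. hd xs = x) \<longleftrightarrow> (\<exists>xs\<in>A. hd xs = x)" for x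
      by (auto 4 4)
    with Suc.IH[OF A] show ?case by simp
  qed
  obtain n where "\<And>k. n \<le> k \<Longrightarrow> \<exists>A\<in>S k. \<forall>e. P (e 0) \<longleftrightarrow> map e [0..<k] \<in> A"
    using definable_eventually[OF assms] by blast
  then obtain A where A: "A \<in> S (Suc n)" "\<And>e. P (e 0) \<longleftrightarrow> map e [0..<Suc n] \<in> A"
    by (meson le_SucI order_refl)
  have hd: "P x \<longleftrightarrow> (\<exists>xs\<in>A. hd xs = x)" for x
  proof
    assume "P x"
    then have "map (\<lambda>_. x) [0..<Suc n] \<in> A"
      using A(2)[of "\<lambda>_. x"] by simp
    then show "\<exists>xs\<in>A. hd xs = x"
      by (rule bexI[rotated]) (simp add: upt_conv_Cons del: upt_Suc)
  next
    assume "\<exists>xs\<in>A. hd xs = x"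
    then obtain xs where xs: "xs \<in> A" "hd xs = x" by blast
    then have len: "length xs = Suc n"
      using S_length A(1) by blast
    then have "xs = map (\<lambda>i. xs ! i) [0..<Suc n]"
      by (metis map_nth)
    then have "P (xs ! 0)"
      using xs(1) A(2)[of "\<lambda>i. xs ! i"] by simp
    then show "P x"
      using xs(2) len by (cases xs) auto
  qed
  obtain B where B: "B \<in> S 1" "\<And>x. [x] \<in> B \<longleftrightarrow> P x"
    using proj[OF A(1)] hd by blast
  obtain F where F: "finite F" "\<forall>I\<in>F. is_interval (I :: real set)" "B = {[x] |x. x \<in> \<Union>F}"
    using S_intervals[OF B(1)] by blast
  show thesis
  proof (rule that)
    show "{x. P x} = \<Union>F"
      using F(3) B(2) by auto
  qed (use F in auto)
qed

text \<open>In a finite union of intervals a point that is not interior must be the minimum or the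
  maximum of every interval containing it, and each interval has at most one of each.\<close>

lemma finite_not_interior:
  assumes "definable (\<lambda>e. P (e 0))"
  shows "finite {x. P x \<and> \<not> (\<exists>p q. p < x \<and> x < q \<and> (\<forall>y. p < y \<and> y < q \<longrightarrow> P y))}"
proof -
  obtain F where F: "finite F" "\<And>I. I \<in> F \<Longrightarrow> is_interval I" "{x. P x} = \<Union>F"
    using definable_unary_intervals[OF assms] by blast
  let ?L = "\<lambda>I. {x \<in> I. \<forall>y\<in>I. x \<le> y}" and ?U = "\<lambda>I. {x \<in> I. \<forall>y\<in>I. y \<le> x}"
  have "finite (?L I)" "finite (?U I)" for I :: "real set"
    by (rule finite_subset[of _ "{Inf I}"], auto intro!: cInf_eq_minimum[symmetric])
      (rule finite_subset[of _ "{Sup I}"], auto intro!: cSup_eq_maximum[symmetric])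
  then have "finite (\<Union>I\<in>F. ?L I \<union> ?U I)"
    using F(1) by blast
  moreover have "{x. P x \<and> \<not> (\<exists>p q. p < x \<and> x < q \<and> (\<forall>y. p < y \<and> y < q \<longrightarrow> P y))}
      \<subseteq> (\<Union>I\<in>F. ?L I \<union> ?U I)"
  proof safe
    fix x assume x: "P x" "\<not> (\<exists>p q. p < x \<and> x < q \<and> (\<forall>y. p < y \<and> y < q \<longrightarrow> P y))"
    then obtain I where I: "I \<in> F" "x \<in> I"
      using F(3) by blast
    have "x \<in> ?L I \<union> ?U I"
    proof (rule ccontr)
      assume "x \<notin> ?L I \<union> ?U I"
      then obtain p q where pq: "p \<in> I" "q \<in> I" "p < x" "x < q"
        using I(2) by (auto simp: not_le)
      have "P y" if "p < y" "y < q" for y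
        using F(2)[OF I(1)] F(3) I(1) pq(1,2) that
        by (metis UnionI less_imp_le mem_Collect_eq mem_is_interval_1_I)
      then show False
        using x(2) pq(3,4) by blast
    qed
    then show "x \<in> (\<Union>I\<in>F. ?L I \<union> ?U I)"
      using I(1) by blast
  qed
  ultimately show ?thesis
    by (rule finite_subset[rotated])
qed

text \<open>With a dense complement no point is interior, so every point of the set is among the
  finitely many exceptions.\<close>

lemma finite_if_dense_complement:
  assumes "definable (\<lambda>e. P (e 0))" "\<And>p q. p < q \<Longrightarrow> \<exists>y. p < y \<and> y < q \<and> \<not> P y"
  shows "finite {x. P x}"
proof (rule finite_subset[OF _ finite_not_interior[OF assms(1)]], safe)
  fix x p q assume "p < x" "x < q" "\<forall>y. p < y \<and> y < q \<longrightarrow> P y"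
  then show False
    using assms(2)[of p q] by auto
qed

lemma finite_if_countable:
  assumes "definable (\<lambda>e. P (e 0))" "countable {x. P x}"
  shows "finite {x. P x}"
proof (rule finite_if_dense_complement[OF assms(1)])
  fix p q :: real assume "p < q"
  then have "\<not> countable {p<..<q}"
    by (simp add: uncountable_open_interval)
  then have "\<not> {p<..<q} \<subseteq> {x. P x}"
    using assms(2) countable_subset by blast
  then show "\<exists>y. p < y \<and> y < q \<and> \<not> P y"
    by auto
qed

end

section \<open>Uniform finiteness\<close>

lemma eventually_nhds_real:
  "(\<forall>\<^sub>F y in nhds x. P y) \<longleftrightarrow> (\<exists>\<epsilon>>0. \<forall>y. x - \<epsilon> < y \<and> y < x + \<epsilon> \<longrightarrow> P y)" for x :: real
proof -
  have "dist y x < \<epsilon> \<longleftrightarrow> x - \<epsilon> < y \<and> y < x + \<epsilon>" for y \<epsilon>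
    by (auto simp: dist_real_def)
  then show ?thesis
    by (simp add: eventually_nhds_metric)
qed

lemma eventually_nhds_between: "p < x \<Longrightarrow> x < q \<Longrightarrow> \<forall>\<^sub>F y in nhds x. p < y \<and> y < q" for x :: real
  using eventually_nhds_in_open[of "{p<..<q}" x] by simp

text \<open>Rational endpoints leave only countably many candidate intervals, which is what makes
  the set of irregular parameters countable.\<close>

lemma finite_isolating_interval:
  fixes b :: real
  assumes "finite X"
  obtains p q where "p \<in> \<rat>" "q \<in> \<rat>" "p < b" "b < q" "\<And>x. x \<in> X \<Longrightarrow> p < x \<Longrightarrow> x < q \<Longrightarrow> x = b"
proof -
  obtain d where d: "d > 0" "\<forall>x\<in>X. x \<noteq> b \<longrightarrow> d \<le> dist b x"
    using finite_set_avoid[OF assms] by blast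
  obtain p where p: "p \<in> \<rat>" "b - d < p" "p < b"
    using Rats_dense_in_real[of "b - d" b] d(1) by auto
  obtain q where q: "q \<in> \<rat>" "b < q" "q < b + d"
    using Rats_dense_in_real[of b "b + d"] d(1) by auto
  show thesis
    by (rule that[OF p(1) q(1) p(3) q(2)]) (use d p q in \<open>fastforce simp: dist_real_def\<close>)
qed

text \<open>First-order conditions, hence definable ones, under which the cardinality of the fibre is locally
  constant at s.\<close>
definition regular_fibre :: "(real \<Rightarrow> real set) \<Rightarrow> real \<Rightarrow> bool" where
  "regular_fibre F s \<longleftrightarrow>
     (\<exists>K. \<forall>\<^sub>F t in nhds s. \<forall>x. x \<in> F t \<longrightarrow> - K \<le> x \<and> x \<le> K) \<and>
     (\<forall>b. \<exists>\<delta>>0. \<forall>\<^sub>F t in nhds s. \<forall>x. x \<in> F t \<and> b - \<delta> < x \<and> x < b + \<delta> \<longrightarrow>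
        b \<in> F s \<and> (\<forall>y. y \<in> F t \<and> b - \<delta> < y \<and> y < b + \<delta> \<longrightarrow> x = y)) \<and>
     (\<forall>b \<delta>. b \<in> F s \<and> \<delta> > 0 \<longrightarrow> (\<forall>\<^sub>F t in nhds s. \<exists>x. x \<in> F t \<and> b - \<delta> < x \<and> x < b + \<delta>))"

text \<open>Upper bound: by compactness finitely many windows cover \<open>{-K..K}\<close>; for t
  near s each holds at most one point of \<open>F t\<close>, and none unless its centre lies in
  \<open>F s\<close>, so sending a point to the centre of its window embeds \<open>F t\<close> into
  \<open>F s\<close>. Lower bound: every point of \<open>F s\<close> persists within distance
  \<open>\<eta>\<close>, and these neighbourhoods are disjoint.\<close>

lemma card_locally_constant:
  assumes fin: "\<And>t. finite (F t)" and reg: "regular_fibre F s"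
  shows "\<forall>\<^sub>F t in nhds s. card (F t) = card (F s)"
proof -
  obtain K where K: "\<forall>\<^sub>F t in nhds s. \<forall>x. x \<in> F t \<longrightarrow> - K \<le> x \<and> x \<le> K"
    using reg unfolding regular_fibre_def by blast
  have "\<forall>b. \<exists>\<delta>>0. \<forall>\<^sub>F t in nhds s. \<forall>x. x \<in> F t \<and> b - \<delta> < x \<and> x < b + \<delta> \<longrightarrow>
        b \<in> F s \<and> (\<forall>y. y \<in> F t \<and> b - \<delta> < y \<and> y < b + \<delta> \<longrightarrow> x = y)"
    using reg unfolding regular_fibre_def by blast
  from choice[OF this] obtain \<delta> where "\<forall>b. \<delta> b > 0 \<and> (\<forall>\<^sub>F t in nhds s. \<forall>x. x \<in> F t \<and> b - \<delta> b < x \<and> x < b + \<delta> b \<longrightarrow>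
        b \<in> F s \<and> (\<forall>y. y \<in> F t \<and> b - \<delta> b < y \<and> y < b + \<delta> b \<longrightarrow> x = y))" ..
  then have \<delta>: "\<And>b. \<delta> b > 0"
    "\<And>b. \<forall>\<^sub>F t in nhds s. \<forall>x. x \<in> F t \<and> b - \<delta> b < x \<and> x < b + \<delta> b \<longrightarrow>
        b \<in> F s \<and> (\<forall>y. y \<in> F t \<and> b - \<delta> b < y \<and> y < b + \<delta> b \<longrightarrow> x = y)"
    by blast+
  have "{-K..K} \<subseteq> (\<Union>b\<in>{-K..K}. {b - \<delta> b<..<b + \<delta> b})"
    using \<delta>(1) by force
  then obtain T where "T \<subseteq> {-K..K}" and T: "finite T" "{-K..K} \<subseteq> (\<Union>b\<in>T. {b - \<delta> b<..<b + \<delta> b})"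
    by (rule compactE_image[OF compact_Icc, rotated]) auto
  have "\<forall>\<^sub>F t in nhds s. \<forall>b\<in>T. \<forall>x. x \<in> F t \<and> b - \<delta> b < x \<and> x < b + \<delta> b \<longrightarrow>
        b \<in> F s \<and> (\<forall>y. y \<in> F t \<and> b - \<delta> b < y \<and> y < b + \<delta> b \<longrightarrow> x = y)"
    using T(1) \<delta>(2) by (simp add: eventually_ball_finite_distrib)
  with K have upper: "\<forall>\<^sub>F t in nhds s. card (F t) \<le> card (F s)"
  proof eventually_elim
    case (elim t)
    have "\<forall>x\<in>F t. \<exists>b\<in>T. b - \<delta> b < x \<and> x < b + \<delta> b"
      using elim(1) T(2) by (force simp: subset_iff)
    then obtain g where g: "\<And>x. x \<in> F t \<Longrightarrow> g x \<in> T \<and> g x - \<delta> (g x) < x \<and> x < g x + \<delta> (g x)"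
      by metis
    have "g ` F t \<subseteq> F s"
      using elim(2) g by blast
    moreover have "inj_on g (F t)"
    proof (rule inj_onI)
      fix x y assume xy: "x \<in> F t" "y \<in> F t" "g x = g y"
      then have "g x - \<delta> (g x) < y" "y < g x + \<delta> (g x)"
        using g[of y] by simp_all
      with elim(2) g[of x] xy(1,2) show "x = y"
        by blast
    qed
    ultimately show ?case
      using fin card_inj_on_le by blast
  qed
  obtain \<eta> where \<eta>: "\<eta> > 0" "\<And>b c. b \<in> F s \<Longrightarrow> c \<in> F s \<Longrightarrow> b \<noteq> c \<Longrightarrow> 2 * \<eta> \<le> dist b c"
  proof -
    have "\<forall>b. \<exists>d>0. \<forall>x\<in>F s. x \<noteq> b \<longrightarrow> d \<le> dist b x"
      using finite_set_avoid[OF fin] by blast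
    from choice[OF this] obtain d
      where d: "\<And>b. d b > 0" "\<And>b x. x \<in> F s \<Longrightarrow> x \<noteq> b \<Longrightarrow> d b \<le> dist b x"
      by blast
    \<comment> \<open>The inserted 1 keeps the minimum meaningful when the fibre is empty.\<close>
    define m where "m = Min (insert 1 (d ` F s))"
    have m: "m > 0" "\<And>b. b \<in> F s \<Longrightarrow> m \<le> d b"
      using fin d(1) by (auto simp: m_def)
    show thesis
    proof (rule that[of "m / 2"])
      fix b c assume "b \<in> F s" "c \<in> F s" "b \<noteq> c"
      then show "2 * (m / 2) \<le> dist b c"
        using m(2)[of b] d(2)[of c b] by simp
    qed (use m in simp)
  qed
  have "\<forall>\<^sub>F t in nhds s. \<forall>b\<in>F s. \<exists>x. x \<in> F t \<and> b - \<eta> < x \<and> x < b + \<eta>"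
    using reg fin \<eta>(1) unfolding regular_fibre_def by (simp add: eventually_ball_finite_distrib)
  then have "\<forall>\<^sub>F t in nhds s. card (F s) \<le> card (F t)"
  proof eventually_elim
    case (elim t)
    then obtain g where g: "\<And>b. b \<in> F s \<Longrightarrow> g b \<in> F t \<and> b - \<eta> < g b \<and> g b < b + \<eta>"
      by metis
    have "inj_on g (F s)"
    proof (rule inj_onI)
      fix b c assume bc: "b \<in> F s" "c \<in> F s" "g b = g c"
      then have "dist b c < 2 * \<eta>"
        using g[of b] g[of c] unfolding dist_real_def by linarith
      then show "b = c"
        using \<eta>(2) bc by force
    qed
    moreover have "g ` F s \<subseteq> F t"
      using g by blast
    ultimately show ?case
      using fin card_inj_on_le by blast
  qed
  with upper show ?thesis
    by eventually_elim simp
qed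

text \<open>The cardinality is locally constant along a segment of regular parameters, and a segment
  is connected.\<close>

lemma card_constant_segment:
  assumes "\<And>t. finite (F t)" and "\<And>u. u \<in> closed_segment s t \<Longrightarrow> regular_fibre F u"
  shows "card (F s) = card (F t)"
proof -
  have "(\<lambda>u. card (F u)) constant_on closed_segment s t"
  proof (rule locally_constant_imp_constant)
    fix u assume u: "u \<in> closed_segment s t"
    from card_locally_constant[OF assms(1) assms(2)[OF this]]
    obtain U where U: "open U" "u \<in> U" "\<forall>x\<in>U. card (F x) = card (F u)"
      unfolding eventually_nhds by blast
    show "\<exists>V. openin (top_of_set (closed_segment s t)) V \<and> u \<in> V \<and> (\<forall>x\<in>V. card (F x) = card (F u))"
    proof (intro exI conjI ballI)
      show "openin (top_of_set (closed_segment s t)) (closed_segment s t \<inter> U)"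
        using U(1) by (rule openin_open_Int)
      show "u \<in> closed_segment s t \<inter> U"
        using u U(2) by (rule IntI)
      show "card (F x) = card (F u)" if "x \<in> closed_segment s t \<inter> U" for x
        using U(3) that by (rule bspec[OF _ IntD2])
    qed
  qed simp
  then obtain k where "\<forall>u\<in>closed_segment s t. card (F u) = k"
    unfolding constant_on_def ..
  then show ?thesis
    by simp
qed

text \<open>Every component of the complement of \<open>B\<close> gets a representative that is
  first-order definable from \<open>B\<close>: 0 if \<open>B\<close> is empty, a point at distance 1
  from the end of an unbounded component, a midpoint otherwise. The midpoint is written with
  \<open>s' + s'\<close>, so that only sums of terms occur.\<close>

lemma gap_sample:
  fixes s :: real
  assumes "finite B" "s \<notin> B"
  obtains s' where "closed_segment s s' \<inter> B = {}"
    "s' = 0 \<or> (\<exists>a. a \<in> B \<and> (s' = a + 1 \<or> s' = a - 1)) \<or> (\<exists>a b. a \<in> B \<and> b \<in> B \<and> s' + s' = a + b)"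
proof -
  have lower: "(\<forall>a\<in>B. s < a) \<or> (\<exists>l\<in>B. l < s \<and> (\<forall>a\<in>B. a \<le> l \<or> s < a))"
  proof (cases "{a \<in> B. a < s} = {}")
    case True
    then show ?thesis
      using assms(2) by (auto simp: order_le_less not_less)
  next
    case False
    define l where "l = Max {a \<in> B. a < s}"
    have fin: "finite {a \<in> B. a < s}"
      using assms(1) by simp
    have l: "l \<in> B" "l < s" "\<And>a. a \<in> B \<Longrightarrow> a < s \<Longrightarrow> a \<le> l"
      using Max_in[OF fin False] Max_ge[OF fin] by (simp_all add: l_def)
    have "a \<le> l \<or> s < a" if "a \<in> B" for a
      using l(3)[OF that] that assms(2) by (cases a s rule: linorder_cases) auto
    then show ?thesis
      using l by blast
  qed
  have upper: "(\<forall>a\<in>B. a < s) \<or> (\<exists>r\<in>B. s < r \<and> (\<forall>a\<in>B. r \<le> a \<or> a < s))"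
  proof (cases "{a \<in> B. s < a} = {}")
    case True
    then show ?thesis
      using assms(2) by (auto simp: order_le_less not_less)
  next
    case False
    define r where "r = Min {a \<in> B. s < a}"
    have fin: "finite {a \<in> B. s < a}"
      using assms(1) by simp
    have r: "r \<in> B" "s < r" "\<And>a. a \<in> B \<Longrightarrow> s < a \<Longrightarrow> r \<le> a"
      using Min_in[OF fin False] Min_le[OF fin] by (simp_all add: r_def)
    have "r \<le> a \<or> a < s" if "a \<in> B" for a
      using r(3)[OF that] that assms(2) by (cases a s rule: linorder_cases) auto
    then show ?thesis
      using r by blast
  qed
  have segment: "closed_segment s s' \<inter> B = {}"
    if "\<And>a. a \<in> B \<Longrightarrow> a < s \<and> a < s' \<or> s < a \<and> s' < a" for s'
  proof -
    have "a \<notin> closed_segment s s'" if "a \<in> B" for a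
      using \<open>\<And>a. a \<in> B \<Longrightarrow> a < s \<and> a < s' \<or> s < a \<and> s' < a\<close>[OF that]
      by (auto simp: closed_segment_eq_real_ivl)
    then show ?thesis by blast
  qed
  from lower show thesis
  proof (elim disjE bexE conjE)
    assume lo: "\<forall>a\<in>B. s < a"
    from upper show thesis
    proof (elim disjE bexE conjE)
      assume "\<forall>a\<in>B. a < s"
      with lo have "B = {}" by force
      then show thesis by (intro that[of 0]) auto
    next
      fix r assume r: "r \<in> B" "s < r" "\<forall>a\<in>B. r \<le> a \<or> a < s"
      have "s < a \<and> r - 1 < a" if "a \<in> B" for a
        using bspec[OF lo that] bspec[OF r(3) that] by auto
      then show thesis
        using r(1) by (intro that[of "r - 1"] segment) blast+
    qed
  next
    fix l assume l: "l \<in> B" "l < s" "\<forall>a\<in>B. a \<le> l \<or> s < a"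
    from upper show thesis
    proof (elim disjE bexE conjE)
      assume up: "\<forall>a\<in>B. a < s"
      have "a < s \<and> a < l + 1" if "a \<in> B" for a
        using bspec[OF up that] bspec[OF l(3) that] by auto
      then show thesis
        using l(1) by (intro that[of "l + 1"] segment) blast+
    next
      fix r assume r: "r \<in> B" "s < r" "\<forall>a\<in>B. r \<le> a \<or> a < s"
      have "a < s \<and> a < (l + r) / 2 \<or> s < a \<and> (l + r) / 2 < a" if "a \<in> B" for a
        using l(2) r(2) bspec[OF r(3) that] bspec[OF l(3) that] by auto
      moreover have "(l + r) / 2 + (l + r) / 2 = l + r"
        by simp
      ultimately show thesis
        using l(1) r(1) by (intro that[of "(l + r) / 2"] segment) blast+
    qed
  qed
qed

section \<open>Irregular parameters and the uniform bound\<close>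

context ominimal_structure begin

lemma definable_term_minus: "definable_term t \<Longrightarrow> definable_term (\<lambda>e. - t e)"
  using definable_term_diff[OF definable_term_const[of 0], of t] by simp

lemmas definable_intros =
  definable_conj definable_disj definable_imp definable_not definable_ex definable_all
  definable_less definable_le definable_eq definable_const
  definable_term_var definable_term_const definable_term_add definable_term_diff definable_term_minus definable_term_mult

lemma definable_eventually_nhds:
  assumes "definable (\<lambda>e. Q (e 0) (\<lambda>i. e (Suc i)))" "definable_term t"
  shows "definable (\<lambda>e. \<forall>\<^sub>F y in nhds (t e). Q y e)"
  unfolding eventually_nhds_real
  \<comment> \<open>Two quantifiers are in scope: coordinate 0 is the nearby point, coordinate 1 the
    radius, and the old environment starts at 2.\<close>
  using definable_rename[OF assms(1), of "case_nat 0 (\<lambda>i. Suc (Suc i))"]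
  by (intro definable_intros definable_term_rename[OF assms(2)]) simp

lemma finite_not_eventually:
  assumes "definable (\<lambda>e. P (e 0))"
  shows "finite {x. P x \<and> \<not> (\<forall>\<^sub>F y in nhds x. P y)}"
proof (rule finite_subset[OF _ finite_not_interior[OF assms]], safe)
  fix x p q assume "\<not> (\<forall>\<^sub>F y in nhds x. P y)" "p < x" "x < q" "\<forall>y. p < y \<and> y < q \<longrightarrow> P y"
  then show False
    using eventually_mono[OF eventually_nhds_between] by metis
qed

lemma definable_regular_fibre:
  assumes F: "\<And>s t u. definable_term t \<Longrightarrow> definable_term u \<Longrightarrow> (\<And>i. definable_term (\<lambda>e. s e i)) \<Longrightarrow>
      definable (\<lambda>e. t e \<in> F (s e) (u e))"
    and "definable_term u"  "\<And>i. definable_term (\<lambda>e. s e i)"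
  shows "definable (\<lambda>e. regular_fibre (F (s e)) (u e))"
  unfolding regular_fibre_def
  by (intro definable_intros F definable_eventually_nhds definable_term_rename[OF assms(2)]
      definable_term_rename[OF assms(3)] assms(2,3))

text \<open>At an irregular s one of countably many definable properties holds but does not persist
  near s: boundedness of the fibre by a natural number, or existence, absence or uniqueness of a
  fibre point in a rational interval. Each such property is unstable at finitely many parameters
  only.\<close>

lemma countable_irregular:
  assumes F: "\<And>t u. definable_term t \<Longrightarrow> definable_term u \<Longrightarrow> definable (\<lambda>e. t e \<in> F (u e))"
    and fin: "\<And>s. finite (F s)"
  shows "countable {s. \<not> regular_fibre F s}"
proof -
  define X where "X P = {x. P x \<and> \<not> (\<forall>\<^sub>F y in nhds x. P y)}" for P :: "real \<Rightarrow> bool"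
  have X: "\<forall>\<^sub>F y in nhds s. P y" if "s \<notin> X P" "P s" for s P
    using that unfolding X_def by blast
  define B where "B k t \<longleftrightarrow> (\<forall>x. x \<in> F t \<longrightarrow> - k \<le> x \<and> x \<le> k)" for k t
  define E where "E p q t \<longleftrightarrow> (\<exists>x. x \<in> F t \<and> p < x \<and> x < q)" for p q t
  define M where "M p q t \<longleftrightarrow> (\<forall>x. x \<in> F t \<and> p < x \<and> x < q \<longrightarrow> (\<forall>y. y \<in> F t \<and> p < y \<and> y < q \<longrightarrow> x = y))" for p q t
  have fX: "finite (X (B k))" "finite (X (E p q))" "finite (X (\<lambda>t. \<not> E p q t))" "finite (X (M p q))" for k p q
    unfolding X_def B_def E_def M_def
    by (intro finite_not_eventually definable_intros F)+
  let ?U = "(\<Union>k::nat. X (B k)) \<union> (\<Union>p\<in>\<rat>. \<Union>q\<in>\<rat>. X (E p q) \<union> X (\<lambda>t. \<not> E p q t) \<union> X (M p q))"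
  have "countable ?U"
    using fX by (intro countable_Un countable_UN countable_rat) (auto intro: countable_finite)
  moreover have "{s. \<not> regular_fibre F s} \<subseteq> ?U"
  proof (rule subsetI, rule ccontr)
    fix s assume "s \<in> {s. \<not> regular_fibre F s}" and s: "s \<notin> ?U"
    moreover have "regular_fibre F s"
      unfolding regular_fibre_def
    proof (intro conjI allI impI)
      obtain r where "\<And>x. x \<in> F s \<Longrightarrow> \<bar>x\<bar> \<le> r"
        using finite_imp_bounded[OF fin[of s]] unfolding bounded_iff by auto
      moreover obtain k :: nat where "r \<le> real k"
        using real_arch_simple by blast
      ultimately have "B k s"
        unfolding B_def by (meson abs_le_iff minus_le_iff order_trans)
      moreover have "s \<notin> X (B k)"
        using s by blast
      ultimately show "\<exists>K. \<forall>\<^sub>F t in nhds s. \<forall>x. x \<in> F t \<longrightarrow> - K \<le> x \<and> x \<le> K"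
        using X unfolding B_def by blast
    next
      fix b
      \<comment> \<open>The rational interval meets \<open>F s\<close> at most in b. If b lies in
        \<open>F s\<close>, uniqueness in the interval persists nearby; otherwise absence
        does.\<close>
      obtain p q where pq: "p \<in> \<rat>" "q \<in> \<rat>" "p < b" "b < q"
        "\<And>x. x \<in> F s \<Longrightarrow> p < x \<Longrightarrow> x < q \<Longrightarrow> x = b"
        using finite_isolating_interval[OF fin] by blast
      have *: "\<forall>\<^sub>F t in nhds s. \<forall>x. x \<in> F t \<and> p < x \<and> x < q \<longrightarrow>
          b \<in> F s \<and> (\<forall>y. y \<in> F t \<and> p < y \<and> y < q \<longrightarrow> x = y)"
      proof (cases "b \<in> F s")
        case True
        have "M p q s"
          unfolding M_def using pq(5) by metis
        have "s \<notin> X (M p q)"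
          using pq s by auto
        from X[OF this \<open>M p q s\<close>] show ?thesis
          by eventually_elim (use True in \<open>simp add: M_def\<close>)
      next
        case False
        have "\<not> E p q s" "s \<notin> X (\<lambda>t. \<not> E p q t)"
          using pq False s by (auto simp: E_def)
        from X[OF this(2,1)] show ?thesis
          by eventually_elim (auto simp: E_def)
      qed
      show "\<exists>\<delta>>0. \<forall>\<^sub>F t in nhds s. \<forall>x. x \<in> F t \<and> b - \<delta> < x \<and> x < b + \<delta> \<longrightarrow>
        b \<in> F s \<and> (\<forall>y. y \<in> F t \<and> b - \<delta> < y \<and> y < b + \<delta> \<longrightarrow> x = y)"
      proof (intro exI conjI)
        show "0 < min (b - p) (q - b)"
          using pq by simp
        show "\<forall>\<^sub>F t in nhds s. \<forall>x. x \<in> F t \<and> b - min (b - p) (q - b) < x \<and> x < b + min (b - p) (q - b) \<longrightarrow>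
          b \<in> F s \<and> (\<forall>y. y \<in> F t \<and> b - min (b - p) (q - b) < y \<and> y < b + min (b - p) (q - b) \<longrightarrow> x = y)"
          using * by eventually_elim (smt (verit))
      qed
    next
      fix b \<delta> :: real assume b: "b \<in> F s \<and> 0 < \<delta>"
      obtain p where p: "p \<in> \<rat>" "b - \<delta> < p" "p < b"
        using Rats_dense_in_real[of "b - \<delta>" b] b by auto
      obtain q where q: "q \<in> \<rat>" "b < q" "q < b + \<delta>"
        using Rats_dense_in_real[of b "b + \<delta>"] b by auto
      have "E p q s" "s \<notin> X (E p q)"
        using p q b s by (auto simp: E_def)
      from X[OF this(2,1)] show "\<forall>\<^sub>F t in nhds s. \<exists>x. x \<in> F t \<and> b - \<delta> < x \<and> x < b + \<delta>"
        by eventually_elim (use p q in \<open>force simp: E_def\<close>)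
    qed
    ultimately show False by simp
  qed
  ultimately show ?thesis
    by (rule countable_subset[rotated])
qed

text \<open>The parameter space is peeled off one coordinate at a time: in the last parameter the fibre
  cardinality is constant off a finite definable set, so finitely many definable sample points
  capture all values, and the union of the fibres over these points is a finite-fibred family with
  one parameter less.\<close>
theorem uniform_finiteness:
  assumes "definable (\<lambda>e. e 0 \<in> A (\<lambda>i. e (Suc i)))"
    and "\<And>e. finite (A e)"
    and "\<And>e e'. (\<And>i. i < d \<Longrightarrow> e i = e' i) \<Longrightarrow> A e = A e'"
  shows "\<exists>N. \<forall>e. card (A e) \<le> N"
  using assms
proof (induction d arbitrary: A)
  case 0
  have "card (A e) = card (A (\<lambda>_. 0))" for e
    by (rule arg_cong[OF "0.prems"(3)]) simp
  then show ?case
    by (intro exI allI eq_refl)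
next
  case (Suc d)
  \<comment> \<open>Coordinate 0 of the environment is the parameter that is split off;
    \<open>e\<close> carries the remaining ones.\<close>
  define F where "F e s = A (case_nat s e)" for e s
  have F: "definable (\<lambda>e. t e \<in> F (s e) (u e))"
    if "definable_term t" "definable_term u" "\<And>i. definable_term (\<lambda>e. s e i)" for s t u
    unfolding F_def
    by (rule definable_subst_param[where P = "\<lambda>e x. x \<in> A e", OF Suc.prems(1)])
      (intro definable_term_case_nat that)+
  have fin: "finite (F e s)" for e s
    unfolding F_def by (rule Suc.prems)
  define Bad where "Bad e = {s. \<not> regular_fibre (F e) s}" for e
  have Bad: "definable (\<lambda>e. u e \<in> Bad (s e))"
    if "definable_term u" "\<And>i. definable_term (\<lambda>e. s e i)" for s u
    unfolding Bad_def mem_Collect_eq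
    by (intro definable_not definable_regular_fibre F that)
  have fin_Bad: "finite (Bad e)" for e
  proof -
    have "definable (\<lambda>e'. e' 0 \<in> Bad e)"
      by (intro Bad definable_intros)
    moreover have "countable (Bad e)"
      unfolding Bad_def by (intro countable_irregular fin F definable_term_const)
    ultimately show ?thesis
      using finite_if_countable[of "\<lambda>s. s \<in> Bad e"] by simp
  qed
  \<comment> \<open>Each bad parameter is a sample of itself; the other clauses contain a
    representative of every gap between bad parameters.\<close>
  define Sam where "Sam e = {s. s = 0 \<or> s \<in> Bad e \<or> (\<exists>a. a \<in> Bad e \<and> (s = a + 1 \<or> s = a - 1)) \<or>
      (\<exists>a b. a \<in> Bad e \<and> b \<in> Bad e \<and> s + s = a + b)}" for e
  have fin_Sam: "finite (Sam e)" for e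
  proof (rule finite_subset)
    show "Sam e \<subseteq> {0} \<union> Bad e \<union> (\<lambda>a. a + 1) ` Bad e \<union> (\<lambda>a. a - 1) ` Bad e
        \<union> (\<lambda>(a, b). (a + b) / 2) ` (Bad e \<times> Bad e)"
    proof
      fix s assume "s \<in> Sam e"
      then consider "s = 0" | "s \<in> Bad e" | a where "a \<in> Bad e" "s = a + 1 \<or> s = a - 1"
        | a b where "a \<in> Bad e" "b \<in> Bad e" "s + s = a + b"
        unfolding Sam_def by blast
      then show "s \<in> {0} \<union> Bad e \<union> (\<lambda>a. a + 1) ` Bad e \<union> (\<lambda>a. a - 1) ` Bad e
        \<union> (\<lambda>(a, b). (a + b) / 2) ` (Bad e \<times> Bad e)"
      proof cases
        case (4 a b)
        then have "s = (\<lambda>(a, b). (a + b) / 2) (a, b)" by simp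
        with 4 show ?thesis by blast
      qed auto
    qed
  qed (use fin_Bad in auto)
  \<comment> \<open>\<open>C e\<close> contains the fibre over each sample. A bound on its size
    therefore bounds the fibres over samples and, by constancy on gaps, all the others.\<close>
  define C where "C e = {x. \<exists>s. s \<in> Sam e \<and> x \<in> F e s}" for e
  have "definable (\<lambda>e. e 0 \<in> C (\<lambda>i. e (Suc i)))"
    unfolding C_def Sam_def mem_Collect_eq
    by (intro definable_intros Bad F)
  moreover have fin_C: "finite (C e)" for e
  proof -
    have "C e = (\<Union>s\<in>Sam e. F e s)"
      unfolding C_def by blast
    then show ?thesis
      using fin fin_Sam by simp
  qed
  moreover have "C e = C e'" if "\<And>i. i < d \<Longrightarrow> e i = e' i" for e e'
  proof -
    have "F e s = F e' s" for s
      unfolding F_def by (rule Suc.prems(3)) (use that in \<open>auto split: nat.split\<close>)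
    then have "F e = F e'" by blast
    then show ?thesis
      by (simp add: C_def Sam_def Bad_def)
  qed
  ultimately obtain N where N: "\<And>e. card (C e) \<le> N"
    using Suc.IH[of C] by blast
  have "card (F e s) \<le> N" for e s
  proof -
    obtain s' where s': "s' \<in> Sam e" "card (F e s) = card (F e s')"
    proof (cases "s \<in> Bad e")
      case True
      then show thesis
        by (intro that[of s]) (auto simp: Sam_def)
    next
      case False
      obtain s' where s': "closed_segment s s' \<inter> Bad e = {}"
        "s' = 0 \<or> (\<exists>a. a \<in> Bad e \<and> (s' = a + 1 \<or> s' = a - 1)) \<or>
          (\<exists>a b. a \<in> Bad e \<and> b \<in> Bad e \<and> s' + s' = a + b)"
        using gap_sample[OF fin_Bad False] by blast
      have "card (F e s) = card (F e s')"
        by (rule card_constant_segment) (use fin s'(1) in \<open>auto simp: Bad_def\<close>)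
      then show thesis
        using s'(2) by (intro that[of s']) (auto simp: Sam_def)
    qed
    have "F e s' \<subseteq> C e"
      using s'(1) unfolding C_def by blast
    then show ?thesis
      using card_mono[OF fin_C] s'(2) N order_trans by metis
  qed
  then have "card (F (\<lambda>i. e (Suc i)) (e 0)) \<le> N" for e .
  then have "card (A e) \<le> N" for e
    unfolding F_def case_nat_Suc_id .
  then show ?case
    by (intro exI allI)
qed

end

section \<open>Generic points\<close>

text \<open>The first list entry is quantified outermost.\<close>
primrec iter_quant :: "(('a \<Rightarrow> bool) \<Rightarrow> bool) \<Rightarrow> nat \<Rightarrow> ('a list \<Rightarrow> bool) \<Rightarrow> bool" where
  "iter_quant Q 0 P = P []"
| "iter_quant Q (Suc n) P = Q (\<lambda>x. iter_quant Q n (\<lambda>xs. P (x # xs)))"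

text \<open>This is "for all points outside a small set" for a sigma-ideal of small sets, seen as a
  quantifier. In this form it can be iterated, and the iterates satisfy the same laws.\<close>

definition sigma_quant :: "(('a \<Rightarrow> bool) \<Rightarrow> bool) \<Rightarrow> bool" where
  "sigma_quant Q \<longleftrightarrow> (\<forall>P P'. Q P \<longrightarrow> (\<forall>x. P x \<longrightarrow> P' x) \<longrightarrow> Q P') \<and>
     (\<forall>P :: nat \<Rightarrow> 'a \<Rightarrow> bool. (\<forall>n. Q (P n)) \<longrightarrow> Q (\<lambda>x. \<forall>n. P n x)) \<and> Q (\<lambda>_. True)"

lemma sigma_quant_mono: "sigma_quant Q \<Longrightarrow> Q P \<Longrightarrow> (\<And>x. P x \<Longrightarrow> P' x) \<Longrightarrow> Q P'"
  and sigma_quant_all_nat: "sigma_quant Q \<Longrightarrow> (\<And>n :: nat. Q (R n)) \<Longrightarrow> Q (\<lambda>x. \<forall>n. R n x)"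
  and sigma_quant_True: "sigma_quant Q \<Longrightarrow> Q (\<lambda>_. True)"
  unfolding sigma_quant_def by simp_all

lemma sigma_quant_ball:
  assumes Q: "sigma_quant Q" and "countable I" and P: "\<And>i. i \<in> I \<Longrightarrow> Q (P i)"
  shows "Q (\<lambda>x. \<forall>i\<in>I. P i x)"
proof (cases "I = {}")
  case True
  then show ?thesis
    using sigma_quant_True[OF Q] by simp
next
  case False
  have "Q (\<lambda>x. \<forall>n. P (from_nat_into I n) x)"
    by (intro sigma_quant_all_nat[OF Q] P from_nat_into False)
  moreover have "(\<forall>n. P (from_nat_into I n) x) \<longleftrightarrow> (\<forall>i\<in>I. P i x)" for x
    using range_from_nat_into[OF False \<open>countable I\<close>] by (metis from_nat_into[OF False] rangeE)
  ultimately show ?thesis by simp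
qed

lemma sigma_quant_conj:
  assumes "sigma_quant Q" "Q P" "Q P'"
  shows "Q (\<lambda>x. P x \<and> P' x)"
proof -
  have "Q (\<lambda>x. \<forall>b\<in>UNIV. (if b then P else P') x)"
    by (rule sigma_quant_ball[OF assms(1)]) (use assms(2,3) in auto)
  then show ?thesis
  proof (rule sigma_quant_mono[OF assms(1)])
    fix x assume *: "\<forall>b\<in>UNIV. (if b then P else P') x"
    show "P x \<and> P' x"
      using bspec[OF *, of True] bspec[OF *, of False] by simp
  qed
qed

text \<open>Each law is pushed through one quantifier at a time. It serves on two levels: from
  numbers to vectors, and from vectors to tuples of vectors.\<close>

lemma sigma_quant_iter:
  assumes Q: "sigma_quant Q"
  shows "sigma_quant (iter_quant Q n)"
proof (induction n)
  case 0
  then show ?case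
    by (simp add: sigma_quant_def)
next
  case (Suc n)
  show ?case
    unfolding sigma_quant_def iter_quant.simps
  proof (intro conjI allI impI)
    fix P P' :: "'a list \<Rightarrow> bool"
    assume "Q (\<lambda>x. iter_quant Q n (\<lambda>xs. P (x # xs)))" "\<forall>x. P x \<longrightarrow> P' x"
    then show "Q (\<lambda>x. iter_quant Q n (\<lambda>xs. P' (x # xs)))"
      by (elim sigma_quant_mono[OF Q] sigma_quant_mono[OF Suc.IH]) simp
  next
    fix P :: "nat \<Rightarrow> 'a list \<Rightarrow> bool"
    assume "\<forall>k. Q (\<lambda>x. iter_quant Q n (\<lambda>xs. P k (x # xs)))"
    then have "Q (\<lambda>x. \<forall>k. iter_quant Q n (\<lambda>xs. P k (x # xs)))"
      by (intro sigma_quant_all_nat[OF Q]) simp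
    then show "Q (\<lambda>x. iter_quant Q n (\<lambda>xs. \<forall>k. P k (x # xs)))"
      by (rule sigma_quant_mono[OF Q]) (intro sigma_quant_all_nat[OF Suc.IH], simp)
  next
    show "Q (\<lambda>x. iter_quant Q n (\<lambda>xs. True))"
      using sigma_quant_True[OF Q] sigma_quant_True[OF Suc.IH] by simp
  qed
qed

lemma iter_quant_append:
  "iter_quant Q (m + n) P = iter_quant Q m (\<lambda>xs. iter_quant Q n (\<lambda>ys. P (xs @ ys)))"
  by (induction m arbitrary: P) simp_all

lemma iter_quant_Suc_right:
  "iter_quant Q (Suc n) P = iter_quant Q n (\<lambda>xs. Q (\<lambda>x. P (xs @ [x])))"
  using iter_quant_append[of Q n 1 P] by simp

text \<open>N generic vectors of length k amount to \<open>N * k\<close> generic numbers, so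
  arguments about single coordinates can be run on the flattened tuple.\<close>

lemma iter_quant_concat:
  "iter_quant (iter_quant Q k) N (\<lambda>xss. P (concat xss)) = iter_quant Q (N * k) P"
proof (induction N arbitrary: P)
  case (Suc N)
  have "iter_quant (iter_quant Q k) N (\<lambda>xss. P (x @ concat xss)) = iter_quant Q (N * k) (\<lambda>zs. P (x @ zs))" for x
    by (rule Suc.IH)
  then show ?case
    by (simp add: iter_quant_append)
qed simp

lemma iter_quant_length:
  assumes "sigma_quant Q"
  shows "iter_quant Q n (\<lambda>xs. length xs = n)"
  by (induction n) (simp_all add: sigma_quant_True[OF assms])

lemma iter_quant_all:
  assumes "sigma_quant Q" "Q R"
  shows "iter_quant Q n (\<lambda>xs. \<forall>x\<in>set xs. R x)"
proof (induction n)
  case (Suc n)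
  show ?case
    unfolding iter_quant.simps
  proof (rule sigma_quant_mono[OF assms])
    fix x assume "R x"
    with Suc show "iter_quant Q n (\<lambda>xs. \<forall>y\<in>set (x # xs). R y)" by simp
  qed
qed simp

text \<open>Only lists of length n are ever inspected, so an implication is needed for those
  alone.\<close>

lemma iter_quant_mono:
  assumes Q: "sigma_quant Q" and "iter_quant Q n P"
    and "\<And>xs. length xs = n \<Longrightarrow> P xs \<Longrightarrow> P' xs"
  shows "iter_quant Q n P'"
proof -
  note iter = sigma_quant_iter[OF Q, of n]
  have "iter_quant Q n (\<lambda>xs. P xs \<and> length xs = n)"
    using sigma_quant_conj[of "iter_quant Q n" P "\<lambda>xs. length xs = n"] iter assms(2) iter_quant_length[OF Q]
    by simp
  then show ?thesis
    using sigma_quant_mono[of "iter_quant Q n" "\<lambda>xs. P xs \<and> length xs = n" P'] iter assms(3)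
    by simp
qed

text \<open>A countable set of reals is Lebesgue null and has dense complement, so this one
  quantifier serves both measure and topology.\<close>

definition cocountable :: "('a \<Rightarrow> bool) \<Rightarrow> bool" where
  "cocountable P \<longleftrightarrow> countable {x. \<not> P x}"

lemma sigma_quant_cocountable: "sigma_quant cocountable"
  unfolding sigma_quant_def cocountable_def
proof (intro conjI allI impI)
  fix P P' :: "'a \<Rightarrow> bool"
  assume "countable {x. \<not> P x}" "\<forall>x. P x \<longrightarrow> P' x"
  then show "countable {x. \<not> P' x}"
    by (elim countable_subset[rotated]) auto
next
  fix P :: "nat \<Rightarrow> 'a \<Rightarrow> bool"
  assume "\<forall>n. countable {x. \<not> P n x}"
  then have "countable (\<Union>n. {x. \<not> P n x})" by simp
  then show "countable {x. \<not> (\<forall>n. P n x)}"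
    by (rule countable_subset[rotated]) auto
qed simp

context ominimal_structure begin

text \<open>One real parameter s is eliminated at the cost of doubling the number of points: a generic
  first half excludes all rational s, hence all but finitely many s, and a generic second half
  excludes these.\<close>
lemma generic_points_exclude_parameters:
  assumes Q: "sigma_quant Q"
    and "\<And>x. definable (\<lambda>u. Z u x)"
    and "\<And>u. Q (\<lambda>x. \<not> Z u x)"
    and "\<And>u u' x. (\<And>i. i < d \<Longrightarrow> u i = u' i) \<Longrightarrow> Z u x = Z u' x"
  shows "iter_quant Q (2 ^ d) (\<lambda>xs. \<not> (\<exists>u. \<forall>x\<in>set xs. Z u x))"
  using assms(2-)
proof (induction d arbitrary: Z)
  case 0
  have "Z u x = Z (\<lambda>_. 0) x" for u x
    by (rule "0.prems"(3)) simp
  then have "(\<exists>u. Z u y) \<longleftrightarrow> Z (\<lambda>_. 0) y" for y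
    by blast
  then show ?case
    using "0.prems"(2)[of "\<lambda>_. 0"] by (simp del: not_ex)
next
  case (Suc d)
  \<comment> \<open>\<open>T xs s\<close>: with the first parameter fixed to s, some choice of the
    other parameters still fits every point of \<open>xs\<close>.\<close>
  define T where "T xs s \<longleftrightarrow> (\<exists>u. \<forall>x\<in>set xs. Z (case_nat s u) x)" for xs s
  have T: "iter_quant Q (2 ^ d) (\<lambda>xs. \<not> T xs s)" for s
    unfolding T_def
  proof (rule Suc.IH)
    show "definable (\<lambda>u. Z (case_nat s u) x)" for x
      by (rule definable_subst[OF Suc.prems(1)]) (intro definable_term_case_nat definable_intros)
    show "Q (\<lambda>x. \<not> Z (case_nat s u) x)" for u
      by (rule Suc.prems(2))
    show "Z (case_nat s u) x = Z (case_nat s u') x" if "\<And>i. i < d \<Longrightarrow> u i = u' i" for u u' x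
      by (rule Suc.prems(3)) (use that in \<open>auto split: nat.split\<close>)
  qed
  \<comment> \<open>\<open>T xs\<close> is definable, and the rationals, which are dense, lie in its
    complement.\<close>
  have fin: "finite {s. T xs s}" if "\<forall>q\<in>\<rat>. \<not> T xs q" for xs
  proof (rule finite_if_dense_complement)
    have "definable (\<lambda>u. \<forall>x\<in>set xs. Z u x)"
      by (intro definable_Ball Suc.prems(1) finite_set)
    from definable_ex_tail[OF this, of 1]
    have "definable (\<lambda>e. \<exists>u. \<forall>x\<in>set xs. Z (\<lambda>i. if i < 1 then e i else u (i - 1)) x)" .
    moreover have "(\<lambda>i. if i < 1 then e i else u (i - 1)) = case_nat (e 0) u" for e u :: "nat \<Rightarrow> real"
      by (auto simp: fun_eq_iff split: nat.split)
    ultimately show "definable (\<lambda>e. T xs (e 0))"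
      by (simp add: T_def)
    show "\<exists>y. p < y \<and> y < q \<and> \<not> T xs y" if "p < q" for p q
      using Rats_dense_in_real[OF that] \<open>\<forall>q\<in>\<rat>. \<not> T xs q\<close> by blast
  qed
  have "iter_quant Q (2 ^ d) (\<lambda>xs. \<forall>q\<in>\<rat>. \<not> T xs q)"
    by (intro sigma_quant_ball[OF sigma_quant_iter[OF Q]] countable_rat T)
  then have "iter_quant Q (2 ^ d + 2 ^ d) (\<lambda>xs. \<not> (\<exists>u. \<forall>x\<in>set xs. Z u x))"
    unfolding iter_quant_append
  proof (rule sigma_quant_mono[OF sigma_quant_iter[OF Q]])
    fix xs assume xs: "\<forall>q\<in>\<rat>. \<not> T xs q"
    have "iter_quant Q (2 ^ d) (\<lambda>ys. \<forall>s\<in>{s. T xs s}. \<not> T ys s)"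
      by (intro sigma_quant_ball[OF sigma_quant_iter[OF Q]] countable_finite fin xs T)
    then show "iter_quant Q (2 ^ d) (\<lambda>ys. \<not> (\<exists>u. \<forall>x\<in>set (xs @ ys). Z u x))"
    proof (rule sigma_quant_mono[OF sigma_quant_iter[OF Q]])
      fix ys assume ys: "\<forall>s\<in>{s. T xs s}. \<not> T ys s"
      show "\<not> (\<exists>u. \<forall>x\<in>set (xs @ ys). Z u x)"
      proof
        assume "\<exists>u. \<forall>x\<in>set (xs @ ys). Z u x"
        then obtain u where "\<forall>x\<in>set (xs @ ys). Z (case_nat (u 0) (\<lambda>i. u (Suc i))) x"
          unfolding case_nat_Suc_id by blast
        then have "T xs (u 0)" "T ys (u 0)"
          unfolding T_def by auto
        with ys show False by simp
      qed
    qed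
  qed
  then show ?case
    by (simp add: mult_2)
qed

text \<open>For a fixed initial segment the last coordinate is interior to the good fibre with
  finitely many exceptions, and then some rational interval around it lies in that fibre. Containing
  a given rational interval is a definable property of the initial segment, so by induction it is
  generically stable; there are only countably many rational intervals to treat.\<close>

lemma generic_interior:
  assumes "definable (\<lambda>e. R (map e [0..<n]))"
  shows "iter_quant cocountable n (\<lambda>xs. R xs \<longrightarrow>
    (\<exists>\<epsilon>>0. \<forall>ys. list_all2 (\<lambda>x y. \<bar>x - y\<bar> < \<epsilon>) xs ys \<longrightarrow> R ys))"
  using assms
proof (induction n arbitrary: R)
  case 0
  have "\<exists>\<epsilon>::real. \<epsilon> > 0"
    by (rule exI[of _ 1]) simp
  then show ?case by simp
next
  case (Suc n)
  note cc = sigma_quant_iter[OF sigma_quant_cocountable]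
  define I where "I p q xs \<longleftrightarrow> (\<forall>y. p < y \<and> y < q \<longrightarrow> R (xs @ [y]))" for p q xs
  have map_snoc: "map (\<lambda>i. if i < n then f i else y) [0..<Suc n] = map f [0..<n] @ [y]"
    for f :: "nat \<Rightarrow> real" and y
    by simp
  have "definable (\<lambda>e. I p q (map e [0..<n]))" for p q
  proof -
    \<comment> \<open>The list entries are rotated: the last entry is read from coordinate 0, where
      a quantifier can bind it.\<close>
    have "definable (\<lambda>e. R (map (\<lambda>i. if i < n then e (Suc i) else e 0) [0..<Suc n]))"
      by (rule definable_rename[OF Suc.prems, of "\<lambda>i. if i < n then Suc i else 0", unfolded if_distrib[of e for e :: "nat \<Rightarrow> real"]])
    then have "definable (\<lambda>e. R (map (\<lambda>i. e (Suc i)) [0..<n] @ [e 0]))"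
      unfolding map_snoc .
    then show ?thesis
      unfolding I_def by (intro definable_intros)
  qed
  then have "iter_quant cocountable n (\<lambda>xs. \<forall>p\<in>\<rat>. \<forall>q\<in>\<rat>. I p q xs \<longrightarrow>
      (\<exists>\<epsilon>>0. \<forall>ys. list_all2 (\<lambda>x y. \<bar>x - y\<bar> < \<epsilon>) xs ys \<longrightarrow> I p q ys))"
    by (intro sigma_quant_ball[OF cc] countable_rat Suc.IH)
  then show ?case
    unfolding iter_quant_Suc_right
  proof (rule iter_quant_mono[OF sigma_quant_cocountable])
    fix xs :: "real list" assume len: "length xs = n"
      and xs: "\<forall>p\<in>\<rat>. \<forall>q\<in>\<rat>. I p q xs \<longrightarrow>
        (\<exists>\<epsilon>>0. \<forall>ys. list_all2 (\<lambda>x y. \<bar>x - y\<bar> < \<epsilon>) xs ys \<longrightarrow> I p q ys)"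
    have "definable (\<lambda>e. R (map (\<lambda>i. if i < n then xs ! i else e 0) [0..<Suc n]))"
    proof (rule definable_subst[OF Suc.prems])
      show "definable_term (\<lambda>e. if i < n then xs ! i else e 0)" for i
        by (cases "i < n") (simp_all add: definable_term_const definable_term_var)
    qed
    then have "definable (\<lambda>e. R (xs @ [e 0]))"
      unfolding map_snoc using len map_nth[of xs] by simp
    from finite_not_interior[OF this]
    have "cocountable (\<lambda>x. \<not> (R (xs @ [x]) \<and> \<not> (\<exists>p q. p < x \<and> x < q \<and> (\<forall>y. p < y \<and> y < q \<longrightarrow> R (xs @ [y])))))"
      unfolding cocountable_def not_not by (rule countable_finite)
    then show "cocountable (\<lambda>x. R (xs @ [x]) \<longrightarrow>
      (\<exists>\<epsilon>>0. \<forall>ys. list_all2 (\<lambda>x y. \<bar>x - y\<bar> < \<epsilon>) (xs @ [x]) ys \<longrightarrow> R ys))"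
    proof (rule sigma_quant_mono[OF sigma_quant_cocountable], intro impI)
      fix x assume "\<not> (R (xs @ [x]) \<and> \<not> (\<exists>p q. p < x \<and> x < q \<and> (\<forall>y. p < y \<and> y < q \<longrightarrow> R (xs @ [y]))))"
        and "R (xs @ [x])"
      then obtain p q where pq: "p < x" "x < q" "\<And>y. p < y \<Longrightarrow> y < q \<Longrightarrow> R (xs @ [y])"
        by blast
      obtain p' where p': "p' \<in> \<rat>" "p < p'" "p' < x"
        using Rats_dense_in_real[OF pq(1)] by blast
      obtain q' where q': "q' \<in> \<rat>" "x < q'" "q' < q"
        using Rats_dense_in_real[OF pq(2)] by blast
      have "I p' q' xs"
        using pq(3) p'(2) q'(3) unfolding I_def by force
      then obtain \<epsilon> where \<epsilon>: "\<epsilon> > 0" "\<And>ys. list_all2 (\<lambda>x y. \<bar>x - y\<bar> < \<epsilon>) xs ys \<Longrightarrow> I p' q' ys"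
        using xs p'(1) q'(1) by blast
      \<comment> \<open>Within this radius the initial segment stays stable and the last entry stays
        inside the rational interval.\<close>
      define \<delta> where "\<delta> = min \<epsilon> (min (x - p') (q' - x))"
      have "R ys" if ys: "list_all2 (\<lambda>x y. \<bar>x - y\<bar> < \<delta>) (xs @ [x]) ys" for ys
      proof -
        obtain zs y where z: "ys = zs @ [y]" "list_all2 (\<lambda>x y. \<bar>x - y\<bar> < \<delta>) xs zs" "\<bar>x - y\<bar> < \<delta>"
          using ys by (auto simp: list_all2_append1 list_all2_Cons1)
        have "list_all2 (\<lambda>x y. \<bar>x - y\<bar> < \<epsilon>) xs zs"
          by (rule list_all2_mono[OF z(2)]) (simp add: \<delta>_def)
        moreover have "p' < y" "y < q'"
          using z(3) unfolding \<delta>_def by auto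
        ultimately show ?thesis
          using \<epsilon>(2) z(1) unfolding I_def by blast
      qed
      moreover have "\<delta> > 0"
        using \<epsilon>(1) p'(3) q'(2) by (simp add: \<delta>_def)
      ultimately show "\<exists>\<epsilon>>0. \<forall>ys. list_all2 (\<lambda>x y. \<bar>x - y\<bar> < \<epsilon>) (xs @ [x]) ys \<longrightarrow> R ys"
        by blast
    qed
  qed
qed

end

section \<open>Analyticity and growth\<close>

text \<open>Real analyticity in terms of local complex extensions, which makes composition and the identity
  theorem available.\<close>
definition locally_holomorphic :: "(real \<Rightarrow> real) \<Rightarrow> bool" where
  "locally_holomorphic g \<longleftrightarrow> (\<forall>x. \<exists>h. h analytic_on {complex_of_real x} \<and>
     (\<forall>\<^sub>F y in nhds x. h (of_real y) = of_real (g y)))"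

lemma locally_holomorphic_const: "locally_holomorphic (\<lambda>_. c)"
  unfolding locally_holomorphic_def by (intro allI exI[of _ "\<lambda>_. of_real c"]) simp

lemma locally_holomorphic_id: "locally_holomorphic (\<lambda>x. x)"
  unfolding locally_holomorphic_def by (intro allI exI[of _ "\<lambda>z. z"]) simp

lemma locally_holomorphic_add:
  assumes "locally_holomorphic f" "locally_holomorphic g"
  shows "locally_holomorphic (\<lambda>x. f x + g x)"
  unfolding locally_holomorphic_def
proof
  fix x
  obtain h k where hk: "h analytic_on {of_real x}" "\<forall>\<^sub>F y in nhds x. h (of_real y) = of_real (f y)"
    "k analytic_on {of_real x}" "\<forall>\<^sub>F y in nhds x. k (of_real y) = of_real (g y)"
    using assms unfolding locally_holomorphic_def by metis
  have "\<forall>\<^sub>F y in nhds x. h (of_real y) + k (of_real y) = of_real (f y + g y)"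
    using hk(2,4) by eventually_elim simp
  then show "\<exists>h. h analytic_on {of_real x} \<and> (\<forall>\<^sub>F y in nhds x. h (of_real y) = of_real (f y + g y))"
    using analytic_on_add[OF hk(1,3)] by blast
qed

lemma locally_holomorphic_mult:
  assumes "locally_holomorphic f" "locally_holomorphic g"
  shows "locally_holomorphic (\<lambda>x. f x * g x)"
  unfolding locally_holomorphic_def
proof
  fix x
  obtain h k where hk: "h analytic_on {of_real x}" "\<forall>\<^sub>F y in nhds x. h (of_real y) = of_real (f y)"
    "k analytic_on {of_real x}" "\<forall>\<^sub>F y in nhds x. k (of_real y) = of_real (g y)"
    using assms unfolding locally_holomorphic_def by metis
  have "\<forall>\<^sub>F y in nhds x. h (of_real y) * k (of_real y) = of_real (f y * g y)"
    using hk(2,4) by eventually_elim simp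
  then show "\<exists>h. h analytic_on {of_real x} \<and> (\<forall>\<^sub>F y in nhds x. h (of_real y) = of_real (f y * g y))"
    using analytic_on_mult[OF hk(1,3)] by blast
qed

lemma locally_holomorphic_isCont:
  assumes "locally_holomorphic g"
  shows "isCont g x"
proof -
  obtain h where h: "h analytic_on {complex_of_real x}"
    "\<forall>\<^sub>F y in nhds x. h (of_real y) = of_real (g y)"
    using assms unfolding locally_holomorphic_def by blast
  from h(2) have "\<forall>\<^sub>F y in nhds x. g y = Re (h (of_real y))"
    by eventually_elim simp
  moreover have "isCont (\<lambda>y. Re (h (of_real y))) x"
    using analytic_at_imp_isCont[OF h(1)] by (intro continuous_intros isCont_o2[where f = of_real]) auto
  ultimately show ?thesis
    using isCont_cong[of g "\<lambda>y. Re (h (of_real y))" x] by blast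
qed

lemma locally_holomorphic_compose:
  assumes "locally_holomorphic f" "locally_holomorphic g"
  shows "locally_holomorphic (\<lambda>x. f (g x))"
  unfolding locally_holomorphic_def
proof
  fix x
  obtain k where k: "k analytic_on {complex_of_real x}" "\<forall>\<^sub>F y in nhds x. k (of_real y) = of_real (g y)"
    using assms(2) unfolding locally_holomorphic_def by blast
  obtain h where h: "h analytic_on {complex_of_real (g x)}" "\<forall>\<^sub>F y in nhds (g x). h (of_real y) = of_real (f y)"
    using assms(1) unfolding locally_holomorphic_def by blast
  \<comment> \<open>Agreement near x includes x itself, so \<open>k\<close> maps the centre to the
    point where \<open>h\<close> is analytic.\<close>
  have "k (of_real x) = of_real (g x)"
    using k(2) by (rule eventually_nhds_x_imp_x)
  then have "(h \<circ> k) analytic_on {of_real x}"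
    using k(1) h(1) by (intro analytic_on_compose) simp_all
  moreover have "filterlim g (nhds (g x)) (nhds x)"
    using locally_holomorphic_isCont[OF assms(2), of x]
    by (simp add: isCont_def tendsto_at_iff_tendsto_nhds)
  from filterlim_iff[THEN iffD1, OF this, rule_format, OF h(2)] k(2)
  have "\<forall>\<^sub>F y in nhds x. (h \<circ> k) (of_real y) = of_real (f (g y))"
    by eventually_elim simp
  ultimately show "\<exists>h. h analytic_on {of_real x} \<and> (\<forall>\<^sub>F y in nhds x. h (of_real y) = of_real (f (g y)))"
    by blast
qed

lemma locally_holomorphic_power: "locally_holomorphic g \<Longrightarrow> locally_holomorphic (\<lambda>x. g x ^ n)"
  by (induction n) (simp_all add: locally_holomorphic_const locally_holomorphic_mult)

lemma locally_holomorphic_sum: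
  "finite I \<Longrightarrow> (\<And>i. i \<in> I \<Longrightarrow> locally_holomorphic (g i)) \<Longrightarrow> locally_holomorphic (\<lambda>x. \<Sum>i\<in>I. g i x)"
  by (induction I rule: finite_induct) (simp_all add: locally_holomorphic_const locally_holomorphic_add)

lemma locally_holomorphic_prod:
  "finite I \<Longrightarrow> (\<And>i. i \<in> I \<Longrightarrow> locally_holomorphic (g i)) \<Longrightarrow> locally_holomorphic (\<lambda>x. \<Prod>i\<in>I. g i x)"
  by (induction I rule: finite_induct) (simp_all add: locally_holomorphic_const locally_holomorphic_mult)

text \<open>A power series that converges on a real interval converges on the complex disc of the
  same radius: convergence at a real point at distance \<open>\<rho>\<close> from the centre forces
  convergence at all complex points closer to it.\<close>

lemma real_analytic_locally_holomorphic:
  assumes "real_analytic g"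
  shows "locally_holomorphic g"
  unfolding locally_holomorphic_def
proof
  fix x
  obtain r a where r: "r > 0" and a: "\<And>y. \<bar>y - x\<bar> < r \<Longrightarrow> (\<lambda>k. a k * (y - x) ^ k) sums g y"
    using assms unfolding real_analytic_def by blast
  let ?x = "complex_of_real x"
  define h where "h z = (\<Sum>k. of_real (a k) * (z - ?x) ^ k)" for z
  have sums: "(\<lambda>k. of_real (a k) * (z - ?x) ^ k) sums h z" if "z \<in> ball ?x r" for z
  proof -
    have "norm (z - ?x) < r"
      using that by (simp add: dist_norm norm_minus_commute)
    then obtain \<rho> where \<rho>: "norm (z - ?x) < \<rho>" "\<rho> < r"
      using dense by blast
    then have "0 < \<rho>"
      using norm_ge_zero[of "z - ?x"] by linarith
    then have "summable (\<lambda>k. a k * \<rho> ^ k)"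
      using a[of "x + \<rho>"] \<rho> by (auto simp: sums_iff)
    then have "summable (\<lambda>k. complex_of_real (a k * \<rho> ^ k))"
      by (simp only: summable_of_real_iff)
    then have "summable (\<lambda>k. complex_of_real (a k) * of_real \<rho> ^ k)"
      by simp
    then have "summable (\<lambda>k. of_real (a k) * (z - ?x) ^ k)"
      by (rule powser_inside) (use \<rho> \<open>0 < \<rho>\<close> in simp)
    then show ?thesis
      unfolding h_def by (rule summable_sums)
  qed
  have "h holomorphic_on ball ?x r"
    by (rule power_series_holomorphic) (rule sums)
  then have "h analytic_on {?x}"
    using r by (intro holomorphic_on_imp_analytic_at[of _ "ball ?x r"]) auto
  moreover have "\<forall>\<^sub>F y in nhds x. \<bar>y - x\<bar> < r"
    unfolding eventually_nhds_metric using r by (auto simp: dist_real_def)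
  then have "\<forall>\<^sub>F y in nhds x. h (of_real y) = of_real (g y)"
  proof eventually_elim
    case (elim y)
    have "(\<lambda>k. complex_of_real (a k * (y - x) ^ k)) sums of_real (g y)"
      using a[OF elim] by (simp only: sums_of_real_iff)
    moreover have "of_real y \<in> ball ?x r"
      using elim by (simp add: dist_norm abs_minus_commute flip: of_real_diff)
    from sums[OF this] have "(\<lambda>k. complex_of_real (a k * (y - x) ^ k)) sums h (of_real y)"
      by simp
    ultimately show ?case
      using sums_unique2 by blast
  qed
  ultimately show "\<exists>h. h analytic_on {?x} \<and> (\<forall>\<^sub>F y in nhds x. h (of_real y) = of_real (g y))"
    by blast
qed

text \<open>The dichotomy for the complex extension, either vanishing near the point or having no
  zeros in a punctured neighbourhood, restricts to the real line.\<close>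

lemma locally_holomorphic_isolated_zeros:
  assumes "locally_holomorphic g"
  shows "(\<forall>\<^sub>F y in nhds x. g y = 0) \<or> (\<forall>\<^sub>F y in at x. g y \<noteq> 0)"
proof -
  obtain h where h: "h analytic_on {complex_of_real x}"
    "\<forall>\<^sub>F y in nhds x. h (of_real y) = of_real (g y)"
    using assms unfolding locally_holomorphic_def by blast
  have lim: "filterlim complex_of_real (nhds (of_real x)) (nhds x)"
    using tendsto_at_iff_tendsto_nhds[of complex_of_real x] tendsto_of_real[OF tendsto_ident_at] by blast
  show ?thesis
  proof (cases "\<exists>\<^sub>F w in at (complex_of_real x). h w \<noteq> 0")
    case True
    then have "\<forall>\<^sub>F w in at (of_real x). h w \<noteq> 0"
      by (rule non_zero_neighbour[OF isolated_singularity_at_analytic[OF h(1)] not_essential_analytic[OF h(1)]])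
    then have "\<forall>\<^sub>F w in nhds (of_real x). w \<noteq> of_real x \<longrightarrow> h w \<noteq> 0"
      by (simp add: eventually_at_filter)
    from filterlim_iff[THEN iffD1, OF lim, rule_format, OF this] h(2)
    have "\<forall>\<^sub>F y in nhds x. y \<noteq> x \<longrightarrow> g y \<noteq> 0"
      by eventually_elim auto
    then show ?thesis
      by (simp add: eventually_at_filter)
  next
    case False
    then have ev: "\<forall>\<^sub>F w in at (of_real x). h w = 0"
      by (simp add: frequently_def)
    \<comment> \<open>Vanishing on a punctured neighbourhood extends to the centre by
      continuity.\<close>
    then have "(h \<longlongrightarrow> 0) (at (of_real x))"
      by (rule tendsto_eventually)
    moreover have "(h \<longlongrightarrow> h (of_real x)) (at (of_real x))"
      using analytic_at_imp_isCont[OF h(1)] by (simp add: isCont_def)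
    ultimately have "h (of_real x) = 0"
      using tendsto_unique trivial_limit_at by blast
    with ev have "\<forall>\<^sub>F w in nhds (of_real x). h w = 0"
      by (auto simp: eventually_at_filter elim!: eventually_mono)
    from filterlim_iff[THEN iffD1, OF lim, rule_format, OF this] h(2)
    have "\<forall>\<^sub>F y in nhds x. g y = 0"
      by eventually_elim simp
    then show ?thesis ..
  qed
qed

text \<open>The set of points near which \<open>g\<close> vanishes is open and closed and misses a,
  so it is empty. All zeros are then isolated, and a sparse set of reals is countable.\<close>

lemma locally_holomorphic_cocountable_nonzero:
  assumes g: "locally_holomorphic g" and "g a \<noteq> 0"
  shows "cocountable (\<lambda>x. g x \<noteq> 0)"
proof -
  define U where "U = {x. \<forall>\<^sub>F y in nhds x. g y = 0}"
  have "open U"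
    unfolding open_subopen[of U]
  proof
    fix x assume "x \<in> U"
    then obtain V where "open V" "x \<in> V" "\<forall>y\<in>V. g y = 0"
      unfolding U_def eventually_nhds by blast
    then show "\<exists>V. open V \<and> x \<in> V \<and> V \<subseteq> U"
      unfolding U_def eventually_nhds by blast
  qed
  moreover have "open (- U)"
    unfolding open_subopen[of "- U"]
  proof
    fix x assume "x \<in> - U"
    then have "\<forall>\<^sub>F y in at x. g y \<noteq> 0"
      using locally_holomorphic_isolated_zeros[OF g, of x] by (auto simp: U_def)
    then obtain V where V: "open V" "x \<in> V" "\<forall>y\<in>V. y \<noteq> x \<longrightarrow> g y \<noteq> 0"
      unfolding eventually_at_topological by blast
    have "V \<subseteq> - U"
    proof
      fix y assume "y \<in> V"
      show "y \<in> - U"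
      proof (cases "y = x")
        case False
        with V \<open>y \<in> V\<close> have "g y \<noteq> 0" by blast
        then show ?thesis
          unfolding U_def using eventually_nhds_x_imp_x by blast
      qed (use \<open>x \<in> - U\<close> in simp)
    qed
    with V show "\<exists>V. open V \<and> x \<in> V \<and> V \<subseteq> - U" by blast
  qed
  ultimately have "U = {} \<or> U = UNIV"
    using clopen[of U] by (simp add: closed_def)
  moreover have "a \<notin> U"
    using assms(2) unfolding U_def using eventually_nhds_x_imp_x by blast
  ultimately have "U = {}" by blast
  then have "\<forall>\<^sub>F y in at x. g y \<noteq> 0" for x
    using locally_holomorphic_isolated_zeros[OF g, of x] by (auto simp: U_def)
  then have "{x. g x = 0} sparse_in UNIV"
    by (simp add: sparse_in_eventually_iff)
  from sparse_imp_countable[OF open_UNIV this] show ?thesis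
    by (simp add: cocountable_def)
qed

text \<open>Analyticity in each variable separately is all that the identity theorem needs here.\<close>
lemma separately_analytic_generic_nonzero:
  assumes "\<And>xs ys. Suc (length xs + length ys) = n \<Longrightarrow> locally_holomorphic (\<lambda>t. G (xs @ t # ys))"
    and "length zs = n" "G zs \<noteq> 0"
  shows "iter_quant cocountable n (\<lambda>xs. G xs \<noteq> 0)"
  using assms
proof (induction n arbitrary: G zs)
  case 0
  then show ?case by simp
next
  case (Suc n)
  then obtain a ys where zs: "zs = a # ys" "length ys = n"
    by (cases zs) auto
  \<comment> \<open>Only the first coordinate of the witness is varied. For generic x the unchanged
    tail \<open>ys\<close> witnesses nonvanishing in the remaining variables.\<close>
  have "cocountable (\<lambda>x. G (x # ys) \<noteq> 0)"
    using Suc.prems(1)[of "[]" ys] Suc.prems(3) zs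
    by (intro locally_holomorphic_cocountable_nonzero[of _ a]) auto
  then show ?case
    unfolding iter_quant.simps
  proof (rule sigma_quant_mono[OF sigma_quant_cocountable])
    fix x assume "G (x # ys) \<noteq> 0"
    show "iter_quant cocountable n (\<lambda>xs. G (x # xs) \<noteq> 0)"
    proof (rule Suc.IH)
      show "locally_holomorphic (\<lambda>t. G (x # us @ t # vs))" if "Suc (length us + length vs) = n" for us vs
        using Suc.prems(1)[of "x # us" vs] that by simp
    qed (use \<open>G (x # ys) \<noteq> 0\<close> zs in auto)
  qed
qed

text \<open>The lowest digit is the residue modulo \<open>B\<close>; cancelling it leaves the same
  equation for the shifted digits.\<close>

lemma base_expansion_inj:
  fixes \<alpha> \<beta> :: "nat \<Rightarrow> nat"
  assumes "\<And>i. i < n \<Longrightarrow> \<alpha> i < B" "\<And>i. i < n \<Longrightarrow> \<beta> i < B"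
    and "(\<Sum>i<n. \<alpha> i * B ^ i) = (\<Sum>i<n. \<beta> i * B ^ i)" and "i < n"
  shows "\<alpha> i = \<beta> i"
  using assms
proof (induction n arbitrary: \<alpha> \<beta> i)
  case (Suc n)
  have shift: "(\<Sum>i<Suc n. \<gamma> i * B ^ i) = \<gamma> 0 + B * (\<Sum>i<n. \<gamma> (Suc i) * B ^ i)" for \<gamma>
    by (simp only: sum.lessThan_Suc_shift) (simp add: sum_distrib_left mult_ac)
  note eq = Suc.prems(3)[unfolded shift]
  have lt: "\<alpha> 0 < B" "\<beta> 0 < B"
    using Suc.prems(1,2) by auto
  have "\<alpha> 0 = \<beta> 0"
    using arg_cong[OF eq, of "\<lambda>m. m mod B"] lt by simp
  moreover from this have "(\<Sum>i<n. \<alpha> (Suc i) * B ^ i) = (\<Sum>i<n. \<beta> (Suc i) * B ^ i)"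
    using eq lt by auto
  then have "\<alpha> (Suc i) = \<beta> (Suc i)" if "i < n" for i
    using Suc.IH[of "\<lambda>i. \<alpha> (Suc i)" "\<lambda>i. \<beta> (Suc i)" i] Suc.prems(1,2) that by simp
  ultimately show ?case
    using Suc.prems(4) by (cases i) auto
qed simp

text \<open>Kronecker substitution with a base exceeding all exponents turns distinct monomials into
  distinct powers of one variable.\<close>
lemma mpoly_eval_nonzero:
  assumes c: "mpoly_coeffs n c" and "c \<alpha> \<noteq> 0"
  shows "\<exists>v. mpoly_eval n c v \<noteq> 0"
proof -
  let ?A = "{\<alpha>. c \<alpha> \<noteq> 0}"
  have fin: "finite ?A"
    using c by (simp add: mpoly_coeffs_def)
  define B where "B = Suc (Max (\<Union>\<alpha>\<in>?A. \<alpha> ` {..<n} \<union> {0}))"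
  have B: "\<alpha> i < B" if "\<alpha> \<in> ?A" "i < n" for \<alpha> i
    unfolding B_def using fin that by (intro le_imp_less_Suc Max_ge) auto
  define code where "code \<alpha> = (\<Sum>i<n. \<alpha> i * B ^ i)" for \<alpha> :: "nat \<Rightarrow> nat"
  have inj: "\<alpha> = \<beta>" if "\<alpha> \<in> ?A" "\<beta> \<in> ?A" "code \<alpha> = code \<beta>" for \<alpha> \<beta>
  proof
    fix i
    show "\<alpha> i = \<beta> i"
    proof (cases "i < n")
      case True
      then show ?thesis
        by (intro base_expansion_inj[of n \<alpha> B \<beta>] B that that(3)[unfolded code_def])
    next
      case False
      then have "n \<le> i" by simp
      then have "\<alpha> i = 0" "\<beta> i = 0"
        using c that(1,2) unfolding mpoly_coeffs_def by blast+
      then show ?thesis by simp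
    qed
  qed
  define p where "p = (\<Sum>\<alpha>\<in>?A. monom (c \<alpha>) (code \<alpha>))"
  have eval: "poly p y = mpoly_eval n c (\<lambda>i. y ^ (B ^ i))" for y
    unfolding p_def mpoly_eval_def poly_sum
    by (rule sum.cong) (auto simp: poly_monom code_def power_sum power_mult[symmetric] mult.commute)
  \<comment> \<open>By injectivity of the code no other monomial contributes to this power.\<close>
  have "coeff p (code \<alpha>) = (\<Sum>\<beta>\<in>?A. if \<beta> = \<alpha> then c \<beta> else 0)"
    unfolding p_def coeff_sum by (rule sum.cong) (use inj[of _ \<alpha>] assms(2) in auto)
  also have "\<dots> = c \<alpha>"
    using fin assms(2) by (simp add: sum.delta)
  finally have "p \<noteq> 0"
    using assms(2) by auto
  then show ?thesis
    using poly_all_0_iff_0[of p] eval by metis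
qed

section \<open>Linear growth along rays\<close>

definition linear_growth :: "(real \<Rightarrow> real) \<Rightarrow> bool" where
  "linear_growth g \<longleftrightarrow> (\<exists>K. \<forall>t\<ge>1. \<bar>g t\<bar> \<le> K * t)"

lemma linear_growth_add:
  assumes "linear_growth f" "linear_growth g"
  shows "linear_growth (\<lambda>t. f t + g t)"
proof -
  obtain K L where "\<And>t. t \<ge> 1 \<Longrightarrow> \<bar>f t\<bar> \<le> K * t" "\<And>t. t \<ge> 1 \<Longrightarrow> \<bar>g t\<bar> \<le> L * t"
    using assms unfolding linear_growth_def by blast
  then have "\<bar>f t + g t\<bar> \<le> (K + L) * t" if "t \<ge> 1" for t
    using that by (smt (verit) distrib_right)
  then show ?thesis
    unfolding linear_growth_def by blast
qed

lemma linear_growth_cmult: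
  assumes "linear_growth g"
  shows "linear_growth (\<lambda>t. c * g t)"
proof -
  obtain K where "\<And>t. t \<ge> 1 \<Longrightarrow> \<bar>g t\<bar> \<le> K * t"
    using assms unfolding linear_growth_def by blast
  then have "\<bar>c * g t\<bar> \<le> (\<bar>c\<bar> * K) * t" if "t \<ge> 1" for t
    using that mult_left_mono[of "\<bar>g t\<bar>" "K * t" "\<bar>c\<bar>"] by (simp add: abs_mult mult.assoc)
  then show ?thesis
    unfolding linear_growth_def by blast
qed

text \<open>Growth is measured from t = 1 on, where a constant is bounded by a multiple of t; this
  is why biases do no harm.\<close>

lemma linear_growth_const: "linear_growth (\<lambda>_. c)"
  unfolding linear_growth_def
proof (intro exI allI impI)
  fix t :: real assume "1 \<le> t"
  then show "\<bar>c\<bar> \<le> \<bar>c\<bar> * t"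
    using mult_left_mono[of 1 t "\<bar>c\<bar>"] by simp
qed

lemma linear_growth_compose:
  assumes \<psi>: "\<And>y. \<bar>\<psi> y\<bar> \<le> K * (1 + \<bar>y\<bar>)" and "linear_growth g"
  shows "linear_growth (\<lambda>t. \<psi> (g t))"
proof -
  obtain L where L: "\<And>t. t \<ge> 1 \<Longrightarrow> \<bar>g t\<bar> \<le> L * t"
    using assms unfolding linear_growth_def by blast
  have "0 \<le> K"
    using \<psi>[of 0] by simp
  have "\<bar>\<psi> (g t)\<bar> \<le> K * (1 + L) * t" if "t \<ge> 1" for t
  proof -
    have "1 + \<bar>g t\<bar> \<le> (1 + L) * t"
      using L[OF that] that by (simp add: distrib_right)
    then show ?thesis
      using mult_left_mono[OF _ \<open>0 \<le> K\<close>] \<psi>[of "g t"] by (fastforce simp: mult.assoc)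
  qed
  then show ?thesis
    unfolding linear_growth_def by blast
qed

text \<open>Sublinearity along the directions 1 and -1 controls large arguments of either sign;
  continuity on the compact interval in between supplies the additive constant.\<close>

lemma sublinear_bound:
  assumes "sublinear \<psi>" and cont: "\<And>y. isCont \<psi> y"
  shows "\<exists>K. \<forall>y. \<bar>\<psi> y\<bar> \<le> K * (1 + \<bar>y\<bar>)"
proof -
  have ray: "\<exists>C T. \<forall>t\<ge>T. \<bar>\<psi> (t * x)\<bar> \<le> C * t" for x
  proof -
    have "Limsup at_top (\<lambda>t. ereal (\<bar>\<psi> (t * x)\<bar> / t)) \<noteq> \<infinity>"
      using assms(1) unfolding sublinear_def by (metis less_irrefl)
    then obtain n :: nat where "Limsup at_top (\<lambda>t. ereal (\<bar>\<psi> (t * x)\<bar> / t)) < ereal (real n)"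
      using less_PInf_Ex_of_nat by blast
    from Limsup_lessD[OF this] eventually_gt_at_top[of 0]
    have "\<forall>\<^sub>F t in at_top. \<bar>\<psi> (t * x)\<bar> \<le> real n * t"
      by eventually_elim (simp add: divide_less_eq)
    then show ?thesis
      unfolding eventually_at_top_linorder by blast
  qed
  obtain C1 T1 where 1: "\<And>t. t \<ge> T1 \<Longrightarrow> \<bar>\<psi> (t * 1)\<bar> \<le> C1 * t"
    using ray by blast
  obtain C2 T2 where 2: "\<And>t. t \<ge> T2 \<Longrightarrow> \<bar>\<psi> (t * - 1)\<bar> \<le> C2 * t"
    using ray by blast
  define T where "T = max \<bar>T1\<bar> \<bar>T2\<bar>"
  have "bounded (\<psi> ` {-T..T})"
    by (intro compact_imp_bounded compact_continuous_image continuous_at_imp_continuous_on ballI cont compact_Icc)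
  then obtain M where M: "\<forall>y\<in>{-T..T}. \<bar>\<psi> y\<bar> \<le> M"
    unfolding bounded_iff by auto
  define K where "K = max M (max \<bar>C1\<bar> \<bar>C2\<bar>)"
  have T0: "0 \<le> T" "T1 \<le> T" "T2 \<le> T"
    by (auto simp: T_def)
  have "0 \<le> K"
    by (auto simp: K_def)
  have "\<bar>\<psi> y\<bar> \<le> K * (1 + \<bar>y\<bar>)" for y
  proof -
    have mono: "C * \<bar>y\<bar> \<le> K * (1 + \<bar>y\<bar>)" if "C \<le> K" for C
      using that \<open>0 \<le> K\<close> by (intro mult_mono) auto
    consider "y \<in> {-T..T}" | "y > T" | "- y > T"
      by force
    then show ?thesis
    proof cases
      case 1
      have "M \<le> K * 1"
        by (simp add: K_def)
      also have "\<dots> \<le> K * (1 + \<bar>y\<bar>)"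
        using \<open>0 \<le> K\<close> by (intro mult_left_mono) auto
      finally show ?thesis
        using bspec[OF M 1] by simp
    next
      case 2
      then have "\<bar>\<psi> y\<bar> \<le> C1 * \<bar>y\<bar>"
        using "1"[of y] T0 by simp
      also have "\<dots> \<le> K * (1 + \<bar>y\<bar>)"
        by (rule mono) (auto simp: K_def)
      finally show ?thesis .
    next
      case 3
      then have "\<bar>\<psi> y\<bar> \<le> C2 * \<bar>y\<bar>"
        using "2"[of "- y"] T0 by simp
      also have "\<dots> \<le> K * (1 + \<bar>y\<bar>)"
        by (rule mono) (auto simp: K_def)
      finally show ?thesis .
    qed
  qed
  then show ?thesis by blast
qed

text \<open>Splitting off the constant term leaves t times a nonconstant polynomial. Linear growth
  would keep that factor bounded for t at least 1, but it tends to infinity.\<close>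

lemma poly_not_linear_growth:
  assumes "degree p \<ge> 2"
  shows "\<not> linear_growth (poly p)"
proof
  assume "linear_growth (poly p)"
  then obtain K where K: "\<And>t. t \<ge> 1 \<Longrightarrow> \<bar>poly p t\<bar> \<le> K * t"
    unfolding linear_growth_def by blast
  obtain a r where p: "p = pCons a r" by (cases p)
  obtain b q where r: "r = pCons b q" by (cases r)
  have "q \<noteq> 0"
    using assms unfolding p r by (auto split: if_splits)
  then obtain T where T: "\<And>z. T \<le> norm z \<Longrightarrow> K + \<bar>a\<bar> + 1 \<le> norm (poly r z)"
    using poly_infinity[of q] unfolding r by blast
  define t where "t = max 1 T"
  have t: "1 \<le> t" "T \<le> norm t"
    by (auto simp: t_def)
  have "t * norm (poly r t) = \<bar>poly p t - a\<bar>"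
    using t(1) by (simp add: p abs_mult)
  also have "\<dots> \<le> K * t + \<bar>a\<bar>"
    using K[OF t(1)] by linarith
  also have "\<dots> \<le> t * (K + \<bar>a\<bar>)"
    using t(1) mult_right_mono[of 1 t "\<bar>a\<bar>"] by (simp add: algebra_simps)
  finally have "norm (poly r t) \<le> K + \<bar>a\<bar>"
    using t(1) by simp
  with T[OF t(2)] show False by simp
qed

text \<open>On the ray through v the coefficient of the K-th power of t is the homogeneous part of
  degree K at v. With K the degree of the given monomial this part is a nonzero polynomial, so some
  v makes the coefficient nonzero. K need not be the total degree, as only a lower bound on the
  degree in t is used.\<close>

lemma mpoly_eval_not_linear_growth:
  assumes c: "mpoly_coeffs n c" and "c \<alpha> \<noteq> 0" and "(\<Sum>i<n. \<alpha> i) \<ge> 2"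
  shows "\<exists>v. \<not> linear_growth (\<lambda>t. mpoly_eval n c (\<lambda>i. t * v i))"
proof -
  define K where "K = (\<Sum>i<n. \<alpha> i)"
  define c' where "c' \<beta> = (if (\<Sum>i<n. \<beta> i) = K then c \<beta> else 0)" for \<beta>
  have fin: "finite {\<beta>. c \<beta> \<noteq> 0}"
    using c by (simp add: mpoly_coeffs_def)
  have sub: "{\<beta>. c' \<beta> \<noteq> 0} \<subseteq> {\<beta>. c \<beta> \<noteq> 0}"
    by (auto simp: c'_def)
  have "mpoly_coeffs n c'"
    using c finite_subset[OF sub fin] unfolding mpoly_coeffs_def c'_def by auto
  moreover have "c' \<alpha> \<noteq> 0"
    using assms(2) by (simp add: c'_def K_def)
  ultimately obtain v where v: "mpoly_eval n c' v \<noteq> 0"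
    using mpoly_eval_nonzero by blast
  define p where "p = (\<Sum>\<beta> | c \<beta> \<noteq> 0. monom (c \<beta> * (\<Prod>i<n. v i ^ \<beta> i)) (\<Sum>i<n. \<beta> i))"
  have eval: "poly p t = mpoly_eval n c (\<lambda>i. t * v i)" for t
    unfolding p_def mpoly_eval_def poly_sum
    by (rule sum.cong) (auto simp: poly_monom power_mult_distrib prod.distrib power_sum)
  have "coeff p K = (\<Sum>\<beta> | c \<beta> \<noteq> 0. c' \<beta> * (\<Prod>i<n. v i ^ \<beta> i))"
    unfolding p_def coeff_sum by (rule sum.cong) (auto simp: c'_def)
  also have "\<dots> = mpoly_eval n c' v"
    unfolding mpoly_eval_def by (rule sum.mono_neutral_right) (use sub fin in auto)
  finally have "K \<le> degree p"
    using v by (intro le_degree) simp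
  then have "\<not> linear_growth (poly p)"
    using assms(3) by (intro poly_not_linear_growth) (simp add: K_def)
  then show ?thesis
    unfolding eval[abs_def] by blast
qed

section \<open>Properties inherited by network responses\<close>

lemma nn_response_layers:
  "nn_response \<psi> [d0, d1] [w] x = affine_layer d0 d1 (fst w) (snd w) x"
  "nn_response \<psi> (d0 # d1 # d2 # ds) (w # \<theta>) x =
     nn_response \<psi> (d1 # d2 # ds) \<theta> (\<lambda>j\<in>{..<d1}. \<psi> (affine_layer d0 d1 (fst w) (snd w) x j))"
  by (cases w; simp)+

text \<open>One induction over the layers serves for local holomorphy, linear growth, definability
  and measurability. Weights form a class \<open>W\<close> of their own because linear growth is not
  closed under products: there \<open>W\<close> consists of constants, while for definability the
  weights vary and \<open>W\<close> consists of definable terms.\<close>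

lemma nn_response_closure:
  assumes add: "\<And>g h. C g \<Longrightarrow> C h \<Longrightarrow> C (\<lambda>p. g p + h p)"
    and mult: "\<And>w g. W w \<Longrightarrow> C g \<Longrightarrow> C (\<lambda>p. w p * g p)"
    and weight: "\<And>w. W w \<Longrightarrow> C w"
    and const: "\<And>r. C (\<lambda>_. r)"
    and act: "\<And>g. C g \<Longrightarrow> C (\<lambda>p. \<psi> (g p))"
    and weights: "\<And>w. w \<in> set \<theta> \<Longrightarrow> (\<forall>j i. W (\<lambda>p. fst (w p) j i)) \<and> (\<forall>j. W (\<lambda>p. snd (w p) j))"
    and input: "\<And>i. C (\<lambda>p. x p i)"
  shows "C (\<lambda>p. nn_response \<psi> ds (map (\<lambda>w. w p) \<theta>) (x p) j)"
  using weights input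
proof (induction \<theta> arbitrary: ds x j)
  case Nil
  \<comment> \<open>Without layers every shape falls under the default clause, where the response is
    the input.\<close>
  consider "ds = []" | d where "ds = [d]" | d0 d1 where "ds = [d0, d1]"
    | d0 d1 d2 ds' where "ds = d0 # d1 # d2 # ds'"
    by (metis neq_Nil_conv)
  then show ?case
    by cases (use Nil in simp_all)
next
  case (Cons w \<theta>)
  have sum: "C (\<lambda>p. \<Sum>l<d0. g l p)" if "\<And>l. C (g l)" for d0 :: nat and g
    by (induction d0) (auto intro: add const that)
  have affine: "C (\<lambda>p. affine_layer d0 d1 (fst (w p)) (snd (w p)) (x p) j)" for d0 d1 j
  proof (cases "j < d1")
    case True
    have "C (\<lambda>p. (\<Sum>l<d0. fst (w p) j l * x p l) + snd (w p) j)"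
      by (intro add sum mult weight Cons.prems(2)) (use Cons.prems(1) in auto)
    with True show ?thesis
      by (simp add: affine_layer_def)
  next
    case False
    then show ?thesis
      by (simp add: affine_layer_def const)
  qed
  consider "ds = []" | d where "ds = [d]" | d0 d1 where "ds = [d0, d1]" "\<theta> = []"
    | d0 d1 w' \<theta>' where "ds = [d0, d1]" "\<theta> = w' # \<theta>'"
    | d0 d1 d2 ds' where "ds = d0 # d1 # d2 # ds'"
    by (metis neq_Nil_conv)
  then show ?case
  proof cases
    case 3
    then show ?thesis
      using affine by (simp add: nn_response_layers)
  next
    case (5 d0 d1 d2 ds')
    \<comment> \<open>The activations of this layer are the input of the remaining network; outside
      the index range they are constant, so they belong to \<open>C\<close> as well.\<close>
    define x' where "x' p = (\<lambda>j\<in>{..<d1}. \<psi> (affine_layer d0 d1 (fst (w p)) (snd (w p)) (x p) j))" for p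
    have "C (\<lambda>p. x' p i)" for i
      by (cases "i < d1") (simp_all add: x'_def act affine const)
    with Cons.IH[of x' "d1 # d2 # ds'" j] Cons.prems(1)
    have "C (\<lambda>p. nn_response \<psi> (d1 # d2 # ds') (map (\<lambda>w. w p) \<theta>) (x' p) j)"
      by simp
    then show ?thesis
      unfolding x'_def 5 list.map nn_response_layers .
  qed (use Cons.prems(2) in simp_all)
qed

section \<open>From generic points to measure and category\<close>

abbreviation list_vec :: "('a \<Rightarrow> 'b) \<Rightarrow> nat \<Rightarrow> 'a list \<Rightarrow> nat \<Rightarrow> 'b" where
  "list_vec r n xs \<equiv> (\<lambda>i\<in>{..<n}. r (xs ! i))"

text \<open>Tonelli, integrating out the last coordinate: the inner integral vanishes for generic
  initial segments. It is stated for functions, not sets, because this inner integral is the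
  function for the induction. \<open>M\<close> and \<open>r\<close> are kept general for two uses,
  with numbers as list entries and with vectors.\<close>

lemma nn_integral_PiM_iter_quant_null:
  fixes f :: "(nat \<Rightarrow> 'b) \<Rightarrow> ennreal" and r :: "'a \<Rightarrow> 'b"
  assumes M: "sigma_finite_measure M" and Q: "sigma_quant Q" and r: "\<And>x. r x \<in> space M"
    and null: "\<And>g. g \<in> borel_measurable M \<Longrightarrow> Q (\<lambda>x. g (r x) = 0) \<Longrightarrow> (\<integral>\<^sup>+ x. g x \<partial>M) = (0 :: ennreal)"
    and "f \<in> borel_measurable (PiM {..<n} (\<lambda>_. M))"
    and "iter_quant Q n (\<lambda>xs. f (list_vec r n xs) = 0)"
  shows "(\<integral>\<^sup>+ x. f x \<partial>PiM {..<n} (\<lambda>_. M)) = 0"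
  using assms(5,6)
proof (induction n arbitrary: f)
  case 0
  interpret product_sigma_finite "\<lambda>_. M"
    using M by (simp add: product_sigma_finite_def)
  show ?case
    using 0 by (simp add: PiM_empty nn_integral_count_space_finite restrict_def)
next
  case (Suc n)
  interpret product_sigma_finite "\<lambda>_. M"
    using M by (simp add: product_sigma_finite_def)
  interpret M: sigma_finite_measure M by (rule M)
  have f: "f \<in> borel_measurable (PiM (insert n {..<n}) (\<lambda>_. M))"
    using Suc.prems(1) by (simp add: lessThan_Suc)
  define g where "g x = (\<integral>\<^sup>+ y. f (x(n := y)) \<partial>M)" for x
  have "(\<lambda>(x, y). f (x(n := y))) \<in> borel_measurable (PiM {..<n} (\<lambda>_. M) \<Otimes>\<^sub>M M)"
    using measurable_comp[OF measurable_add_dim f] by (simp add: comp_def split_def)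
  from M.borel_measurable_nn_integral[OF this]
  have g: "g \<in> borel_measurable (PiM {..<n} (\<lambda>_. M))"
    unfolding g_def[abs_def] by simp
  have vec: "list_vec r n xs \<in> space (PiM {..<n} (\<lambda>_. M))" for xs
    by (auto simp: space_PiM r)
  have "iter_quant Q n (\<lambda>xs. g (list_vec r n xs) = 0)"
  proof (rule iter_quant_mono[OF Q Suc.prems(2)[unfolded iter_quant_Suc_right]])
    fix xs :: "'a list"
    assume len: "length xs = n" and *: "Q (\<lambda>x. f (list_vec r (Suc n) (xs @ [x])) = 0)"
    have "list_vec r (Suc n) (xs @ [x]) = (list_vec r n xs)(n := r x)" for x
      using len by (auto simp: fun_eq_iff restrict_def nth_append)
    with * have "Q (\<lambda>x. f ((list_vec r n xs)(n := r x)) = 0)"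
      by simp
    moreover have "(\<lambda>y. f ((list_vec r n xs)(n := y))) \<in> borel_measurable M"
      using measurable_comp[OF measurable_component_update[OF vec] f] by (simp add: comp_def)
    ultimately show "g (list_vec r n xs) = 0"
      unfolding g_def by (intro null)
  qed
  from Suc.IH[OF g this] show ?case
    using product_nn_integral_insert[OF _ _ f] by (simp add: lessThan_Suc g_def)
qed

text \<open>A nonempty open set contains a nonempty open box, and a generic entry is picked in each
  factor in turn.\<close>

lemma iter_quant_dense:
  assumes Q: "sigma_quant Q"
    and dense: "\<And>U P. openin T U \<Longrightarrow> U \<noteq> {} \<Longrightarrow> Q P \<Longrightarrow> \<exists>x. P x \<and> r x \<in> U"
    and U: "openin (product_topology (\<lambda>_. T) {..<n}) U" "U \<noteq> {}" and P: "iter_quant Q n P"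
  shows "\<exists>xs. P xs \<and> list_vec r n xs \<in> U"
proof -
  have box: "\<exists>xs. P xs \<and> (\<forall>i<n. r (xs ! i) \<in> V i)"
    if "iter_quant Q n P" "\<And>i. i < n \<Longrightarrow> openin T (V i) \<and> V i \<noteq> {}" for n P and V :: "nat \<Rightarrow> _"
    using that
  proof (induction n arbitrary: P V)
    case 0
    then show ?case by auto
  next
    case (Suc n)
    obtain x where x: "iter_quant Q n (\<lambda>xs. P (x # xs))" "r x \<in> V 0"
      using dense[of "V 0"] Suc.prems by auto
    obtain xs where "P (x # xs)" "\<forall>i<n. r (xs ! i) \<in> V (Suc i)"
      using Suc.IH[OF x(1), of "\<lambda>i. V (Suc i)"] Suc.prems(2) by auto
    with x(2) show ?case
      by (intro exI[of _ "x # xs"]) (auto simp: nth_Cons split: nat.split)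
  qed
  obtain y where "y \<in> U"
    using U(2) by blast
  then obtain V where V: "\<forall>i\<in>{..<n}. openin T (V i)" "y \<in> Pi\<^sub>E {..<n} V" "Pi\<^sub>E {..<n} V \<subseteq> U"
    using U(1) unfolding openin_product_topology_alt by blast
  have "openin T (V i) \<and> V i \<noteq> {}" if "i < n" for i
    using V(1,2) that by auto
  with box[OF P, of V] obtain xs where "P xs" "\<forall>i<n. r (xs ! i) \<in> V i"
    by blast
  then have "list_vec r n xs \<in> Pi\<^sub>E {..<n} V"
    by auto
  with V(3) \<open>P xs\<close> show ?thesis by blast
qed

lemma nn_integral_lborel_cocountable_null:
  fixes f :: "real \<Rightarrow> ennreal"
  assumes "f \<in> borel_measurable lborel" "cocountable (\<lambda>x. f x = 0)"
  shows "(\<integral>\<^sup>+ x. f x \<partial>lborel) = 0"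
proof -
  have "{x. f x \<noteq> 0} \<in> null_sets lborel"
    using assms(2) countable_imp_null_set_lborel by (simp add: cocountable_def)
  then have "AE x in lborel. f x = 0"
    by (rule AE_I') auto
  then show ?thesis
    using assms(1) by (simp add: nn_integral_0_iff_AE)
qed

lemma cocountable_dense:
  fixes U :: "real set"
  assumes "open U" "U \<noteq> {}" "cocountable P"
  shows "\<exists>x. P x \<and> x \<in> U"
proof -
  obtain x e where "e > 0" "ball x e \<subseteq> U"
    using assms(1,2) by (metis ex_in_conv openE)
  then have "uncountable {x - e<..<x + e}" "{x - e<..<x + e} \<subseteq> U"
    by (auto simp: uncountable_open_interval ball_eq_greaterThanLessThan)
  then have "\<not> U \<subseteq> {x. \<not> P x}"
    using assms(3) unfolding cocountable_def by (metis countable_subset)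
  then show ?thesis by blast
qed

section \<open>Generic vectors and tuples of vectors\<close>

abbreviation generic_vec :: "nat \<Rightarrow> (real list \<Rightarrow> bool) \<Rightarrow> bool" where
  "generic_vec d \<equiv> iter_quant cocountable d"

abbreviation vec :: "nat \<Rightarrow> real list \<Rightarrow> nat \<Rightarrow> real" where
  "vec d \<equiv> list_vec (\<lambda>x. x) d"

lemma sigma_finite_lborel_n: "sigma_finite_measure (lborel_n d)"
proof -
  interpret product_sigma_finite "\<lambda>_ :: nat. lborel :: real measure"
    by (simp add: product_sigma_finite_def lborel.sigma_finite_measure_axioms)
  show ?thesis
    by (rule sigma_finite) simp
qed

lemma nn_integral_lborel_n_generic_null:
  assumes "f \<in> borel_measurable (lborel_n d)" "generic_vec d (\<lambda>xs. f (vec d xs) = 0)"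
  shows "(\<integral>\<^sup>+ x. f x \<partial>lborel_n d) = 0"
  by (rule nn_integral_PiM_iter_quant_null[OF lborel.sigma_finite_measure_axioms sigma_quant_cocountable _
      nn_integral_lborel_cocountable_null assms]) simp_all

lemma AE_tuples_generic:
  assumes D: "D \<in> sets (PiM {..<N} (\<lambda>_. lborel_n d))"
    and gen: "iter_quant (generic_vec d) N (\<lambda>zs. list_vec (vec d) N zs \<in> D)"
  shows "AE z in PiM {..<N} (\<lambda>_. lborel_n d). z \<in> D"
proof -
  let ?M = "PiM {..<N} (\<lambda>_. lborel_n d)"
  have f: "indicator (space ?M - D) \<in> borel_measurable ?M"
    using D by (intro borel_measurable_indicator) auto
  have "iter_quant (generic_vec d) N
      (\<lambda>zs. indicator (space ?M - D) (list_vec (vec d) N zs) = (0 :: ennreal))"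
    by (rule iter_quant_mono[OF sigma_quant_iter[OF sigma_quant_cocountable] gen]) simp
  then have "(\<integral>\<^sup>+ z. indicator (space ?M - D) z \<partial>?M) = 0"
  proof (rule nn_integral_PiM_iter_quant_null[where r = "vec d" and Q = "generic_vec d" and M = "lborel_n d",
        OF sigma_finite_lborel_n sigma_quant_iter[OF sigma_quant_cocountable] _ _ f, rotated -1])
    show "vec d x \<in> space (lborel_n d)" for x
      by (simp add: space_PiM PiE_iff)
  qed (rule nn_integral_lborel_n_generic_null)
  then have "emeasure ?M (space ?M - D) = 0"
    using D by (simp add: nn_integral_indicator)
  then show ?thesis
    using D by (intro AE_I[of _ _ "space ?M - D"]) auto
qed

lemma generic_vec_dense:
  assumes "openin (top_n d) U" "U \<noteq> {}" "generic_vec d P"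
  shows "\<exists>xs. P xs \<and> vec d xs \<in> U"
  by (rule iter_quant_dense[OF sigma_quant_cocountable _ assms]) (auto intro: cocountable_dense)

lemma closure_tuples_generic:
  assumes gen: "iter_quant (generic_vec d) N (\<lambda>zs. list_vec (vec d) N zs \<in> D)"
  shows "(product_topology (\<lambda>_. top_n d) {..<N}) closure_of D
    = topspace (product_topology (\<lambda>_. top_n d) {..<N})"
  unfolding dense_intersects_open
proof (intro allI impI, elim conjE)
  fix U assume U: "openin (product_topology (\<lambda>_. top_n d) {..<N}) U" "U \<noteq> {}"
  have "\<exists>zs. list_vec (vec d) N zs \<in> D \<and> list_vec (vec d) N zs \<in> U"
    by (rule iter_quant_dense[OF sigma_quant_iter[OF sigma_quant_cocountable] _ U gen])
      (rule generic_vec_dense)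
  then show "D \<inter> U \<noteq> {}" by blast
qed

definition grid_cell :: "nat \<Rightarrow> nat \<Rightarrow> nat \<Rightarrow> (nat \<Rightarrow> nat \<Rightarrow> int) \<Rightarrow> (nat \<Rightarrow> nat \<Rightarrow> real) set" where
  "grid_cell N d k m =
     PiE {..<N} (\<lambda>i. PiE {..<d} (\<lambda>j. {(m i j - 1) / real (Suc k) <..< (m i j + 1) / real (Suc k)}))"

text \<open>The exterior of \<open>B\<close> as a union of open cubes of side
  \<open>2 / real (Suc k)\<close> centred at lattice points. The lattice functions \<open>m\<close>
  are extensional, so there are countably many cubes; hence the union is open and measurable
  whatever \<open>B\<close> is, in particular for a projection.\<close>

definition grid_exterior :: "nat \<Rightarrow> nat \<Rightarrow> (nat \<Rightarrow> nat \<Rightarrow> real) set \<Rightarrow> (nat \<Rightarrow> nat \<Rightarrow> real) set" where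
  "grid_exterior N d B = (\<Union>(k, m) \<in> {(k, m). m \<in> PiE {..<N} (\<lambda>_. PiE {..<d} (\<lambda>_. UNIV)) \<and>
     grid_cell N d k m \<inter> B = {}}. grid_cell N d k m)"

lemma openin_grid_exterior: "openin (product_topology (\<lambda>_. top_n d) {..<N}) (grid_exterior N d B)"
proof -
  have "openin (product_topology (\<lambda>_. top_n d) {..<N}) (grid_cell N d k m)" for k m
    unfolding grid_cell_def by (auto simp: openin_PiE)
  then show ?thesis
    unfolding grid_exterior_def by (intro openin_Union) auto
qed

lemma sets_grid_exterior: "grid_exterior N d B \<in> sets (PiM {..<N} (\<lambda>_. lborel_n d))"
proof -
  have "countable (PiE {..<N} (\<lambda>_. PiE {..<d} (\<lambda>_. UNIV :: int set)))"
    by (intro countable_PiE) auto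
  then have "countable (UNIV \<times> PiE {..<N} (\<lambda>_. PiE {..<d} (\<lambda>_. UNIV :: int set)) :: (nat \<times> _) set)"
    by (intro countable_SIGMA) auto
  then have "countable {(k :: nat, m). m \<in> PiE {..<N} (\<lambda>_. PiE {..<d} (\<lambda>_. UNIV :: int set)) \<and>
     grid_cell N d k m \<inter> B = {}}"
    by (rule countable_subset[rotated]) auto
  moreover have "grid_cell N d k m \<in> sets (PiM {..<N} (\<lambda>_. lborel_n d))" for k m
    unfolding grid_cell_def by (intro sets_PiM_I_finite) auto
  ultimately show ?thesis
    unfolding grid_exterior_def by (intro sets.countable_UN') auto
qed

lemma grid_exterior_disjoint: "grid_exterior N d B \<inter> B = {}"
  unfolding grid_exterior_def by auto

lemma grid_exterior_subset: "grid_exterior N d B \<subseteq> PiE {..<N} (\<lambda>_. Rn d)"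
  unfolding grid_exterior_def grid_cell_def by (force simp: PiE_iff)

text \<open>A cube of side less than \<open>\<epsilon>\<close> that contains z consists of points
  within \<open>\<epsilon>\<close> of z and so misses \<open>B\<close>.\<close>

lemma in_grid_exterior:
  assumes z: "z \<in> PiE {..<N} (\<lambda>_. Rn d)" and "\<epsilon> > 0"
    and B: "\<And>z'. (\<And>i j. i < N \<Longrightarrow> j < d \<Longrightarrow> \<bar>z i j - z' i j\<bar> < \<epsilon>) \<Longrightarrow> z' \<notin> B"
  shows "z \<in> grid_exterior N d B"
proof -
  obtain k :: nat where k: "2 / real (Suc k) < \<epsilon>"
    using reals_Archimedean[of "\<epsilon> / 2"] assms(2) by (auto simp: field_simps)
  \<comment> \<open>Cubes reach one lattice step to either side of their centre, so rounding down
    puts z strictly inside.\<close>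
  define m where "m = (\<lambda>i\<in>{..<N}. \<lambda>j\<in>{..<d}. \<lfloor>z i j * real (Suc k)\<rfloor>)"
  have m: "m \<in> PiE {..<N} (\<lambda>_. PiE {..<d} (\<lambda>_. UNIV))"
    by (simp add: m_def)
  have "(m i j - 1) / real (Suc k) < z i j \<and> z i j < (m i j + 1) / real (Suc k)"
    if "i < N" "j < d" for i j
  proof -
    have "m i j - 1 < z i j * real (Suc k)" "z i j * real (Suc k) < m i j + 1"
      using that unfolding m_def by (simp; linarith)+
    then show ?thesis
      by (simp only: divide_less_eq less_divide_eq) simp
  qed
  then have "z \<in> grid_cell N d k m"
    using z unfolding grid_cell_def by (auto simp: PiE_iff)
  moreover have "grid_cell N d k m \<inter> B = {}"
  proof (rule ccontr)
    assume "grid_cell N d k m \<inter> B \<noteq> {}"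
    then obtain z' where z': "z' \<in> grid_cell N d k m" "z' \<in> B"
      by blast
    have "\<bar>z i j - z' i j\<bar> < \<epsilon>" if "i < N" "j < d" for i j
    proof -
      have "w i j \<in> {(m i j - 1) / real (Suc k) <..< (m i j + 1) / real (Suc k)}" if "w \<in> grid_cell N d k m" for w
        using that \<open>i < N\<close> \<open>j < d\<close> unfolding grid_cell_def by (auto simp: PiE_iff)
      from this[OF \<open>z \<in> grid_cell N d k m\<close>] this[OF z'(1)]
      have "\<bar>z i j - z' i j\<bar> < (m i j + 1) / real (Suc k) - (m i j - 1) / real (Suc k)"
        by auto
      also have "\<dots> = 2 / real (Suc k)"
        by (simp add: diff_divide_distrib[symmetric])
      finally show ?thesis
        using k by simp
    qed
    with B z'(2) show False by blast
  qed
  ultimately show ?thesis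
    using m unfolding grid_exterior_def by blast
qed

section \<open>Networks against polynomials\<close>

text \<open>All weights are stored in one environment through a pairing code, index 0 holding the bias.\<close>
definition layer_params :: "nat \<Rightarrow> (nat \<Rightarrow> real) \<Rightarrow> (nat \<Rightarrow> nat \<Rightarrow> real) \<times> (nat \<Rightarrow> real)" where
  "layer_params l u = ((\<lambda>j i. u (prod_encode (l, prod_encode (j, Suc i)))),
     (\<lambda>j. u (prod_encode (l, prod_encode (j, 0)))))"

definition net_params :: "nat \<Rightarrow> (nat \<Rightarrow> real) \<Rightarrow> ((nat \<Rightarrow> nat \<Rightarrow> real) \<times> (nat \<Rightarrow> real)) list" where
  "net_params K u = map (\<lambda>l. layer_params l u) [0..<K]"

lemma net_params_surj:
  assumes "length \<theta> = K"
  obtains u where "net_params K u = \<theta>"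
proof
  let ?u = "\<lambda>k. case prod_decode k of (l, r) \<Rightarrow> (case prod_decode r of (j, i) \<Rightarrow>
    (case i of 0 \<Rightarrow> snd (\<theta> ! l) j | Suc i \<Rightarrow> fst (\<theta> ! l) j i))"
  show "net_params K ?u = \<theta>"
    by (rule nth_equalityI) (use assms in \<open>simp_all add: net_params_def layer_params_def\<close>)
qed

text \<open>Since outputs are extensional, agreement in the coordinates below the output dimension
  is equality of functions.\<close>

lemma nn_response_Rn:
  assumes "length ds \<ge> 2" "length \<theta> = length ds - 1"
  shows "nn_response \<psi> ds \<theta> x \<in> Rn (last ds)"
  using assms
proof (induction \<theta> arbitrary: ds x)
  case (Cons w \<theta>)
  then consider d0 d1 where "ds = [d0, d1]" "\<theta> = []"
    | d0 d1 d2 ds' where "ds = d0 # d1 # d2 # ds'"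
    by (cases ds rule: remdups_adj.cases; cases "tl (tl ds)") auto
  then show ?case
  proof cases
    case 1
    then show ?thesis
      by (simp add: nn_response_layers affine_layer_def PiE_iff extensional_def)
  next
    case (2 d0 d1 d2 ds')
    have "nn_response \<psi> (d1 # d2 # ds') \<theta> y \<in> Rn (last (d1 # d2 # ds'))" for y
      by (rule Cons.IH) (use Cons.prems 2 in auto)
    then show ?thesis
      by (simp add: 2 nn_response_layers)
  qed
qed simp

lemma concat_nth_block:
  assumes "\<And>x. x \<in> set zs \<Longrightarrow> length x = d" "i < length zs" "j < d"
  shows "concat zs ! (i * d + j) = zs ! i ! j"
  using assms
proof (induction zs arbitrary: i)
  case (Cons x zs)
  show ?case
  proof (cases i)
    case 0
    then show ?thesis
      using Cons.prems by (simp add: nth_append)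
  next
    case (Suc i')
    then have "concat zs ! (i' * d + j) = zs ! i' ! j"
      using Cons by simp
    moreover have "length x = d"
      using Cons.prems(1) by simp
    ultimately show ?thesis
      using Suc by (simp add: nth_append)
  qed
qed simp

lemma length_concat_block:
  "(\<And>x. x \<in> set zs \<Longrightarrow> length x = d) \<Longrightarrow> length (concat zs) = length zs * d"
  by (induction zs) auto

lemma linear_growth_id: "linear_growth (\<lambda>t. t)"
  unfolding linear_growth_def by (intro exI[of _ 1]) simp

lemma mpoly_eval_cong: "(\<And>i. i < n \<Longrightarrow> x i = y i) \<Longrightarrow> mpoly_eval n c x = mpoly_eval n c y"
  unfolding mpoly_eval_def by (intro sum.cong refl arg_cong2[where f = "(*)"] prod.cong) auto

context ominimal_structure begin

text \<open>It bounds the relevant environment entries without any look at the pairing code that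
  stores the weights.\<close>

lemma definable_finite_dependence:
  assumes "definable P"
  shows "\<exists>n. \<forall>e e'. (\<forall>i<n. e i = e' i) \<longrightarrow> P e = P e'"
proof -
  obtain n A where A: "\<And>e. P e \<longleftrightarrow> map e [0..<n] \<in> A"
    using assms unfolding definable_def by blast
  have "P e = P e'" if "\<forall>i<n. e i = e' i" for e e'
  proof -
    have "map e [0..<n] = map e' [0..<n]"
      using that by simp
    then show ?thesis
      by (simp only: A)
  qed
  then show ?thesis by blast
qed

lemma definable_term_mpoly_eval:
  assumes "mpoly_coeffs n c" "\<And>i. definable_term (\<lambda>e. t e i)"
  shows "definable_term (\<lambda>e. mpoly_eval n c (t e))"
  unfolding mpoly_eval_def using assms(1) unfolding mpoly_coeffs_def
  by (intro definable_term_sum definable_term_mult definable_term_const definable_term_prod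
      definable_term_power assms(2)) auto

lemma definable_term_restrict:
  assumes "\<And>i. definable_term (\<lambda>e. t e i)"
  shows "definable_term (\<lambda>e. (\<lambda>i\<in>I. t e i) j)"
  using assms by (cases "j \<in> I") (simp_all add: definable_term_const)

end

locale polynomial_network =
  fixes \<psi> :: "real \<Rightarrow> real" and ds :: "nat list"
    and f :: "(nat \<Rightarrow> real) \<Rightarrow> (nat \<Rightarrow> real)" and c :: "nat \<Rightarrow> (nat \<Rightarrow> nat) \<Rightarrow> real"
  assumes len: "length ds \<ge> 2" and pos: "\<forall>d\<in>set ds. d > 0"
    and SAD: "SAD \<psi>"
    and f: "poly_map_coeffs (hd ds) (last ds) c f"
    and deg: "poly_map_deg_ge2 (hd ds) (last ds) c"
begin

abbreviation "d \<equiv> hd ds"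
abbreviation "m \<equiv> last ds"
abbreviation "resp u \<equiv> nn_response \<psi> ds (net_params (length ds - 1) u)"

text \<open>The coefficients are used instead of \<open>f\<close>, which is specified on
  \<open>Rn d\<close> only; this makes the relation definable on arbitrary environments.\<close>

definition fits :: "(nat \<Rightarrow> real) \<Rightarrow> (nat \<Rightarrow> real) \<Rightarrow> bool" where
  "fits u x \<longleftrightarrow> (\<forall>j<m. resp u x j = mpoly_eval d (c j) x)"

lemma d_pos: "d > 0"
  using pos len by (cases ds) auto

lemma coeffs: "j < m \<Longrightarrow> mpoly_coeffs d (c j)"
  using f by (simp add: poly_map_coeffs_def)

lemma fits_iff: "x \<in> Rn d \<Longrightarrow> fits u x \<longleftrightarrow> resp u x = f x"
proof -
  assume x: "x \<in> Rn d"
  have r: "resp u x \<in> Rn m"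
    by (rule nn_response_Rn) (use len in \<open>auto simp: net_params_def\<close>)
  have fx: "f x \<in> Rn m" "\<forall>j<m. f x j = mpoly_eval d (c j) x"
    using f x by (simp_all add: poly_map_coeffs_def)
  show "fits u x \<longleftrightarrow> resp u x = f x"
  proof
    assume "fits u x"
    then show "resp u x = f x"
      using fx by (intro PiE_ext[OF r]) (auto simp: fits_def)
  qed (use fx(2) in \<open>simp add: fits_def\<close>)
qed

text \<open>For fixed parameters the weights are constants, so closure under scalar multiples
  replaces closure under products.\<close>

lemma resp_closure:
  assumes "\<And>g h. C g \<Longrightarrow> C h \<Longrightarrow> C (\<lambda>p. g p + h p)"
    and "\<And>r g. C g \<Longrightarrow> C (\<lambda>p. r * g p)"
    and const: "\<And>r. C (\<lambda>_. r)"
    and "\<And>g. C g \<Longrightarrow> C (\<lambda>p. \<psi> (g p))"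
    and "\<And>i. C (\<lambda>p. x p i)"
  shows "C (\<lambda>p. resp u (x p) j)"
proof -
  have "C (\<lambda>p. nn_response \<psi> ds (map (\<lambda>w. w p) (map (\<lambda>w _. w) (net_params (length ds - 1) u))) (x p) j)"
    by (rule nn_response_closure[where W = "\<lambda>w. \<exists>r. w = (\<lambda>_. r)"]) (use assms in auto)
  then show ?thesis
    by (simp add: comp_def)
qed

lemma locally_holomorphic_act: "locally_holomorphic \<psi>"
  using SAD by (intro real_analytic_locally_holomorphic) (simp add: SAD_def)

lemma act_bound: "\<exists>K. \<forall>y. \<bar>\<psi> y\<bar> \<le> K * (1 + \<bar>y\<bar>)"
  using SAD locally_holomorphic_isCont[OF locally_holomorphic_act]
  by (intro sublinear_bound) (simp_all add: SAD_def)

lemma generic_not_fits: "generic_vec d (\<lambda>xs. \<not> fits u (vec d xs))"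
proof -
  obtain j \<alpha> where j: "j < m" "c j \<alpha> \<noteq> 0" "(\<Sum>i<d. \<alpha> i) \<ge> 2"
    using deg unfolding poly_map_deg_ge2_def by blast
  \<comment> \<open>The difference is written as a sum with a multiple by -1, the operations for
    which analyticity is available.\<close>
  define G where "G xs = resp u (vec d xs) j + - 1 * mpoly_eval d (c j) (vec d xs)" for xs
  have "locally_holomorphic (\<lambda>t. G (xs @ t # ys))" if "Suc (length xs + length ys) = d" for xs ys
  proof -
    have coord: "locally_holomorphic (\<lambda>t. vec d (xs @ t # ys) i)" for i
    proof -
      consider "i < length xs" | "i = length xs" | "length xs < i" "i < d" | "d \<le> i"
        using that by linarith
      then show ?thesis
      proof cases
        case 2
        with that show ?thesis
          by (simp add: locally_holomorphic_id)
      next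
        case 3
        then obtain k where "i - length xs = Suc k"
          by (metis Suc_diff_Suc)
        with 3 show ?thesis
          by (simp add: nth_append locally_holomorphic_const)
      qed (use that in \<open>simp_all add: nth_append locally_holomorphic_const\<close>)
    qed
    have "locally_holomorphic (\<lambda>t. resp u (vec d (xs @ t # ys)) j)"
    proof (rule resp_closure[where C = locally_holomorphic and x = "\<lambda>t. vec d (xs @ t # ys)"])
      show "locally_holomorphic (\<lambda>t. \<psi> (g t))" if "locally_holomorphic g" for g
        by (rule locally_holomorphic_compose[OF locally_holomorphic_act that])
    qed (simp_all only: coord locally_holomorphic_add locally_holomorphic_mult locally_holomorphic_const)
    moreover have "locally_holomorphic (\<lambda>t. mpoly_eval d (c j) (vec d (xs @ t # ys)))"
      using coeffs[OF j(1)] unfolding mpoly_eval_def mpoly_coeffs_def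
      by (intro locally_holomorphic_sum locally_holomorphic_mult locally_holomorphic_const
          locally_holomorphic_prod locally_holomorphic_power coord) auto
    ultimately show ?thesis
      unfolding G_def
      by (intro locally_holomorphic_add locally_holomorphic_mult[OF locally_holomorphic_const])
  qed
  moreover obtain zs where "length zs = d" "G zs \<noteq> 0"
  proof -
    obtain v where v: "\<not> linear_growth (\<lambda>t. mpoly_eval d (c j) (\<lambda>i. t * v i))"
      using mpoly_eval_not_linear_growth[OF coeffs[OF j(1)] j(2,3)] by blast
    obtain K where K: "\<And>y. \<bar>\<psi> y\<bar> \<le> K * (1 + \<bar>y\<bar>)"
      using act_bound by blast
    \<comment> \<open>The point t times v of the ray, as a list.\<close>
    define z where "z t = map (\<lambda>i. t * v i) [0..<d]" for t
    have coord: "linear_growth (\<lambda>t. vec d (z t) i)" for i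
      using linear_growth_cmult[OF linear_growth_id, of "v i"]
      by (cases "i < d") (simp_all add: z_def mult.commute linear_growth_const)
    have "linear_growth (\<lambda>t. resp u (vec d (z t)) j)"
    proof (rule resp_closure[where C = linear_growth and x = "\<lambda>t. vec d (z t)"])
      show "linear_growth (\<lambda>t. \<psi> (g t))" if "linear_growth g" for g
        by (rule linear_growth_compose[OF K that])
    qed (simp_all only: coord linear_growth_add linear_growth_cmult linear_growth_const)
    moreover have "mpoly_eval d (c j) (vec d (z t)) = mpoly_eval d (c j) (\<lambda>i. t * v i)" for t
      by (rule mpoly_eval_cong) (simp add: z_def)
    ultimately have "(\<lambda>t. resp u (vec d (z t)) j) \<noteq> (\<lambda>t. mpoly_eval d (c j) (vec d (z t)))"
      using v by auto
    then obtain t where "G (z t) \<noteq> 0"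
      unfolding G_def by auto
    then show thesis
      by (intro that[of "z t"]) (simp_all add: z_def)
  qed
  ultimately have "generic_vec d (\<lambda>xs. G xs \<noteq> 0)"
    by (rule separately_analytic_generic_nonzero)
  then show ?thesis
    by (rule iter_quant_mono[OF sigma_quant_cocountable]) (use j(1) in \<open>auto simp: G_def fits_def\<close>)
qed

section \<open>Definability of the fit relation\<close>

lemma ominimal_act: "\<exists>S. ominimal_structure S \<and> {[x, \<psi> x] |x. True} \<in> S 2"
  using SAD unfolding SAD_def definable_fun_def ominimal_structure_def by blast

text \<open>Parameters and input are both given by terms, so that either can be fixed, quantified,
  or placed anywhere in an environment.\<close>

lemma fits_definable:
  assumes "ominimal_structure S" "{[x, \<psi> x] |x. True} \<in> S 2"
    and s: "\<And>i. ominimal_structure.definable_term S (\<lambda>e. s e i)"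
    and t: "\<And>i. ominimal_structure.definable_term S (\<lambda>e. t e i)"
  shows "ominimal_structure.definable S (\<lambda>e. fits (s e) (t e))"
proof -
  interpret ominimal_structure S by fact
  have "definable_term (\<lambda>e. resp (s e) (t e) j)" for j
  proof -
    have "definable_term (\<lambda>e. nn_response \<psi> ds
        (map (\<lambda>w. w e) (map (\<lambda>l e. layer_params l (s e)) [0..<length ds - 1])) (t e) j)"
      by (rule nn_response_closure[where C = definable_term and W = definable_term])
        (auto intro: definable_term_add definable_term_mult definable_term_const
          definable_term_fun[OF assms(2)] s t simp: layer_params_def)
    then show ?thesis
      by (simp add: net_params_def comp_def)
  qed
  then show ?thesis
    unfolding fits_def
    by (intro definable_less_forall definable_eq definable_term_mpoly_eval coeffs t)
qed

text \<open>Parameters and input are interleaved at the even and odd positions of one environment; a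
  single predicate then covers all inputs, and the bound does not depend on the input.\<close>

lemma fits_finite_dependence:
  "\<exists>n. \<forall>u u' x. (\<forall>i<n. u i = u' i) \<longrightarrow> fits u x = fits u' x"
proof -
  obtain S where S: "ominimal_structure S" "{[x, \<psi> x] |x. True} \<in> S 2"
    using ominimal_act by blast
  interpret ominimal_structure S by fact
  have "definable (\<lambda>e. fits (\<lambda>k. e (2 * k)) (\<lambda>k. e (Suc (2 * k))))"
    by (rule fits_definable[OF S]) (rule definable_term_var)+
  from definable_finite_dependence[OF this] obtain n where n: "\<forall>e e'. (\<forall>i<n. e i = e' i) \<longrightarrow>
      fits (\<lambda>k. e (2 * k)) (\<lambda>k. e (Suc (2 * k))) = fits (\<lambda>k. e' (2 * k)) (\<lambda>k. e' (Suc (2 * k)))" ..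
  have "fits u x = fits u' x" if "\<forall>i<n. u i = u' i" for u u' x
  proof -
    let ?e = "\<lambda>w k. if even k then w (k div 2) else x (k div 2) :: real"
    have "?e u i = ?e u' i" if "i < n" for i
      using \<open>\<forall>i<n. u i = u' i\<close> that by auto
    then show ?thesis
      using n[rule_format, of "?e u" "?e u'"] by simp
  qed
  then show ?thesis by blast
qed

text \<open>In dimension one genericity is cocountability, so each fit set is countable and, being
  definable, finite. Dependence on finitely many parameters then permits the uniform bound.\<close>

lemma uniformly_finite_fits:
  assumes "d = 1"
  shows "\<exists>N. \<forall>u. finite {x. fits u (vec 1 [x])} \<and> card {x. fits u (vec 1 [x])} \<le> N"
proof -
  obtain S where S: "ominimal_structure S" "{[x, \<psi> x] |x. True} \<in> S 2"
    using ominimal_act by blast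
  interpret ominimal_structure S by fact
  let ?A = "\<lambda>u. {x. fits u (vec 1 [x])}"
  have def: "definable (\<lambda>e. fits (s e) (vec 1 [e 0]))" if "\<And>i. definable_term (\<lambda>e. s e i)" for s
  proof (rule fits_definable[OF S that])
    show "definable_term (\<lambda>e. vec 1 [e 0] i)" for i
      by (cases i) (simp_all add: definable_term_var definable_term_const)
  qed
  have fin: "finite (?A u)" for u
  proof (rule finite_if_countable)
    show "countable (?A u)"
      using generic_not_fits[of u] assms by (simp add: cocountable_def)
  qed (intro def definable_term_const)
  obtain n where n: "\<forall>u u' x. (\<forall>i<n. u i = u' i) \<longrightarrow> fits u x = fits u' x"
    using fits_finite_dependence ..
  have dep: "?A u = ?A u'" if "\<And>i. i < n \<Longrightarrow> u i = u' i" for u u'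
    by (intro Collect_cong n[rule_format] that)
  have "definable (\<lambda>e. e 0 \<in> ?A (\<lambda>i. e (Suc i)))"
    using def[of "\<lambda>e i. e (Suc i)"] by (simp add: definable_term_var)
  then have "\<exists>N. \<forall>u. card (?A u) \<le> N"
    by (rule uniform_finiteness[where A = ?A and d = n, OF _ fin dep])
  then show ?thesis
    using fin by simp
qed

text \<open>Two generic facts are combined: no parameter fits all N points, and a good tuple has a
  whole box of good tuples around it. The second is a statement about numbers, whence the
  flattening.\<close>

lemma generic_exterior:
  "\<exists>N>0. iter_quant (generic_vec d) N (\<lambda>zs. list_vec (vec d) N zs \<in>
     grid_exterior N d {z. \<exists>u. \<forall>i<N. fits u (\<lambda>j\<in>{..<d}. z i j)})"
proof -
  obtain S where S: "ominimal_structure S" "{[x, \<psi> x] |x. True} \<in> S 2"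
    using ominimal_act by blast
  interpret ominimal_structure S by fact
  note Q = sigma_quant_iter[OF sigma_quant_cocountable]
  obtain n where n: "\<forall>u u' x. (\<forall>i<n. u i = u' i) \<longrightarrow> fits u x = fits u' x"
    using fits_finite_dependence ..
  define N :: nat where "N = 2 ^ n"
  have "iter_quant (generic_vec d) N (\<lambda>zs. \<not> (\<exists>u. \<forall>x\<in>set zs. fits u (vec d x)))"
    unfolding N_def
  proof (rule generic_points_exclude_parameters[OF Q])
    show "definable (\<lambda>u. fits u (vec d x))" for x
      by (rule fits_definable[OF S]) (rule definable_term_var definable_term_const)+
    show "generic_vec d (\<lambda>x. \<not> fits u (vec d x))" for u
      by (rule generic_not_fits)
    show "fits u (vec d x) = fits u' (vec d x)" if "\<And>i. i < n \<Longrightarrow> u i = u' i" for u u' x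
      by (intro n[rule_format] that)
  qed
  moreover define R where "R ws \<longleftrightarrow> \<not> (\<exists>u. \<forall>i<N. fits u (\<lambda>j\<in>{..<d}. ws ! (i * d + j)))" for ws :: "real list"
  have block: "i * d + j < N * d" if "i < N" "j < d" for i j
  proof -
    have "i * d + j < Suc i * d"
      using that by simp
    also have "\<dots> \<le> N * d"
      using that by (intro mult_right_mono) auto
    finally show ?thesis .
  qed
  have "iter_quant (generic_vec d) N (\<lambda>zs. R (concat zs) \<longrightarrow>
      (\<exists>\<epsilon>>0. \<forall>ws. list_all2 (\<lambda>x y. \<bar>x - y\<bar> < \<epsilon>) (concat zs) ws \<longrightarrow> R ws))"
  proof (subst iter_quant_concat[where P = "\<lambda>xs. R xs \<longrightarrow>
      (\<exists>\<epsilon>>0. \<forall>ws. list_all2 (\<lambda>x y. \<bar>x - y\<bar> < \<epsilon>) xs ws \<longrightarrow> R ws)"], rule generic_interior)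
    \<comment> \<open>The points occupy the first \<open>N * d\<close> coordinates and the
      parameters all later ones, so quantifying over the tail is quantifying over the
      parameters.\<close>
    have "definable (\<lambda>e. \<forall>i<N. fits (\<lambda>k. e (N * d + k)) (\<lambda>j\<in>{..<d}. e (i * d + j)))"
      by (intro definable_less_forall fits_definable[OF S] definable_term_restrict definable_term_var)
    from definable_not[OF definable_ex_tail[OF this, of "N * d"]]
    have "definable (\<lambda>e. \<not> (\<exists>u. \<forall>i<N. fits (\<lambda>k. u k) (\<lambda>j\<in>{..<d}. if i * d + j < N * d then e (i * d + j) else u (i * d + j - N * d))))"
      by simp
    moreover have "(\<lambda>j\<in>{..<d}. if i * d + j < N * d then e (i * d + j) else u (i * d + j - N * d))
        = (\<lambda>j\<in>{..<d}. map e [0..<N * d] ! (i * d + j))" if "i < N" for i and e u :: "nat \<Rightarrow> real"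
      using block[OF that] by (intro restrict_ext) simp
    ultimately show "definable (\<lambda>e. R (map e [0..<N * d]))"
      by (simp add: R_def cong: conj_cong)
  qed
  moreover have "iter_quant (generic_vec d) N (\<lambda>zs. \<forall>x\<in>set zs. length x = d)"
    by (intro iter_quant_all[OF Q] iter_quant_length sigma_quant_cocountable)
  ultimately have "iter_quant (generic_vec d) N (\<lambda>zs. (\<not> (\<exists>u. \<forall>x\<in>set zs. fits u (vec d x))) \<and>
      (R (concat zs) \<longrightarrow> (\<exists>\<epsilon>>0. \<forall>ws. list_all2 (\<lambda>x y. \<bar>x - y\<bar> < \<epsilon>) (concat zs) ws \<longrightarrow> R ws)) \<and>
      (\<forall>x\<in>set zs. length x = d))"
    by (intro sigma_quant_conj[of "iter_quant (generic_vec d) N"] sigma_quant_iter[OF Q])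
  then have "iter_quant (generic_vec d) N (\<lambda>zs. list_vec (vec d) N zs \<in>
     grid_exterior N d {z. \<exists>u. \<forall>i<N. fits u (\<lambda>j\<in>{..<d}. z i j)})"
  proof (rule iter_quant_mono[OF Q], elim conjE)
    fix zs :: "real list list"
    assume lenN: "length zs = N" and no: "\<not> (\<exists>u. \<forall>x\<in>set zs. fits u (vec d x))"
      and near: "R (concat zs) \<longrightarrow> (\<exists>\<epsilon>>0. \<forall>ws. list_all2 (\<lambda>x y. \<bar>x - y\<bar> < \<epsilon>) (concat zs) ws \<longrightarrow> R ws)"
      and lend: "\<forall>x\<in>set zs. length x = d"
    have nth: "concat zs ! (i * d + j) = zs ! i ! j" if "i < N" "j < d" for i j
      by (rule concat_nth_block) (use lenN lend that in auto)
    have lenc: "length (concat zs) = N * d"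
      using length_concat_block[of zs d] lenN lend by simp
    have "(\<lambda>j\<in>{..<d}. concat zs ! (i * d + j)) = vec d (zs ! i)" if "i < N" for i
      using nth[OF that] by (intro restrict_ext) simp
    then have "fits u (vec d x)" if "\<forall>i<N. fits u (\<lambda>j\<in>{..<d}. concat zs ! (i * d + j))" "x \<in> set zs" for u x
      using that lenN by (metis in_set_conv_nth)
    then have "R (concat zs)"
      using no unfolding R_def by blast
    then obtain \<epsilon> where \<epsilon>: "\<epsilon> > 0" "\<And>ws. list_all2 (\<lambda>x y. \<bar>x - y\<bar> < \<epsilon>) (concat zs) ws \<Longrightarrow> R ws"
      using near by blast
    show "list_vec (vec d) N zs \<in> grid_exterior N d {z. \<exists>u. \<forall>i<N. fits u (\<lambda>j\<in>{..<d}. z i j)}"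
    proof (rule in_grid_exterior[OF _ \<epsilon>(1)])
      show "list_vec (vec d) N zs \<in> PiE {..<N} (\<lambda>_. Rn d)"
        by auto
      fix z' :: "nat \<Rightarrow> nat \<Rightarrow> real"
      assume close: "\<And>i j. i < N \<Longrightarrow> j < d \<Longrightarrow> \<bar>list_vec (vec d) N zs i j - z' i j\<bar> < \<epsilon>"
      \<comment> \<open>The flattening of \<open>z'\<close>; quotient and remainder modulo d recover
        the point and the coordinate, as d is positive.\<close>
      define ws where "ws = map (\<lambda>k. z' (k div d) (k mod d)) [0..<N * d]"
      have "list_all2 (\<lambda>x y. \<bar>x - y\<bar> < \<epsilon>) (concat zs) ws"
        unfolding list_all2_conv_all_nth
      proof (intro conjI allI impI)
        fix k assume "k < length (concat zs)"
        then have k: "k < N * d" "k div d < N" "k mod d < d"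
          using lenc d_pos by (simp_all add: less_mult_imp_div_less)
        show "\<bar>concat zs ! k - ws ! k\<bar> < \<epsilon>"
          using close[OF k(2,3)] nth[OF k(2,3)] k by (simp add: ws_def)
      qed (simp add: lenc ws_def)
      then have "R ws"
        by (rule \<epsilon>(2))
      moreover have "(\<lambda>j\<in>{..<d}. ws ! (i * d + j)) = (\<lambda>j\<in>{..<d}. z' i j)" if "i < N" for i
        using block[OF that] by (intro restrict_ext) (simp add: ws_def)
      ultimately show "z' \<notin> {z. \<exists>u. \<forall>i<N. fits u (\<lambda>j\<in>{..<d}. z i j)}"
        unfolding R_def by auto
    qed
  qed
  then show ?thesis
    by (intro exI[of _ N]) (simp add: N_def)
qed

section \<open>Positivity of the expected loss\<close>

lemma measurable_resp: "resp u \<in> measurable (lborel_n d) (lborel_n m)"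
proof -
  have coord: "(\<lambda>x. x i) \<in> borel_measurable (lborel_n d)" for i
  proof (cases "i < d")
    case False
    have "(\<lambda>x. x i) \<in> borel_measurable (lborel_n d) \<longleftrightarrow> (\<lambda>_. undefined :: real) \<in> borel_measurable (lborel_n d)"
      by (rule measurable_cong) (use False in \<open>auto simp: space_PiM PiE_iff extensional_def\<close>)
    then show ?thesis by simp
  qed simp
  have \<psi>: "\<psi> \<in> borel_measurable borel"
    using locally_holomorphic_isCont[OF locally_holomorphic_act]
    by (intro borel_measurable_continuous_onI continuous_at_imp_continuous_on) blast
  have "(\<lambda>x. resp u x j) \<in> borel_measurable (lborel_n d)" for j
    by (rule resp_closure[where C = "\<lambda>g. g \<in> borel_measurable (lborel_n d)"])
      (auto intro: coord measurable_compose[OF _ \<psi>])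
  moreover have "resp u x \<in> Rn m" for x
    by (rule nn_response_Rn) (use len in \<open>auto simp: net_params_def\<close>)
  ultimately show ?thesis
    using measurable_PiM_single'[of "{..<m}" "\<lambda>j x. resp u x j" "lborel_n d" "\<lambda>_. lborel"] by auto
qed

lemma measurable_f: "f \<in> measurable (lborel_n d) (lborel_n m)"
proof -
  have "(\<lambda>x. mpoly_eval d (c j) x) \<in> borel_measurable (lborel_n d)" for j
    unfolding mpoly_eval_def by measurable
  moreover have "(\<lambda>x. f x j) \<in> borel_measurable (lborel_n d)
      \<longleftrightarrow> (\<lambda>x. mpoly_eval d (c j) x) \<in> borel_measurable (lborel_n d)" if "j < m" for j
    by (rule measurable_cong) (use f that in \<open>auto simp: poly_map_coeffs_def space_PiM\<close>)
  ultimately show ?thesis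
    using measurable_PiM_single'[of "{..<m}" "\<lambda>j x. f x j" "lborel_n d" "\<lambda>_. lborel"] f
    by (auto simp: poly_map_coeffs_def space_PiM)
qed

lemma sets_not_fits: "{x \<in> Rn d. \<not> fits u x} \<in> sets (lborel_n d)"
proof -
  have "{x \<in> space (lborel_n d). \<exists>j\<in>{..<m}. resp u x j \<noteq> f x j} \<in> sets (lborel_n d)"
  proof (intro sets.sets_Collect_finite_Ex finite_lessThan)
    fix j assume j: "j \<in> {..<m}"
    have "(\<lambda>x. resp u x j) \<in> measurable (lborel_n d) lborel" "(\<lambda>x. f x j) \<in> measurable (lborel_n d) lborel"
      using measurable_compose[OF measurable_resp measurable_component_singleton[OF j]]
        measurable_compose[OF measurable_f measurable_component_singleton[OF j]] by simp_all
    then show "{x \<in> space (lborel_n d). resp u x j \<noteq> f x j} \<in> sets (lborel_n d)"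
      by (intro borel_measurable_neq) simp_all
  qed
  moreover have "{x \<in> space (lborel_n d). \<exists>j\<in>{..<m}. resp u x j \<noteq> f x j} = {x \<in> Rn d. \<not> fits u x}"
    using f by (auto simp: space_PiM fits_def poly_map_coeffs_def)
  ultimately show ?thesis by simp
qed

lemma AE_not_fits: "AE x in lborel_n d. x \<in> {x \<in> Rn d. \<not> fits u x}"
proof -
  let ?G = "{x \<in> Rn d. \<not> fits u x}"
  have sets: "space (lborel_n d) - ?G \<in> sets (lborel_n d)"
    using sets_not_fits by auto
  have "generic_vec d (\<lambda>xs. indicator (space (lborel_n d) - ?G) (vec d xs) = (0 :: ennreal))"
    by (rule iter_quant_mono[OF sigma_quant_cocountable generic_not_fits[of u]]) (auto simp: indicator_def)
  then have "(\<integral>\<^sup>+ x. indicator (space (lborel_n d) - ?G) x \<partial>lborel_n d) = 0"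
    using sets by (intro nn_integral_lborel_n_generic_null borel_measurable_indicator)
  then have "emeasure (lborel_n d) (space (lborel_n d) - ?G) = 0"
    using sets by (simp add: nn_integral_indicator)
  then show ?thesis
    using sets by (intro AE_I[of _ _ "space (lborel_n d) - ?G"]) auto
qed

text \<open>The loss is nonzero exactly off the fit set, so it suffices that \<open>\<mu>\<close>
  charges \<open>?G\<close>. With a positive weight on the atoms, one of the first N atoms lies in
  \<open>?G\<close>; otherwise \<open>\<mu>\<close> has a density and \<open>?G\<close> is
  conull.\<close>

lemma expected_loss_pos:
  assumes D: "\<And>z u. z \<in> D \<Longrightarrow> \<exists>i<N. \<not> fits u (z i)"
    and L: "measurable_loss m L" and \<mu>: "admissible_measure d N D \<mu>"
  shows "(\<integral>\<^sup>+ x. ennreal (L (resp u x) (f x)) \<partial>\<mu>) > 0"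
proof -
  let ?G = "{x \<in> Rn d. \<not> fits u x}"
  have prob: "prob_space \<mu>" and sets: "sets \<mu> = sets (lborel_n d)"
    using \<mu> by (simp_all add: admissible_measure_def)
  have space: "space \<mu> = Rn d"
    using sets_eq_imp_space_eq[OF sets] by (simp add: space_PiM)
  obtain lam :: real and n :: nat and x p where *: "0 \<le> lam \<and> lam \<le> 1 \<and> n \<ge> N \<and> n > 0 \<and>
      (\<forall>i<n. x i \<in> Rn d) \<and> restrict x {..<N} \<in> D \<and>
      p \<in> borel_measurable (lborel_n d) \<and> (\<forall>y\<in>Rn d. p y \<ge> 0) \<and>
      (\<forall>A\<in>sets (lborel_n d). emeasure \<mu> A =
        ennreal lam * ennreal (real (card {i. i < n \<and> x i \<in> A}) / real n)
          + ennreal (1 - lam) * (\<integral>\<^sup>+ y\<in>A. ennreal (p y) \<partial>lborel_n d))"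
    using \<mu>[unfolded admissible_measure_def, THEN conjunct2, THEN conjunct2] by (elim exE)
  have lam: "0 \<le> lam" and n: "N \<le> n" "0 < n" and x: "\<And>i. i < n \<Longrightarrow> x i \<in> Rn d" "restrict x {..<N} \<in> D"
    and em: "\<And>A. A \<in> sets (lborel_n d) \<Longrightarrow> emeasure \<mu> A =
        ennreal lam * ennreal (real (card {i. i < n \<and> x i \<in> A}) / real n)
             + ennreal (1 - lam) * (\<integral>\<^sup>+ y\<in>A. ennreal (p y) \<partial>lborel_n d)"
    using * by simp_all
  have pos: "emeasure \<mu> ?G \<noteq> 0"
  proof
    assume "emeasure \<mu> ?G = 0"
    then have zero: "ennreal lam * ennreal (real (card {i. i < n \<and> x i \<in> ?G}) / real n) = 0"
      "ennreal (1 - lam) * (\<integral>\<^sup>+ y\<in>?G. ennreal (p y) \<partial>lborel_n d) = 0"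
      using em[OF sets_not_fits[of u]] by simp_all
    show False
    proof (cases "lam = 0")
      case True
      \<comment> \<open>As the fit set is null, a vanishing integral of \<open>p\<close> over
        \<open>?G\<close> would make the total mass 0.\<close>
      have "(\<integral>\<^sup>+ y\<in>Rn d. ennreal (p y) \<partial>lborel_n d) = (\<integral>\<^sup>+ y\<in>?G. ennreal (p y) \<partial>lborel_n d)"
        by (rule nn_integral_cong_AE, use AE_not_fits[of u] in eventually_elim) (auto simp: indicator_def)
      also have "\<dots> = 0"
        using zero(2) True by simp
      finally have "emeasure \<mu> (Rn d) = 0"
        using em[of "Rn d"] True sets.top[of "lborel_n d"] by (simp add: space_PiM)
      then show False
        using prob_space.emeasure_space_1[OF prob] space by simp
    next
      case False
      obtain i where i: "i < N" "\<not> fits u (x i)"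
        using D[OF x(2), of u] by auto
      then have "i \<in> {i. i < n \<and> x i \<in> ?G}"
        using n(1) x(1) by auto
      then have "card {i. i < n \<and> x i \<in> ?G} > 0"
        by (subst card_gt_0_iff) auto
      then have "0 < real (card {i. i < n \<and> x i \<in> ?G}) / real n"
        using n(2) by simp
      then show False
        using zero(1) False lam by (simp add: ennreal_eq_0_iff)
    qed
  qed
  have meas: "(\<lambda>x. ennreal (L (resp u x) (f x))) \<in> borel_measurable \<mu>"
  proof -
    have "(\<lambda>x. (resp u x, f x)) \<in> measurable (lborel_n d) (lborel_n m \<Otimes>\<^sub>M lborel_n m)"
      by (intro measurable_Pair measurable_resp measurable_f)
    moreover have "(\<lambda>(u, v). L u v) \<in> borel_measurable (lborel_n m \<Otimes>\<^sub>M lborel_n m)"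
      using L by (simp add: measurable_loss_def)
    ultimately have "(\<lambda>x. L (resp u x) (f x)) \<in> borel_measurable (lborel_n d)"
      using measurable_compose by fastforce
    then have "(\<lambda>x. L (resp u x) (f x)) \<in> borel_measurable \<mu>"
      using measurable_cong_sets[OF sets refl] by blast
    then show ?thesis by simp
  qed
  have "{x \<in> space \<mu>. ennreal (L (resp u x) (f x)) \<noteq> 0} = ?G"
  proof -
    have "ennreal (L (resp u x) (f x)) \<noteq> 0 \<longleftrightarrow> \<not> fits u x" if "x \<in> Rn d" for x
    proof -
      have "resp u x \<in> Rn m"
        by (rule nn_response_Rn) (use len in \<open>auto simp: net_params_def\<close>)
      moreover have "f x \<in> Rn m"
        using f that by (simp add: poly_map_coeffs_def)
      ultimately have "L (resp u x) (f x) \<ge> 0" "L (resp u x) (f x) = 0 \<longleftrightarrow> resp u x = f x"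
        using L by (auto simp: measurable_loss_def loss_fun_def)
      then show ?thesis
        using fits_iff[OF that] by (auto simp: ennreal_eq_0_iff)
    qed
    then show ?thesis
      using space by auto
  qed
  with pos have "(\<integral>\<^sup>+ x. ennreal (L (resp u x) (f x)) \<partial>\<mu>) \<noteq> 0"
    using nn_integral_0_iff[OF meas] by simp
  then show ?thesis
    by (simp add: zero_less_iff_neq_zero)
qed

end

text \<open>In dimension one the set of tuples is prescribed; exhibiting it as a grid exterior gives
  openness and measurability from the general case.\<close>

lemma distinct_tuples_grid_exterior:
  "{z \<in> PiE {..<N} (\<lambda>_. Rn 1). \<forall>i<N. \<forall>j<N. i \<noteq> j \<longrightarrow> z i \<noteq> z j}
    = grid_exterior N 1 {z. \<exists>i<N. \<exists>j<N. i \<noteq> j \<and> z i 0 = z j 0}"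
  (is "?D = grid_exterior N 1 ?B")
proof
  show "?D \<subseteq> grid_exterior N 1 ?B"
  proof
    fix z assume z: "z \<in> ?D"
    have ne: "z i 0 \<noteq> z j 0" if "i < N" "j < N" "i \<noteq> j" for i j
    proof
      assume "z i 0 = z j 0"
      then have "z i = z j"
        using z that by (intro PiE_ext[of _ "{..<1}" "\<lambda>_. UNIV"]) auto
      with z that show False by blast
    qed
    \<comment> \<open>The gaps between coordinates, with 1 added so that a minimum exists even
      without pairs. Perturbations below half the smallest gap cannot make two coordinates
      meet.\<close>
    define E where "E = insert 1 ((\<lambda>(i, j). \<bar>z i 0 - z j 0\<bar>) ` {(i, j). i < N \<and> j < N \<and> i \<noteq> j})"
    have "finite {(i, j). i < N \<and> j < N \<and> i \<noteq> j}"
      by (rule finite_subset[of _ "{..<N} \<times> {..<N}"]) auto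
    then have fin: "finite E"
      by (simp add: E_def)
    have "Min E > 0"
      using fin ne by (subst Min_gr_iff) (auto simp: E_def)
    show "z \<in> grid_exterior N 1 ?B"
    proof (rule in_grid_exterior[of _ _ _ "Min E / 2"])
      fix z' :: "nat \<Rightarrow> nat \<Rightarrow> real"
      assume close: "\<And>i j. i < N \<Longrightarrow> j < 1 \<Longrightarrow> \<bar>z i j - z' i j\<bar> < Min E / 2"
      have "z' i 0 \<noteq> z' j 0" if "i < N" "j < N" "i \<noteq> j" for i j
      proof -
        have "Min E \<le> \<bar>z i 0 - z j 0\<bar>"
          using fin that by (intro Min_le) (auto simp: E_def)
        moreover have "\<bar>z i 0 - z' i 0\<bar> < Min E / 2" "\<bar>z j 0 - z' j 0\<bar> < Min E / 2"
          by (intro close that zero_less_one)+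
        ultimately show ?thesis
          by linarith
      qed
      then show "z' \<notin> ?B" by blast
    qed (use z \<open>Min E > 0\<close> in auto)
  qed
  show "grid_exterior N 1 ?B \<subseteq> ?D"
  proof
    fix z assume z: "z \<in> grid_exterior N 1 ?B"
    then have "z \<notin> ?B"
      using grid_exterior_disjoint[of N 1 ?B] by blast
    have "z i \<noteq> z j" if "i < N" "j < N" "i \<noteq> j" for i j
    proof
      assume "z i = z j"
      then have "z i 0 = z j 0" by simp
      with \<open>z \<notin> ?B\<close> that show False by blast
    qed
    with subsetD[OF grid_exterior_subset z] show "z \<in> ?D"
      by simp
  qed
qed

text \<open>Each new number only has to avoid the finitely many earlier ones.\<close>

lemma generic_distinct:
  "iter_quant (generic_vec 1) N (\<lambda>zs. list_vec (vec 1) N zs \<in>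
    {z \<in> PiE {..<N} (\<lambda>_. Rn 1). \<forall>i<N. \<forall>j<N. i \<noteq> j \<longrightarrow> z i \<noteq> z j})"
proof -
  have "iter_quant (generic_vec 1) N (\<lambda>zs. \<forall>i<N. \<forall>j<N. i \<noteq> j \<longrightarrow> zs ! i ! 0 \<noteq> zs ! j ! 0)"
  proof (induction N)
    case (Suc N)
    show ?case
      unfolding iter_quant_Suc_right
    proof (rule iter_quant_mono[OF sigma_quant_iter[OF sigma_quant_cocountable] Suc.IH])
      fix zs :: "real list list"
      assume len: "length zs = N" and zs: "\<forall>i<N. \<forall>j<N. i \<noteq> j \<longrightarrow> zs ! i ! 0 \<noteq> zs ! j ! 0"
      have "finite {x. \<not> x \<notin> (\<lambda>i. zs ! i ! 0) ` {..<N}}"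
        by simp
      then have "cocountable (\<lambda>x. x \<notin> (\<lambda>i. zs ! i ! 0) ` {..<N})"
        unfolding cocountable_def by (rule countable_finite)
      then have "cocountable (\<lambda>x. \<forall>i<Suc N. \<forall>j<Suc N. i \<noteq> j \<longrightarrow>
          (zs @ [[x]]) ! i ! 0 \<noteq> (zs @ [[x]]) ! j ! 0)"
        by (rule sigma_quant_mono[OF sigma_quant_cocountable])
          (use len zs in \<open>auto simp: nth_append less_Suc_eq\<close>)
      then show "generic_vec 1 (\<lambda>x. \<forall>i<Suc N. \<forall>j<Suc N. i \<noteq> j \<longrightarrow>
          (zs @ [x]) ! i ! 0 \<noteq> (zs @ [x]) ! j ! 0)"
        by simp
    qed
  qed simp
  then show ?thesis
  proof (rule iter_quant_mono[OF sigma_quant_iter[OF sigma_quant_cocountable]])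
    fix zs :: "real list list"
    assume zs: "\<forall>i<N. \<forall>j<N. i \<noteq> j \<longrightarrow> zs ! i ! 0 \<noteq> zs ! j ! 0"
    have "vec 1 (zs ! i) \<noteq> vec 1 (zs ! j)" if "i < N" "j < N" "i \<noteq> j" for i j
      using zs that by (auto dest: fun_cong[of _ _ 0])
    then show "list_vec (vec 1) N zs \<in>
      {z \<in> PiE {..<N} (\<lambda>_. Rn 1). \<forall>i<N. \<forall>j<N. i \<noteq> j \<longrightarrow> z i \<noteq> z j}"
      by auto
  qed
qed

context polynomial_network begin

text \<open>In dimension one, pigeonhole with one point more than the uniform bound M on fit sets;
  otherwise the exterior of the tuples that some parameter fits. Both sets are grid exteriors, so
  the topological and measure-theoretic claims are the same for both.\<close>

lemma exists_good_tuples: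
  "\<exists>N B. (\<forall>z\<in>grid_exterior N d B. \<forall>u. \<exists>i<N. \<not> fits u (z i)) \<and>
     iter_quant (generic_vec d) N (\<lambda>zs. list_vec (vec d) N zs \<in> grid_exterior N d B) \<and>
     (d = 1 \<longrightarrow> grid_exterior N d B
        = {z \<in> PiE {..<N} (\<lambda>_. Rn d). \<forall>i<N. \<forall>j<N. i \<noteq> j \<longrightarrow> z i \<noteq> z j})"
proof (cases "d = 1")
  case True
  obtain M where M: "\<And>u. finite {x. fits u (vec 1 [x])}" "\<And>u. card {x. fits u (vec 1 [x])} \<le> M"
    using uniformly_finite_fits[OF True] by blast
  let ?N = "Suc M"
  let ?B = "{z :: nat \<Rightarrow> nat \<Rightarrow> real. \<exists>i<?N. \<exists>j<?N. i \<noteq> j \<and> z i 0 = z j 0}"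
  have fails: "\<exists>i<?N. \<not> fits u (z i)" if z: "z \<in> grid_exterior ?N 1 ?B" for z u
  proof (rule ccontr)
    assume "\<not> (\<exists>i<?N. \<not> fits u (z i))"
    moreover have "z i = vec 1 [z i 0]" if "i < ?N" for i
      using PiE_mem[OF subsetD[OF grid_exterior_subset z], of i] that
      by (intro PiE_ext[of _ "{..<1}" "\<lambda>_. UNIV"]) auto
    ultimately have "(\<lambda>i. z i 0) ` {..<?N} \<subseteq> {x. fits u (vec 1 [x])}"
      by auto
    moreover have "inj_on (\<lambda>i. z i 0) {..<?N}"
      using z grid_exterior_disjoint[of ?N 1 ?B] unfolding inj_on_def by blast
    ultimately have "?N \<le> card {x. fits u (vec 1 [x])}"
      using card_inj_on_le[OF _ _ M(1)] by fastforce
    then show False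
      using M(2)[of u] by simp
  qed
  show ?thesis
    unfolding True
  proof (rule exI[of _ ?N], rule exI[of _ ?B], intro conjI ballI allI impI)
    show "iter_quant (generic_vec 1) ?N (\<lambda>zs. list_vec (vec 1) ?N zs \<in> grid_exterior ?N 1 ?B)"
      using generic_distinct[of ?N] unfolding distinct_tuples_grid_exterior .
  qed (rule fails distinct_tuples_grid_exterior[symmetric], assumption?)+
next
  case False
  obtain N where N: "iter_quant (generic_vec d) N (\<lambda>zs. list_vec (vec d) N zs \<in>
     grid_exterior N d {z. \<exists>u. \<forall>i<N. fits u (\<lambda>j\<in>{..<d}. z i j)})"
    using generic_exterior by blast
  let ?B = "{z. \<exists>u. \<forall>i<N. fits u (\<lambda>j\<in>{..<d}. z i j)}"
  have fails: "\<exists>i<N. \<not> fits u (z i)" if z: "z \<in> grid_exterior N d ?B" for z u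
  proof -
    have "(\<lambda>j\<in>{..<d}. z i j) = z i" if "i < N" for i
      using PiE_mem[OF subsetD[OF grid_exterior_subset z], of i] that
      by (simp add: PiE_restrict)
    moreover have "z \<notin> ?B"
      using z grid_exterior_disjoint[of N d ?B] by blast
    ultimately show ?thesis by auto
  qed
  show ?thesis
  proof (rule exI[of _ N], rule exI[of _ ?B], intro conjI ballI allI impI)
    show "iter_quant (generic_vec d) N (\<lambda>zs. list_vec (vec d) N zs \<in> grid_exterior N d ?B)"
      by (rule N)
  qed (rule fails, assumption, use False in simp)
qed

end

theorem theorem3p4:
  fixes \<psi> :: "real \<Rightarrow> real" and ds :: "nat list"
    and f :: "(nat \<Rightarrow> real) \<Rightarrow> (nat \<Rightarrow> real)" and c :: "nat \<Rightarrow> (nat \<Rightarrow> nat) \<Rightarrow> real"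
  assumes "length ds \<ge> 2" and "\<forall>d\<in>set ds. d > 0"
    and "SAD \<psi>"
    and "poly_map_coeffs (hd ds) (last ds) c f"
    and "poly_map_deg_ge2 (hd ds) (last ds) c"
  shows "\<exists>(N::nat) (D :: (nat \<Rightarrow> nat \<Rightarrow> real) set).
     D \<subseteq> PiE {..<N} (\<lambda>_. Rn (hd ds)) \<and>
     openin (product_topology (\<lambda>_. top_n (hd ds)) {..<N}) D \<and>
     (product_topology (\<lambda>_. top_n (hd ds)) {..<N}) closure_of D
        = topspace (product_topology (\<lambda>_. top_n (hd ds)) {..<N}) \<and>
     (AE z in PiM {..<N} (\<lambda>_. lborel_n (hd ds)). z \<in> D) \<and>
     (hd ds = 1 \<longrightarrow>
        D = {z \<in> PiE {..<N} (\<lambda>_. Rn (hd ds)). \<forall>i<N. \<forall>j<N. i \<noteq> j \<longrightarrow> z i \<noteq> z j}) \<and>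
     (\<forall>L \<mu>. measurable_loss (last ds) L \<longrightarrow> admissible_measure (hd ds) N D \<mu> \<longrightarrow>
        (\<forall>\<theta>. length \<theta> = length ds - 1 \<longrightarrow>
           (\<integral>\<^sup>+ x. ennreal (L (nn_response \<psi> ds \<theta> x) (f x)) \<partial>\<mu>) > 0))"
proof -
  interpret polynomial_network \<psi> ds f c
    using assms by unfold_locales
  from exists_good_tuples obtain N B where *: "(\<forall>z\<in>grid_exterior N (hd ds) B. \<forall>u. \<exists>i<N. \<not> fits u (z i)) \<and>
     iter_quant (generic_vec (hd ds)) N (\<lambda>zs. list_vec (vec (hd ds)) N zs \<in> grid_exterior N (hd ds) B) \<and>
     (hd ds = 1 \<longrightarrow> grid_exterior N (hd ds) B
        = {z \<in> PiE {..<N} (\<lambda>_. Rn (hd ds)). \<forall>i<N. \<forall>j<N. i \<noteq> j \<longrightarrow> z i \<noteq> z j})"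
    by (elim exE)
  have good: "\<exists>i<N. \<not> fits u (z i)" if "z \<in> grid_exterior N (hd ds) B" for z u
    using bspec[OF *[THEN conjunct1] that] by (rule spec)
  note generic = *[THEN conjunct2, THEN conjunct1] and one = *[THEN conjunct2, THEN conjunct2]
  show ?thesis
  proof (intro exI[of _ N] exI[of _ "grid_exterior N (hd ds) B"] conjI allI impI)
    show "grid_exterior N (hd ds) B \<subseteq> PiE {..<N} (\<lambda>_. Rn (hd ds))"
      by (rule grid_exterior_subset)
    show "openin (product_topology (\<lambda>_. top_n (hd ds)) {..<N}) (grid_exterior N (hd ds) B)"
      by (rule openin_grid_exterior)
    show "(product_topology (\<lambda>_. top_n (hd ds)) {..<N}) closure_of grid_exterior N (hd ds) B
        = topspace (product_topology (\<lambda>_. top_n (hd ds)) {..<N})"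
      by (rule closure_tuples_generic[OF generic])
    show "AE z in PiM {..<N} (\<lambda>_. lborel_n (hd ds)). z \<in> grid_exterior N (hd ds) B"
      by (rule AE_tuples_generic[OF sets_grid_exterior generic])
    show "grid_exterior N (hd ds) B
      = {z \<in> PiE {..<N} (\<lambda>_. Rn (hd ds)). \<forall>i<N. \<forall>j<N. i \<noteq> j \<longrightarrow> z i \<noteq> z j}" if "hd ds = 1"
      using one that by (rule mp)
    fix L \<mu> and \<theta> :: "((nat \<Rightarrow> nat \<Rightarrow> real) \<times> (nat \<Rightarrow> real)) list"
    assume L: "measurable_loss (last ds) L"
      and \<mu>: "admissible_measure (hd ds) N (grid_exterior N (hd ds) B) \<mu>"
      and "length \<theta> = length ds - 1"
    \<comment> \<open>Every parameter list of the right length is stored in some environment, so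
      nothing is lost by working with environments.\<close>
    then obtain u where u: "net_params (length ds - 1) u = \<theta>"
      using net_params_surj by blast
    show "(\<integral>\<^sup>+ x. ennreal (L (nn_response \<psi> ds \<theta> x) (f x)) \<partial>\<mu>) > 0"
      using expected_loss_pos[OF good L \<mu>, of u] unfolding u .
  qed
qed

end
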